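(* Let $n\ge1$ and let $\mathcal W'=\{W_i\}_{i=1}^n$ be the covering of $\mathbb C^n\setminus\{0\}$ given by $W_i=\{z_i\ne0\}$. Let $\theta$ be a $\bar\partial$-closed $(n,n-1)$-form on $\mathbb C^n\setminus\{0\}$ and $\gamma$ a cocycle in $C^{n-1}(\mathcal W';\mathscr O^{(n)})$. If the class of $\theta$ corresponds to the class of $\gamma$ under the canonical isomorphism $$H^{n,n-1}_{\bar\partial}(\mathbb C^n\setminus\{0\})\simeq H^{n-1}(\mathcal W';\mathscr O^{(n)}),$$ then $$\int_{S^{2n-1}}\theta=(-1)^{\frac{n(n-1)}2}\int_{\Gamma}\gamma .$$
   Context: $\mathbb C^n$ with coordinates $z_i=x_i+\sqrt{-1}y_i$ is oriented so that $(x_1,y_1,\dots,x_n,y_n)$ is positive. For $\varepsilon>0$, $S^{2n-1}=\partial R_1$ is the usually oriented boundary sphere of $R_1=\{z\in\mathbb C^n\mid\|z\|^2\le n\varepsilon^2\}$. Also $\Gamma=\{z\in\mathbb C^n\mid|z_i|=\varepsilon,\ i=1,\dots,n\}$, oriented so that $d\arg z_1\wedge\cdots\wedge d\arg z_n$ is positive. $\int_\Gamma\gamma$ means $\int_\Gamma\gamma_{1\dots n}$, where $\gamma_{1\dots n}$ is the component of $\gamma$ on $W_1\cap\cdots\cap W_n$. Canonical isomorphism: let $\mathscr E^{(p,q)}$ be the sheaf of $C^\infty$ $(p,q)$-forms and $\mathscr O^{(p)}$ the sheaf of holomorphic $p$-forms. Let $\mathscr E^{(p,q)}(\mathcal W')=\bigoplus_{q_1+q_2=q}C^{q_1}(\mathcal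 W';\mathscr E^{(p,q_2)})$ be the Čech–Dolbeault complex, with differential $\bar\vartheta=\check\delta+(-1)^{q_1}\bar\partial$ on the summand of index $q_1$, where $(\check\delta\sigma)_{\alpha_0\dots\alpha_{r+1}}=\sum_\nu(-1)^\nu\sigma_{\alpha_0\dots\widehat{\alpha_\nu}\dots\alpha_{r+1}}$. A $\bar\partial$-closed form $\omega$ is regarded as a cocycle in $C^0(\mathcal W';\mathscr E^{(p,q)})$, and a Čech cocycle $c\in C^q(\mathcal W';\mathscr O^{(p)})$ as a cocycle in $C^q(\mathcal W';\mathscr E^{(p,0)})$. The classes $[\omega]$ and $[c]$ correspond if and only if $\omega-c=\bar\vartheta\chi$ for some $\chi\in\mathscr E^{(p,q-1)}(\mathcal W')$. *)

theory Defs
  imports "HOL-Analysis.Analysis"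
begin

text \<open>
  The coordinates of \<open>\<complex>\<^sup>n\<close> are indexed by a finite linearly ordered type \<open>'n\<close> with \<open>n = CARD('n)\<close>;
  the order of \<open>'n\<close> is the order \<open>1 < \<dots> < n\<close> of the coordinates.
\<close>

definition index_list :: "'n::{finite,linorder} list" where
  "index_list = sorted_list_of_set UNIV"


subsection \<open>Smooth and holomorphic functions on open sets\<close>

fun Ck_on :: "nat \<Rightarrow> ('a::real_normed_vector \<Rightarrow> 'b::real_normed_vector) \<Rightarrow> 'a set \<Rightarrow> bool" where
  "Ck_on 0 f U \<longleftrightarrow> continuous_on U f"
| "Ck_on (Suc k) f U \<longleftrightarrow>
     (\<forall>x\<in>U. f differentiable (at x)) \<and>
     (\<forall>v. Ck_on k (\<lambda>x. frechet_derivative f (at x) v) U)"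

definition smooth_on :: "('a::real_normed_vector \<Rightarrow> 'b::real_normed_vector) \<Rightarrow> 'a set \<Rightarrow> bool" where
  "smooth_on f U \<longleftrightarrow> (\<forall>k. Ck_on k f U)"

definition holo_on :: "(complex^'n::finite \<Rightarrow> complex) \<Rightarrow> (complex^'n) set \<Rightarrow> bool" where
  "holo_on f U \<longleftrightarrow>
     (\<forall>z\<in>U. \<exists>D. (f has_derivative D) (at z) \<and> (\<forall>c v. D (c *s v) = c * D v))"

text \<open>\<open>\<partial>f/\<partial>(cnj z\<^sub>j) = (\<partial>f/\<partial>x\<^sub>j + \<i> \<partial>f/\<partial>y\<^sub>j) / 2\<close>\<close>

definition d_zbar :: "'n::finite \<Rightarrow> (complex^'n \<Rightarrow> complex) \<Rightarrow> complex^'n \<Rightarrow> complex" where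
  "d_zbar j f z =
     (frechet_derivative f (at z) (axis j 1) + \<i> * frechet_derivative f (at z) (axis j \<i>)) / 2"


subsection \<open>Differential forms\<close>

text \<open>
  A form on an open subset of \<open>\<complex>\<^sup>n\<close> is given by its coefficients: \<open>\<omega> z I J\<close> is the coefficient at \<open>z\<close>
  of \<open>dz\<^sub>I \<and> d(cnj z)\<^sub>J\<close>, the factors within \<open>I\<close> and within \<open>J\<close> being taken in increasing order.
  Values outside the open set under consideration are irrelevant.
\<close>

type_synonym 'n form = "complex^'n \<Rightarrow> 'n set \<Rightarrow> 'n set \<Rightarrow> complex"

text \<open>The degree \<open>q\<close> is an integer, so that for \<open>q < 0\<close> only the zero form has bidegree \<open>(p, q)\<close>.\<close>

definition smooth_form :: "nat \<Rightarrow> int \<Rightarrow> (complex^'n::finite) set \<Rightarrow> 'n form \<Rightarrow> bool" where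
  "smooth_form p q U \<omega> \<longleftrightarrow>
     (\<forall>I J. smooth_on (\<lambda>z. \<omega> z I J) U) \<and>
     (\<forall>z\<in>U. \<forall>I J. \<omega> z I J \<noteq> 0 \<longrightarrow> card I = p \<and> int (card J) = q)"

definition holo_form :: "nat \<Rightarrow> (complex^'n::finite) set \<Rightarrow> 'n form \<Rightarrow> bool" where
  "holo_form p U \<omega> \<longleftrightarrow>
     (\<forall>I. holo_on (\<lambda>z. \<omega> z I {}) U) \<and>
     (\<forall>z\<in>U. \<forall>I J. \<omega> z I J \<noteq> 0 \<longrightarrow> card I = p \<and> J = {})"

text \<open>
  The sign moves \<open>d(cnj z)\<^sub>j\<close> first past \<open>dz\<^sub>I\<close> and then to its place in \<open>d(cnj z)\<^sub>J\<close>, in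
  \<open>\<partial>bar (f dz\<^sub>I \<and> d(cnj z)\<^sub>K) = (\<Sum>j. \<partial>f/\<partial>(cnj z\<^sub>j) d(cnj z)\<^sub>j \<and> dz\<^sub>I \<and> d(cnj z)\<^sub>K)\<close>, where \<open>K = J - {j}\<close>.
\<close>

definition dbar :: "'n::{finite,linorder} form \<Rightarrow> 'n form" where
  "dbar \<omega> z I J =
     (-1) ^ card I *
     (\<Sum>j\<in>J. (-1) ^ card {k\<in>J. k < j} * d_zbar j (\<lambda>w. \<omega> w I (J - {j})) z)"

text \<open>
  \<open>wedge [\<lambda>\<^sub>1, \<dots>, \<lambda>\<^sub>k] [v\<^sub>1, \<dots>, v\<^sub>k]\<close> is \<open>(\<lambda>\<^sub>1 \<and> \<dots> \<and> \<lambda>\<^sub>k)(v\<^sub>1, \<dots>, v\<^sub>k) = det (\<lambda>\<^sub>a v\<^sub>b)\<close>.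
\<close>

definition wedge :: "('v \<Rightarrow> complex) list \<Rightarrow> 'v list \<Rightarrow> complex" where
  "wedge ls vs =
     (\<Sum>\<pi> | \<pi> permutes {..<length ls}. of_int (sign \<pi>) * (\<Prod>a<length ls. (ls ! a) (vs ! \<pi> a)))"

definition dz_dzbar :: "'n::{finite,linorder} set \<Rightarrow> 'n set \<Rightarrow> ((complex, 'n) vec \<Rightarrow> complex) list" where
  "dz_dzbar I J =
     map (\<lambda>i v. v $ i) (sorted_list_of_set I) @ map (\<lambda>j v. cnj (v $ j)) (sorted_list_of_set J)"

definition form_eval :: "'n::{finite,linorder} form \<Rightarrow> (complex, 'n) vec \<Rightarrow> (complex, 'n) vec list \<Rightarrow> complex" where
  "form_eval \<omega> z vs =
     (\<Sum>(I, J) | card I + card J = length vs. \<omega> z I J * wedge (dz_dzbar I J) vs)"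


subsection \<open>Integrals\<close>

text \<open>
  Surface integral (against the area measure) over the sphere of radius \<open>R\<close> about the origin.
  The area of \<open>A \<subseteq> sphere 0 R\<close> is \<open>DIM('a) / R\<close> times the volume of the cone
  \<open>{t *\<^sub>R x | x \<in> A, 0 < t \<le> 1}\<close>; integration is therefore integration over the ball of the
  extension that is constant along rays.
\<close>

definition sphere_area_integral :: "real \<Rightarrow> ('a::euclidean_space \<Rightarrow> complex) \<Rightarrow> complex" where
  "sphere_area_integral R f =
     of_real (DIM('a) / R) * (LINT x:cball 0 R|lborel. f ((R / norm x) *\<^sub>R x))"

text \<open>The positive real basis \<open>\<partial>/\<partial>x\<^sub>1, \<partial>/\<partial>y\<^sub>1, \<dots>, \<partial>/\<partial>x\<^sub>n, \<partial>/\<partial>y\<^sub>n\<close>\<close>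

definition real_basis :: "(complex^'n::{finite,linorder}) list" where
  "real_basis = concat (map (\<lambda>i. [axis i 1, axis i \<i>]) index_list)"

text \<open>
  The value of a \<open>(2n-1)\<close>-form \<open>\<omega>\<close> at \<open>z\<close> on the positive unit tangent \<open>(2n-1)\<close>-vector of an oriented
  hypersurface with unit normal \<open>\<nu>\<close>, that is \<open>\<omega>\<^sub>z(e\<^sub>2, \<dots>, e\<^sub>2\<^sub>n)\<close> for any positive orthonormal basis
  \<open>(\<nu>, e\<^sub>2, \<dots>, e\<^sub>2\<^sub>n)\<close>. It equals \<open>(\<langle>\<nu>, \<cdot>\<rangle> \<and> \<omega>\<^sub>z)(\<nu>, e\<^sub>2, \<dots>, e\<^sub>2\<^sub>n)\<close>, which may be computed on any
  positive orthonormal basis; below it is expanded on \<open>real_basis\<close>.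
\<close>

definition tangential_value ::
  "'n::{finite,linorder} form \<Rightarrow> (complex, 'n) vec \<Rightarrow> (complex, 'n) vec \<Rightarrow> complex" where
  "tangential_value \<omega> z \<nu> =
     (\<Sum>k<length (real_basis :: (complex, 'n) vec list).
        (-1) ^ k * of_real (\<nu> \<bullet> (real_basis ! k)) *
        form_eval \<omega> z (take k real_basis @ drop (Suc k) real_basis))"

text \<open>
  Integral of a \<open>(2n-1)\<close>-form over \<open>sphere 0 R\<close>, oriented as the boundary of \<open>cball 0 R\<close>
  (outward normal first).
\<close>

definition sphere_integral :: "real \<Rightarrow> 'n::{finite,linorder} form \<Rightarrow> complex" where
  "sphere_integral R \<omega> = sphere_area_integral R (\<lambda>z. tangential_value \<omega> z ((1 / R) *\<^sub>R z))"

text \<open>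
  Integral of an \<open>n\<close>-form over the torus \<open>\<Gamma> = {z. \<forall>i. norm (z $ i) = \<epsilon>}\<close>, by pullback along
  \<open>t \<mapsto> (\<epsilon> exp(\<i> t\<^sub>1), \<dots>, \<epsilon> exp(\<i> t\<^sub>n))\<close>. Taking the partial derivatives in increasing order of the
  index makes \<open>d arg z\<^sub>1 \<and> \<dots> \<and> d arg z\<^sub>n\<close> positive.
\<close>

definition torus_map :: "real \<Rightarrow> real^'n::finite \<Rightarrow> complex^'n" where
  "torus_map \<epsilon> t = (\<chi> i. of_real \<epsilon> * cis (t $ i))"

definition torus_integral :: "real \<Rightarrow> 'n::{finite,linorder} form \<Rightarrow> complex" where
  "torus_integral \<epsilon> \<omega> =
     (LINT t:cbox 0 (\<chi> i. 2 * pi)|lborel.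
        form_eval \<omega> (torus_map \<epsilon> t)
          (map (\<lambda>j. frechet_derivative (torus_map \<epsilon>) (at t) (axis j 1)) index_list))"


subsection \<open>The Cech--Dolbeault complex of a covering\<close>

text \<open>
  A cochain of Cech degree \<open>r\<close> assigns a form on \<open>W\<^sub>\<alpha>\<^sub>0 \<inter> \<dots> \<inter> W\<^sub>\<alpha>\<^sub>r\<close> to every index tuple
  \<open>\<alpha> = [\<alpha>\<^sub>0, \<dots>, \<alpha>\<^sub>r]\<close>; there is no alternation condition. A family indexed by nonempty lists of all
  lengths describes an element of the product over all Cech degrees, its component of Cech degree
  \<open>r\<close> being the restriction to lists of length \<open>r + 1\<close>. The value at the empty list is irrelevant.
\<close>

type_synonym ('i, 'n) cochain = "'i list \<Rightarrow> 'n form"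

definition cover_inter :: "('i \<Rightarrow> 'a set) \<Rightarrow> 'i list \<Rightarrow> 'a set" where
  "cover_inter W \<alpha> = (\<Inter>i\<in>set \<alpha>. W i)"

definition cech_delta :: "('i, 'n) cochain \<Rightarrow> ('i, 'n) cochain" where
  "cech_delta \<sigma> \<alpha> z I J =
     (if length \<alpha> \<le> 1 then 0
      else \<Sum>\<nu><length \<alpha>. (-1) ^ \<nu> * \<sigma> (take \<nu> \<alpha> @ drop (Suc \<nu>) \<alpha>) z I J)"

definition holo_cochain ::
  "('i \<Rightarrow> (complex^'n::finite) set) \<Rightarrow> nat \<Rightarrow> nat \<Rightarrow> ('i, 'n) cochain \<Rightarrow> bool" where
  "holo_cochain W p r c \<longleftrightarrow> (\<forall>\<alpha>. length \<alpha> = r + 1 \<longrightarrow> holo_form p (cover_inter W \<alpha>) (c \<alpha>))"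

definition holo_cocycle ::
  "('i \<Rightarrow> (complex^'n::finite) set) \<Rightarrow> nat \<Rightarrow> nat \<Rightarrow> ('i, 'n) cochain \<Rightarrow> bool" where
  "holo_cocycle W p r c \<longleftrightarrow>
     holo_cochain W p r c \<and>
     (\<forall>\<alpha>. length \<alpha> = r + 2 \<longrightarrow>
        (\<forall>z\<in>cover_inter W \<alpha>. \<forall>I J. cech_delta c \<alpha> z I J = 0))"

text \<open>
  The \<open>(p, q)\<close>-term of the complex, in total degree \<open>q\<close>. On lists of length \<open>r + 1\<close> the component
  has bidegree \<open>(p, q - r)\<close>; it vanishes for \<open>r > q\<close>, so the direct sum runs over \<open>0 \<le> r \<le> q\<close> and
  is zero for \<open>q = -1\<close>.
\<close>

definition cd_cochain ::
  "('i \<Rightarrow> (complex^'n::finite) set) \<Rightarrow> nat \<Rightarrow> int \<Rightarrow> ('i, 'n) cochain \<Rightarrow> bool" where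
  "cd_cochain W p q \<xi> \<longleftrightarrow>
     (\<forall>\<alpha>. \<alpha> \<noteq> [] \<longrightarrow> smooth_form p (q - (int (length \<alpha>) - 1)) (cover_inter W \<alpha>) (\<xi> \<alpha>))"

definition cd_diff :: "('i, 'n::{finite,linorder}) cochain \<Rightarrow> ('i, 'n) cochain" where
  "cd_diff \<xi> \<alpha> z I J = cech_delta \<xi> \<alpha> z I J + (-1) ^ (length \<alpha> - 1) * dbar (\<xi> \<alpha>) z I J"

definition of_form :: "'n form \<Rightarrow> ('i, 'n) cochain" where
  "of_form \<omega> \<alpha> z I J = (if length \<alpha> = 1 then \<omega> z I J else 0)"

definition of_cech :: "nat \<Rightarrow> ('i, 'n) cochain \<Rightarrow> ('i, 'n) cochain" where
  "of_cech r c \<alpha> z I J = (if length \<alpha> = r + 1 then c \<alpha> z I J else 0)"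

definition classes_correspond ::
  "('i \<Rightarrow> (complex^'n::{finite,linorder}) set) \<Rightarrow> nat \<Rightarrow> nat \<Rightarrow> 'n form \<Rightarrow> ('i, 'n) cochain \<Rightarrow> bool" where
  "classes_correspond W p q \<omega> c \<longleftrightarrow>
     (\<exists>\<xi>. cd_cochain W p (int q - 1) \<xi> \<and>
       (\<forall>\<alpha>. \<alpha> \<noteq> [] \<longrightarrow> (\<forall>z\<in>cover_inter W \<alpha>. \<forall>I J.
          of_form \<omega> \<alpha> z I J - of_cech q c \<alpha> z I J = cd_diff \<xi> \<alpha> z I J)))"

definition coord_cover :: "'n \<Rightarrow> (complex^'n::finite) set" where
  "coord_cover i = {z. z $ i \<noteq> 0}"

end

theory Submission
  imports Defs "Jordan_Normal_Form.Determinant"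
begin

text \<open>
  Integrals over the sphere and the torus are smeared out into volume integrals, so that Stokes'
  theorem is only needed as integration by parts against compactly supported functions.
  Let \<open>u\<close> be a cutoff function equal to 1 near 0. As \<open>\<theta>\<close> is closed, \<open>\<integral> \<theta> \<and> \<partial>bar \<kappa>\<close> is the same for the
  radial cutoff \<open>\<kappa> = u(|z|\<^sup>2)\<close> and the polydisc cutoff \<open>\<kappa> = \<Prod>\<^sub>i u(|z\<^sub>i|\<^sup>2)\<close>. In the second case
  \<open>\<partial>bar \<kappa>\<close> is a sum of terms supported in the sets \<open>W\<^sub>i\<close>, where \<open>\<theta> = \<partial>bar \<chi>\<^sub>i\<close>; integrating by parts, the
  equations \<open>\<theta> - \<gamma> = D \<chi>\<close> are applied successively to \<open>\<chi>\<^sub>\<alpha>\<close> against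
  \<open>\<And>\<^sub>i\<^sub>\<in>\<^sub>\<alpha> \<partial>bar u(|z\<^sub>i|\<^sup>2) \<cdot> \<Prod>\<^sub>i\<^sub>\<notin>\<^sub>\<alpha> u(|z\<^sub>i|\<^sup>2)\<close>, and after \<open>n - 1\<close> steps only
  \<open>\<integral> \<gamma>\<^sub>1\<^sub>\<dots>\<^sub>n \<and> \<And>\<^sub>i \<partial>bar u(|z\<^sub>i|\<^sup>2)\<close> remains. Letting \<open>u\<close> tend to a step function
  turns the first integral into the integral of \<open>\<theta>\<close> over a sphere and the last one into the
  integral of \<open>\<gamma>\<^sub>1\<^sub>\<dots>\<^sub>n\<close> over the torus.
\<close>

hide_const (open) Finite_Cartesian_Product.mat Determinants.det
no_notation vec_index (infixl "$" 100)
no_notation scalar_prod (infix "\<bullet>" 70)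

subsection \<open>Integration by parts\<close>

text \<open>The cocycle data are only defined off coordinate hyperplanes. Each integration by parts
  in z_j puts a derivative on the cutoff of z_j, which confines the new integrand to z_j \<noteq> 0,
  where the next datum lives. Every factor of the polydisc cutoff is differentiated at most once, so
  C^1 cutoffs given by an explicit formula suffice. Cochains need not alternate. Only increasing
  index tuples are used, one for each nonempty set A of indices, and only the component I = UNIV, J
  = - A of the equation at A. The limit is taken in two stages. For fixed h, d \<rightarrow> 0 gives
  an exact identity between an integral over a spherical shell, divided by h, and one over a product
  of n annuli, divided by h^n; then h \<rightarrow> 0. Shells are measured in squared radius, which
  makes their volumes simple. All signs of the descent cancel. The sign (-1)^(n(n-1)/2) arises only
  on the sphere, where dz_1, ..., dz_n, d(cnj z_1), ..., d(cnj z_n) is compared with x_1, y_1, ...,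
  x_n, y_n. The factor (2 i)^n found there meets (1/2)^n from the annuli and leaves the i^n of the
  torus.\<close>

lemma continuous_on_mult_cutoff:
  fixes \<phi> \<psi> :: "'a::topological_space \<Rightarrow> complex"
  assumes "open U" "continuous_on U \<phi>" "continuous_on UNIV \<psi>"
    and "closed C" "C \<subseteq> U" "\<And>x. x \<notin> C \<Longrightarrow> \<psi> x = 0"
  shows "continuous_on UNIV (\<lambda>x. \<phi> x * \<psi> x)"
proof -
  have "continuous_on U (\<lambda>x. \<phi> x * \<psi> x)"
    using assms by (auto intro!: continuous_on_mult intro: continuous_on_subset)
  moreover have "continuous_on (- C) (\<lambda>x. \<phi> x * \<psi> x)"
    by (rule continuous_on_eq[of _ "\<lambda>_. 0"]) (use assms in auto)
  ultimately have "continuous_on (U \<union> - C) (\<lambda>x. \<phi> x * \<psi> x)"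
    using assms by (intro continuous_on_open_Un) auto
  moreover have "U \<union> - C = UNIV" using assms by auto
  ultimately show ?thesis by simp
qed

lemma integrable_compact_support:
  fixes f :: "'a::euclidean_space \<Rightarrow> complex"
  assumes "continuous_on UNIV f" "compact C" "\<And>x. x \<notin> C \<Longrightarrow> f x = 0"
  shows "integrable lborel f"
proof -
  have "integrable lborel (\<lambda>x. indicator C x *\<^sub>R f x)"
    using assms by (intro borel_integrable_compact) (auto intro: continuous_on_subset)
  also have "(\<lambda>x. indicator C x *\<^sub>R f x) = f"
    using assms(3) by (auto simp: indicator_def)
  finally show ?thesis .
qed

lemma borel_measurable_extend_zero:
  fixes f :: "'a::euclidean_space \<Rightarrow> complex"
  assumes "open U" "continuous_on U f" "\<And>x. x \<notin> U \<Longrightarrow> f x = 0"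
  shows "f \<in> borel_measurable borel"
proof -
  have "(\<lambda>x. indicator U x *\<^sub>R f x) \<in> borel_measurable borel"
    by (rule borel_measurable_continuous_on_indicator) (use assms in auto)
  also have "(\<lambda>x. indicator U x *\<^sub>R f x) = f"
    using assms(3) by (intro ext) (auto simp: indicator_def)
  finally show ?thesis .
qed

lemma integral_lborel_translation:
  fixes f :: "'a::euclidean_space \<Rightarrow> complex"
  assumes "f \<in> borel_measurable borel"
  shows "(LINT x|lborel. f (x + c)) = (LINT x|lborel. f x)"
proof -
  have "(LINT x|lborel. f x) = (LINT x|distr lborel borel ((+) c). f x)"
    by (simp add: lborel_distr_plus)
  also have "\<dots> = (LINT x|lborel. f (c + x))"
    using assms by (intro integral_distr) auto
  finally show ?thesis by (simp add: add.commute)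
qed

text \<open>The increment \<open>f (x + v) - f x\<close> is the integral of \<open>g\<close> along
  the segment from x to x + v. Integrated over x it gives 0 by translation invariance, and by Fubini
  it also gives the integral of \<open>g\<close>. This is the only form of Stokes' theorem in the
  proof.\<close>

lemma integral_directional_derivative_eq_0:
  fixes f g :: "'a::euclidean_space \<Rightarrow> complex"
  assumes cf: "continuous_on UNIV f" and cg: "continuous_on UNIV g"
    and C: "compact C" "\<And>x. x \<notin> C \<Longrightarrow> f x = 0" "\<And>x. x \<notin> C \<Longrightarrow> g x = 0"
    and der: "\<And>x. ((\<lambda>t::real. f (x + t *\<^sub>R v)) has_vector_derivative g x) (at 0)"
  shows "(LINT x|lborel. g x) = 0"
proof -
  have der': "((\<lambda>t::real. f (x + t *\<^sub>R v)) has_vector_derivative g (x + s *\<^sub>R v)) (at s)" for x s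
  proof -
    have "((\<lambda>t. f ((x + s *\<^sub>R v) + t *\<^sub>R v)) \<circ> (\<lambda>t. t - s) has_vector_derivative 1 *\<^sub>R g (x + s *\<^sub>R v)) (at s)"
      by (rule vector_diff_chain_at) (auto intro!: der derivative_eq_intros)
    then show ?thesis by (simp add: o_def algebra_simps)
  qed
  have [measurable]: "f \<in> borel_measurable borel" "g \<in> borel_measurable borel"
    using cf cg by (simp_all add: borel_measurable_continuous_onI)
  have intf: "integrable lborel f" and intg: "integrable lborel g"
    using integrable_compact_support[OF cf] integrable_compact_support[OF cg] C by auto
  have FTC: "(LINT t|lborel. indicator {0..1} t *\<^sub>R g (x + t *\<^sub>R v)) = f (x + v) - f x" for x
  proof -
    have "(LINT t|lborel. indicator {0..1} t *\<^sub>R g (x + t *\<^sub>R v)) = f (x + 1 *\<^sub>R v) - f (x + 0 *\<^sub>R v)"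
    proof (rule integral_FTC_atLeastAtMost)
      show "continuous_on {0..1} (\<lambda>t. g (x + t *\<^sub>R v))"
        by (rule continuous_on_compose2[OF cg]) (auto intro!: continuous_intros)
    qed (auto intro: has_vector_derivative_at_within[OF der'])
    then show ?thesis by simp
  qed
  let ?F = "\<lambda>x t. indicator {0..1::real} t *\<^sub>R g (x + t *\<^sub>R v)"
  have int2: "integrable (lborel \<Otimes>\<^sub>M lborel) (\<lambda>(x, t). ?F x t)"
  proof -
    \<comment> \<open>The pairs (x, t) with x + t v in \<open>C\<close> and t in [0, 1] form a
      sheared copy of \<open>C \<times> {0..1}\<close>, hence a compact set; this makes Fubini
      applicable.\<close>
    let ?K = "(\<lambda>(y, t). (y - t *\<^sub>R v, t)) ` (C \<times> {0..1::real})"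
    have K: "compact ?K"
      by (intro compact_continuous_image compact_Times C(1) compact_Icc)
         (auto intro!: continuous_intros simp: split_beta)
    have "integrable lborel (\<lambda>z. indicator ?K z *\<^sub>R g (fst z + snd z *\<^sub>R v))"
      by (rule borel_integrable_compact[OF K]) (auto intro!: continuous_on_compose2[OF cg] continuous_intros)
    also have "(\<lambda>z. indicator ?K z *\<^sub>R g (fst z + snd z *\<^sub>R v)) = (\<lambda>(x, t). ?F x t)"
    proof (intro ext, clarify)
      fix x :: 'a and t :: real
      have "(x, t) \<in> ?K \<longleftrightarrow> x + t *\<^sub>R v \<in> C \<and> t \<in> {0..1}"
        by (auto simp: image_iff intro!: bexI[of _ "x + t *\<^sub>R v"])
      then show "indicator ?K (x, t) *\<^sub>R g (fst (x, t) + snd (x, t) *\<^sub>R v) = ?F x t"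
        using C(3)[of "x + t *\<^sub>R v"] by (cases "x + t *\<^sub>R v \<in> C") (auto simp: indicator_def)
    qed
    finally show ?thesis by (simp add: lborel_prod)
  qed
  have "(LINT x|lborel. f (x + v) - f x) = 0"
  proof -
    have "integrable lborel (\<lambda>x. f (x + v))"
    proof (rule integrable_compact_support)
      show "compact ((\<lambda>x. x - v) ` C)"
        by (intro compact_continuous_image C continuous_intros)
      show "f (x + v) = 0" if "x \<notin> (\<lambda>x. x - v) ` C" for x
        using that C(2)[of "x + v"] by (force simp: image_iff)
      show "continuous_on UNIV (\<lambda>x. f (x + v))"
        by (rule continuous_on_compose2[OF cf]) (auto intro!: continuous_intros)
    qed
    then show ?thesis using intf integral_lborel_translation[of f v] by simp
  qed
  also have "(LINT x|lborel. f (x + v) - f x) = (LINT x|lborel. LINT t|lborel. ?F x t)"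
    by (simp add: FTC)
  also have "\<dots> = (LINT t|lborel. LINT x|lborel. ?F x t)"
    by (rule lborel_pair.Fubini_integral[OF int2, symmetric])
  also have "\<dots> = (LINT t|lborel. indicator {0..1::real} t *\<^sub>R (LINT x|lborel. g x))"
    using integral_lborel_translation[of g] by simp
  also have "\<dots> = (LINT x|lborel. g x)"
    by (subst integral_scaleR_left) auto
  finally show ?thesis by simp
qed

text \<open>The product of \<phi> and \<psi> extends by zero across the complement of
  \<open>U\<close>, and its directional derivative integrates to 0. For the test function only
  derivatives along lines are required, so for the cutoffs a one-variable computation is
  enough.\<close>

lemma directional_integration_by_parts:
  fixes \<phi> \<psi> \<psi>' :: "'a::euclidean_space \<Rightarrow> complex"
  assumes U: "open U" "Ck_on 1 \<phi> U"
    and c: "continuous_on UNIV \<psi>" "continuous_on UNIV \<psi>'"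
    and C: "compact C" "C \<subseteq> U" "\<And>x. x \<notin> C \<Longrightarrow> \<psi> x = 0" "\<And>x. x \<notin> C \<Longrightarrow> \<psi>' x = 0"
    and der: "\<And>x. ((\<lambda>t::real. \<psi> (x + t *\<^sub>R v)) has_vector_derivative \<psi>' x) (at 0)"
  shows "(LINT x|lborel. frechet_derivative \<phi> (at x) v * \<psi> x) = - (LINT x|lborel. \<phi> x * \<psi>' x)"
    and "integrable lborel (\<lambda>x. frechet_derivative \<phi> (at x) v * \<psi> x)"
    and "integrable lborel (\<lambda>x. \<phi> x * \<psi>' x)"
proof -
  have d: "\<phi> differentiable at x" if "x \<in> U" for x
    using U(2) that by simp
  have cd: "continuous_on U (\<lambda>x. frechet_derivative \<phi> (at x) v)"
    using U(2) by simp
  have c\<phi>: "continuous_on U \<phi>"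
    using d differentiable_imp_continuous_within by (auto intro!: continuous_at_imp_continuous_on)
  have clC: "closed C" using C compact_imp_closed by blast
  have c1: "continuous_on UNIV (\<lambda>x. frechet_derivative \<phi> (at x) v * \<psi> x)"
    using continuous_on_mult_cutoff[OF U(1) cd c(1) clC C(2,3)] by simp
  have c2: "continuous_on UNIV (\<lambda>x. \<phi> x * \<psi>' x)"
    using continuous_on_mult_cutoff[OF U(1) c\<phi> c(2) clC C(2,4)] by simp
  have c3: "continuous_on UNIV (\<lambda>x. \<phi> x * \<psi> x)"
    using continuous_on_mult_cutoff[OF U(1) c\<phi> c(1) clC C(2,3)] by simp
  show i1: "integrable lborel (\<lambda>x. frechet_derivative \<phi> (at x) v * \<psi> x)"
    and i2: "integrable lborel (\<lambda>x. \<phi> x * \<psi>' x)"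
    using C by (auto intro!: integrable_compact_support[OF c1] integrable_compact_support[OF c2])
  have "(LINT x|lborel. frechet_derivative \<phi> (at x) v * \<psi> x + \<phi> x * \<psi>' x) = 0"
  proof (rule integral_directional_derivative_eq_0[where C=C and v=v, OF c3])
    show "continuous_on UNIV (\<lambda>x. frechet_derivative \<phi> (at x) v * \<psi> x + \<phi> x * \<psi>' x)"
      by (intro continuous_intros c1 c2)
    show "((\<lambda>t. \<phi> (x + t *\<^sub>R v) * \<psi> (x + t *\<^sub>R v)) has_vector_derivative
            frechet_derivative \<phi> (at x) v * \<psi> x + \<phi> x * \<psi>' x) (at 0)" for x
    proof (cases "x \<in> U")
      case True
      have "(\<phi> has_derivative frechet_derivative \<phi> (at x)) (at x)"
        using d[OF True] frechet_derivative_works by blast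
      then have "(\<phi> has_derivative frechet_derivative \<phi> (at x)) (at (x + 0 *\<^sub>R v))" by simp
      then have "((\<lambda>t. \<phi> (x + t *\<^sub>R v)) has_derivative (\<lambda>t. frechet_derivative \<phi> (at x) (t *\<^sub>R v))) (at 0)"
        by (rule has_derivative_compose[rotated]) (auto intro!: derivative_eq_intros)
      moreover have "linear (frechet_derivative \<phi> (at x))"
        using d[OF True] linear_frechet_derivative by blast
      ultimately have "((\<lambda>t. \<phi> (x + t *\<^sub>R v)) has_vector_derivative frechet_derivative \<phi> (at x) v) (at 0)"
        unfolding has_vector_derivative_def by (simp add: linear_cmul)
      from has_vector_derivative_mult[OF this der] show ?thesis
        by (simp add: algebra_simps)
    next
      case False
      then have x: "x \<in> - C" using C by auto
      have op: "open ((\<lambda>t::real. x + t *\<^sub>R v) -` (- C))"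
        using clC by (intro open_vimage continuous_intros) auto
      have "((\<lambda>t. \<phi> (x + t *\<^sub>R v) * \<psi> (x + t *\<^sub>R v)) has_vector_derivative 0) (at 0)"
        by (rule has_vector_derivative_transform_within_open[OF _ op, of "\<lambda>_. 0"])
           (use x C in auto)
      then show ?thesis using x C by simp
    qed
  qed (use C in auto)
  then show "(LINT x|lborel. frechet_derivative \<phi> (at x) v * \<psi> x) = - (LINT x|lborel. \<phi> x * \<psi>' x)"
    using i1 i2 by (simp add: add_eq_0_iff2)
qed

lemma dzbar_integration_by_parts:
  fixes \<phi> \<psi> \<psi>' \<psi>1 \<psi>2 :: "complex^'n::finite \<Rightarrow> complex"
  assumes U: "open U" "Ck_on 1 \<phi> U"
    and c: "continuous_on UNIV \<psi>" "continuous_on UNIV \<psi>1" "continuous_on UNIV \<psi>2"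
    and C: "compact C" "C \<subseteq> U" "\<And>x. x \<notin> C \<Longrightarrow> \<psi> x = 0" "\<And>x. x \<notin> C \<Longrightarrow> \<psi>1 x = 0" "\<And>x. x \<notin> C \<Longrightarrow> \<psi>2 x = 0"
    and der: "\<And>x. ((\<lambda>t::real. \<psi> (x + t *\<^sub>R axis j 1)) has_vector_derivative \<psi>1 x) (at 0)"
         "\<And>x. ((\<lambda>t::real. \<psi> (x + t *\<^sub>R axis j \<i>)) has_vector_derivative \<psi>2 x) (at 0)"
    and \<psi>': "\<And>x. \<psi>' x = (\<psi>1 x + \<i> * \<psi>2 x) / 2"
  shows "(LINT x|lborel. d_zbar j \<phi> x * \<psi> x) = - (LINT x|lborel. \<phi> x * \<psi>' x)" (is ?A)
    and "integrable lborel (\<lambda>x. d_zbar j \<phi> x * \<psi> x)" (is ?B)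
    and "integrable lborel (\<lambda>x. \<phi> x * \<psi>' x)" (is ?C)
proof -
  note 1 = directional_integration_by_parts[OF U c(1) c(2) C(1-3) C(4) der(1)]
  note 2 = directional_integration_by_parts[OF U c(1) c(3) C(1-3) C(5) der(2)]
  have e1: "d_zbar j \<phi> x * \<psi> x = (1/2) * (frechet_derivative \<phi> (at x) (axis j 1) * \<psi> x)
     + (\<i>/2) * (frechet_derivative \<phi> (at x) (axis j \<i>) * \<psi> x)" for x
    by (simp add: d_zbar_def field_simps)
  have e2: "\<phi> x * \<psi>' x = (1/2) * (\<phi> x * \<psi>1 x) + (\<i>/2) * (\<phi> x * \<psi>2 x)" for x
    by (simp add: \<psi>' field_simps)
  show ?B unfolding e1 by (intro Bochner_Integration.integrable_add integrable_mult_right 1 2)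
  show ?C unfolding e2 by (intro Bochner_Integration.integrable_add integrable_mult_right 1 2)
  show ?A unfolding e1 e2
    by (subst (1 2) Bochner_Integration.integral_add)
       (intro integrable_mult_right 1 2 | simp add: 1(1) 2(1))+
qed

subsection \<open>Cutoff functions\<close>

text \<open>A \<open>C\<^sup>1\<close> cutoff function whose negative derivative is a trapezoid of height \<open>1 / h\<close> and area 1
  on \<open>[a, a + h + d]\<close>; as \<open>d \<rightarrow> 0\<close> the trapezoid tends to the normalised indicator of \<open>(a, a + h]\<close>.\<close>

definition cutoff :: "real \<Rightarrow> real \<Rightarrow> real \<Rightarrow> real \<Rightarrow> real" where
  "cutoff a h d s = 1 - ((max 0 (s - a))\<^sup>2 - (max 0 (s - a - d))\<^sup>2
     - (max 0 (s - a - h))\<^sup>2 + (max 0 (s - a - h - d))\<^sup>2) / (2 * d * h)"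

definition trapezoid :: "real \<Rightarrow> real \<Rightarrow> real \<Rightarrow> real \<Rightarrow> real" where
  "trapezoid a h d s = (max 0 (s - a) - max 0 (s - a - d)
     - max 0 (s - a - h) + max 0 (s - a - h - d)) / (d * h)"

lemma DERIV_max_0_sq: "((\<lambda>x::real. (max 0 (x - c))\<^sup>2) has_real_derivative 2 * max 0 (s - c)) (at s)"
proof -
  consider "s < c" | "s = c" | "s > c" by linarith
  then show ?thesis
  proof cases
    case 1
    have "((\<lambda>x::real. (max 0 (x - c))\<^sup>2) has_real_derivative 0) (at s)"
      by (rule DERIV_cong_ev[THEN iffD1, OF refl _ refl, of "\<lambda>_. 0"])
         (use 1 eventually_nhds_in_open[of "{..<c}" s] in \<open>auto elim!: eventually_mono\<close>)
    then show ?thesis using 1 by simp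
  next
    case 3
    have "((\<lambda>x::real. (x - c)\<^sup>2) has_real_derivative 2 * (s - c)) (at s)"
      by (auto intro!: derivative_eq_intros)
    then have "((\<lambda>x::real. (max 0 (x - c))\<^sup>2) has_real_derivative 2 * (s - c)) (at s)"
      by (rule DERIV_cong_ev[THEN iffD1, rotated -1, OF _ refl _ refl])
         (use 3 eventually_nhds_in_open[of "{c<..}" s] in \<open>auto elim!: eventually_mono\<close>)
    then show ?thesis using 3 by simp
  next
    case 2
    \<comment> \<open>At the kink the difference quotient is bounded by |x - c|; squaring the ramp
      is what makes \<open>cutoff\<close> differentiable there.\<close>
    have "((\<lambda>x::real. (max 0 (x - c))\<^sup>2) has_real_derivative 0) (at c)"
      unfolding has_field_derivative_iff
    proof (rule Lim_null_comparison)
      show "\<forall>\<^sub>F x in at c. norm (((max 0 (x - c))\<^sup>2 - (max 0 (c - c))\<^sup>2) / (x - c)) \<le> \<bar>x - c\<bar>"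
        by (auto simp: eventually_at_filter max_def power2_eq_square)
      show "((\<lambda>x. \<bar>x - c\<bar>) \<longlongrightarrow> 0) (at c)"
        by (auto intro!: tendsto_eq_intros)
    qed
    then show ?thesis using 2 by simp
  qed
qed

lemma DERIV_cutoff:
  assumes "d > 0" "h > 0"
  shows "(cutoff a h d has_real_derivative - trapezoid a h d s) (at s)"
proof -
  have "(cutoff a h d has_real_derivative 0 - (2 * max 0 (s - a) - 2 * max 0 (s - (a + d))
     - 2 * max 0 (s - (a + h)) + 2 * max 0 (s - (a + h + d))) / (2 * d * h)) (at s)"
    unfolding cutoff_def diff_diff_eq
    by (intro DERIV_diff DERIV_const DERIV_cdivide DERIV_add DERIV_max_0_sq)
  moreover have "0 - (2 * X - 2 * Y - 2 * Z + 2 * W) / (2 * d * h) = - ((X - Y - Z + W) / (d * h))"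
    for X Y Z W using assms by (simp add: field_simps)
  ultimately show ?thesis
    by (simp only: trapezoid_def diff_diff_eq)
qed

lemma cutoff_eq_1: "s \<le> a \<Longrightarrow> 0 < d \<Longrightarrow> 0 < h \<Longrightarrow> cutoff a h d s = 1"
  by (simp add: cutoff_def max_def)

lemma cutoff_eq_0: "s \<ge> a + h + d \<Longrightarrow> 0 < d \<Longrightarrow> 0 < h \<Longrightarrow> cutoff a h d s = 0"
  by (simp add: cutoff_def max_def power2_eq_square field_simps)

lemma trapezoid_eq_0: "s \<le> a \<or> s \<ge> a + h + d \<Longrightarrow> 0 < d \<Longrightarrow> 0 < h \<Longrightarrow> trapezoid a h d s = 0"
  by (auto simp: trapezoid_def max_def)

text \<open>The numerator is the difference of s - a and s - a - h, each clamped to [0, d].\<close>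

lemma abs_trapezoid_le:
  assumes "0 < d" "0 < h"
  shows "\<bar>trapezoid a h d s\<bar> \<le> 1 / h"
proof -
  have "\<bar>max 0 (s - a) - max 0 (s - a - d)
     - max 0 (s - a - h) + max 0 (s - a - h - d)\<bar> \<le> d"
    using assms by (auto simp: max_def)
  then have "\<bar>trapezoid a h d s\<bar> \<le> d / (d * h)"
    using assms unfolding trapezoid_def abs_divide
    by (intro frac_le) (auto simp: abs_mult)
  then show ?thesis using assms by simp
qed

lemma continuous_on_trapezoid [continuous_intros]:
  "continuous_on A f \<Longrightarrow> continuous_on A (\<lambda>x. trapezoid a h d (f x))"
  unfolding trapezoid_def divide_inverse by (intro continuous_intros)

lemma continuous_on_cutoff [continuous_intros]:
  "continuous_on A f \<Longrightarrow> continuous_on A (\<lambda>x. cutoff a h d (f x))"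
  unfolding cutoff_def divide_inverse by (intro continuous_intros)

text \<open>For fixed s the sequence is eventually constant. At s = a it is 0 for every ramp width,
  and at s = a + h it is 1 / h as soon as the width is below h, which accounts for the half-open
  interval.\<close>

lemma trapezoid_tendsto:
  assumes h: "h > 0"
  shows "(\<lambda>k. trapezoid a h (1 / real (Suc k)) s) \<longlonglongrightarrow> indicator {a<..a + h} s / h"
proof (rule tendsto_eventually)
  have ev: "\<forall>\<^sub>F k in sequentially. 1 / real (Suc k) < c" if "c > 0" for c :: real
    using order_tendstoD(2)[OF LIMSEQ_inverse_real_of_nat that] by (simp add: inverse_eq_divide)
  \<comment> \<open>Below this width s lies on neither ramp: a point above a is past the rising
    ramp, and a point above a + h is past the falling one.\<close>
  let ?c = "min h (min (if s > a then s - a else 1) (if s > a + h then s - a - h else 1))"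
  have "?c > 0" using h by auto
  from ev[OF this]
  show "\<forall>\<^sub>F k in sequentially. trapezoid a h (1 / real (Suc k)) s = indicator {a<..a + h} s / h"
  proof (rule eventually_mono)
    fix k :: nat
    define d where "d = 1 / real (Suc k)"
    assume "1 / real (Suc k) < ?c"
    then have d: "d < ?c" "d > 0" by (auto simp: d_def)
    consider "s \<le> a" | "a < s" "s \<le> a + h" | "s > a + h" by linarith
    then have "trapezoid a h d s = indicator {a<..a + h} s / h"
    proof cases
      case 1 then show ?thesis using h d by (simp add: trapezoid_eq_0)
    next
      case 2
      then have "max 0 (s - a) - max 0 (s - a - d) - max 0 (s - a - h) + max 0 (s - a - h - d) = d"
        using d by (auto simp: max_def)
      then show ?thesis using 2 d by (simp add: trapezoid_def)
    next
      case 3 then show ?thesis using h d by (simp add: trapezoid_eq_0)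
    qed
    then show "trapezoid a h (1 / real (Suc k)) s = indicator {a<..a + h} s / h"
      by (simp add: d_def)
  qed
qed

text \<open>The family \<open>q\<close> lets one statement serve both the sphere (the single
  function |z|^2) and the torus (the functions |z_i|^2). Convergence is dominated: the product is at
  most (1 / h)^card I and, the ramp widths being at most 1, it vanishes off the fixed compact set
  \<open>K\<close>.\<close>

lemma trapezoid_limit:
  fixes f :: "'a::euclidean_space \<Rightarrow> complex" and q :: "'i \<Rightarrow> 'a \<Rightarrow> real"
  assumes h: "h > 0" and I: "finite I" "I \<noteq> {}"
    and q: "\<And>i. i \<in> I \<Longrightarrow> continuous_on UNIV (q i)"
    and f: "f \<in> borel_measurable borel"
    and K: "compact K" "continuous_on K f" "\<And>x. (\<And>i. i \<in> I \<Longrightarrow> a \<le> q i x \<and> q i x \<le> a + h + 1) \<Longrightarrow> x \<in> K"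
  shows "(\<lambda>k. LINT x|lborel. (\<Prod>i\<in>I. of_real (trapezoid a h (1 / real (Suc k)) (q i x))) * f x)
     \<longlonglongrightarrow> (1 / of_real h ^ card I) * (LINT x|lborel. (\<Prod>i\<in>I. indicator {a<..a + h} (q i x)) * f x)"
proof -
  have qm: "(\<lambda>x. q i x) \<in> borel_measurable borel" if "i \<in> I" for i
    using q[OF that] by (rule borel_measurable_continuous_onI)
  have "(\<lambda>k. LINT x|lborel. (\<Prod>i\<in>I. of_real (trapezoid a h (1 / real (Suc k)) (q i x))) * f x)
     \<longlonglongrightarrow> (LINT x|lborel. (\<Prod>i\<in>I. of_real (indicator {a<..a + h} (q i x) / h)) * f x)"
  proof (rule integral_dominated_convergence[where w = "\<lambda>x. (1 / h) ^ card I * norm (indicator K x *\<^sub>R f x)"])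
    have "(\<lambda>x. complex_of_real (indicator {a<..a + h} (q i x) / h)) \<in> borel_measurable borel" if "i \<in> I" for i
    proof -
      have "(\<lambda>y. complex_of_real (indicator {a<..a + h} y / h)) \<in> borel_measurable borel" by measurable
      from measurable_compose[OF qm[OF that] this] show ?thesis .
    qed
    then show "(\<lambda>x. (\<Prod>i\<in>I. of_real (indicator {a<..a + h} (q i x) / h)) * f x) \<in> borel_measurable lborel"
      using f by (auto intro!: borel_measurable_times borel_measurable_prod)
    have "continuous_on UNIV (\<lambda>x. complex_of_real (trapezoid a h d (q i x)))" if "i \<in> I" for i d
      using q[OF that] by (intro continuous_intros)
    then have "(\<lambda>x. (\<Prod>i\<in>I. of_real (trapezoid a h (1 / real (Suc k)) (q i x))) * f x) \<in> borel_measurable borel" for k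
      by (intro borel_measurable_times borel_measurable_prod borel_measurable_continuous_onI f)
    then show "(\<lambda>x. (\<Prod>i\<in>I. of_real (trapezoid a h (1 / real (Suc k)) (q i x))) * f x) \<in> borel_measurable lborel" for k
      by simp
    show "integrable lborel (\<lambda>x. (1 / h) ^ card I * norm (indicator K x *\<^sub>R f x))"
      by (intro integrable_mult_right Bochner_Integration.integrable_norm borel_integrable_compact K)
    show "AE x in lborel. (\<lambda>k. (\<Prod>i\<in>I. of_real (trapezoid a h (1 / real (Suc k)) (q i x))) * f x)
       \<longlonglongrightarrow> (\<Prod>i\<in>I. complex_of_real (indicator {a<..a + h} (q i x) / h)) * f x"
      by (intro AE_I2 tendsto_mult tendsto_const tendsto_prod tendsto_of_real trapezoid_tendsto[OF h])
    show "AE x in lborel. norm ((\<Prod>i\<in>I. of_real (trapezoid a h (1 / real (Suc k)) (q i x))) * f x)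
       \<le> (1 / h) ^ card I * norm (indicator K x *\<^sub>R f x)" for k
    proof (rule AE_I2)
      fix x
      show "norm ((\<Prod>i\<in>I. of_real (trapezoid a h (1 / real (Suc k)) (q i x))) * f x)
       \<le> (1 / h) ^ card I * norm (indicator K x *\<^sub>R f x)"
      proof (cases "x \<in> K")
        case True
        have "norm (\<Prod>i\<in>I. complex_of_real (trapezoid a h (1 / real (Suc k)) (q i x))) \<le> (\<Prod>i\<in>I. 1 / h)"
          unfolding prod_norm[symmetric]
          by (intro prod_mono) (use h abs_trapezoid_le[of "1 / real (Suc k)" h a] in auto)
        then show ?thesis using True by (simp add: norm_mult mult_right_mono)
      next
        case False
        then obtain i where i: "i \<in> I" "\<not> (a \<le> q i x \<and> q i x \<le> a + h + 1)" using K(3) by blast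
        have "1 / real (Suc k) \<le> 1" by simp
        with i(2) have "q i x \<le> a \<or> q i x \<ge> a + h + 1 / real (Suc k)" by linarith
        then have "trapezoid a h (1 / real (Suc k)) (q i x) = 0"
          by (rule trapezoid_eq_0) (use h in auto)
        then have "(\<Prod>i\<in>I. complex_of_real (trapezoid a h (1 / real (Suc k)) (q i x))) = 0"
          using i(1) I(1) by (intro prod_zero bexI[OF _ i(1)]) auto
        then show ?thesis using h by simp
      qed
    qed
  qed
  also have "(LINT x|lborel. (\<Prod>i\<in>I. of_real (indicator {a<..a + h} (q i x) / h)) * f x) =
    (1 / of_real h ^ card I) * (LINT x|lborel. (\<Prod>i\<in>I. indicator {a<..a + h} (q i x)) * f x)"
  proof -
    have "(\<Prod>i\<in>I. complex_of_real (indicator {a<..a + h} (q i x) / h)) * f x =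
      (1 / of_real h ^ card I) * ((\<Prod>i\<in>I. indicator {a<..a + h} (q i x)) * f x)" for x
      by (simp add: prod_dividef of_real_indicator)
    then show ?thesis by (simp only: integral_mult_right_zero)
  qed
  finally show ?thesis .
qed

subsection \<open>Radial and polydisc test functions\<close>

text \<open>With \<open>u(s) = cutoff a h d s\<close> this is, up to the order of the factors, the coefficient of
  \<open>\<And>\<^sub>i\<^sub>\<in>\<^sub>A \<partial>bar u(|z\<^sub>i|\<^sup>2) \<cdot> \<Prod>\<^sub>i\<^sub>\<notin>\<^sub>A u(|z\<^sub>i|\<^sup>2)\<close>, since \<open>\<partial>u(|z\<^sub>i|\<^sup>2)/\<partial>(cnj z\<^sub>i) = u'(|z\<^sub>i|\<^sup>2) z\<^sub>i\<close>.
  It is supported where \<open>z\<^sub>i \<noteq> 0\<close> for all \<open>i \<in> A\<close>.\<close>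

definition polydisc_test :: "real \<Rightarrow> real \<Rightarrow> real \<Rightarrow> 'n::finite set \<Rightarrow> complex^'n \<Rightarrow> complex" where
  "polydisc_test a h d A z =
     (\<Prod>i\<in>A. - of_real (trapezoid a h d ((norm (z $ i))\<^sup>2)) * z $ i) *
     (\<Prod>i\<in>- A. of_real (cutoff a h d ((norm (z $ i))\<^sup>2)))"

definition polydisc_shell :: "real \<Rightarrow> real \<Rightarrow> 'n::finite set \<Rightarrow> (complex^'n) set" where
  "polydisc_shell a c A = {z. (\<forall>i\<in>A. a \<le> (norm (z $ i))\<^sup>2) \<and> (\<forall>i. (norm (z $ i))\<^sup>2 \<le> c)}"

lemma continuous_on_polydisc_test: "continuous_on S (polydisc_test a h d A)"
  unfolding polydisc_test_def by (intro continuous_intros)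

lemma norm_le_of_components:
  fixes z :: "complex^'n::finite"
  assumes "\<And>i. (norm (z $ i))\<^sup>2 \<le> c"
  shows "(norm z)\<^sup>2 \<le> real CARD('n) * c"
proof -
  have "(norm z)\<^sup>2 = (\<Sum>i\<in>UNIV. (norm (z $ i))\<^sup>2)"
    by (simp add: norm_vec_def L2_set_def sum_nonneg)
  also have "\<dots> \<le> (\<Sum>i\<in>(UNIV::'n set). c)" by (intro sum_mono assms)
  finally show ?thesis by simp
qed

lemma compact_polydisc_shell: "compact (polydisc_shell a c A :: (complex^'n::finite) set)"
proof -
  have "bounded (polydisc_shell a c A :: (complex^'n) set)"
    unfolding bounded_iff
  proof (intro exI ballI)
    fix z :: "complex^'n" assume "z \<in> polydisc_shell a c A"
    then have "(norm z)\<^sup>2 \<le> real CARD('n) * c"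
      by (intro norm_le_of_components) (auto simp: polydisc_shell_def)
    then show "norm z \<le> sqrt (real CARD('n) * c)" by (rule real_le_rsqrt)
  qed
  moreover have "closed (polydisc_shell a c A :: (complex^'n) set)"
  proof -
    have "polydisc_shell a c A = (\<Inter>i\<in>A. {z. a \<le> (norm (z $ i))\<^sup>2}) \<inter> (\<Inter>i. {z :: complex^'n. (norm (z $ i))\<^sup>2 \<le> c})"
      by (auto simp: polydisc_shell_def)
    then show ?thesis
      by (auto intro!: closed_Int closed_INT closed_Collect_le continuous_intros)
  qed
  ultimately show ?thesis by (simp add: compact_eq_bounded_closed)
qed

text \<open>Allowing a larger \<open>B\<close> gives one compact set for the test function of
  \<open>A\<close> and for its derivatives, which belong to \<open>insert j A\<close>.\<close>

lemma polydisc_test_eq_0: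
  fixes z :: "complex^'n::finite"
  assumes "z \<notin> polydisc_shell a (a + h + d) A" "A \<subseteq> B" "0 < d" "0 < h"
  shows "polydisc_test a h d B z = 0"
proof -
  consider i where "i \<in> B" "(norm (z $ i))\<^sup>2 \<le> a \<or> (norm (z $ i))\<^sup>2 \<ge> a + h + d"
    | i where "i \<notin> B" "(norm (z $ i))\<^sup>2 \<ge> a + h + d"
    using assms(1,2) unfolding polydisc_shell_def
    by (smt (verit, best) mem_Collect_eq subsetD)
  then show ?thesis
  proof cases
    case 1
    then have "(\<Prod>i\<in>B. - of_real (trapezoid a h d ((norm (z $ i))\<^sup>2)) * z $ i) = 0"
      using trapezoid_eq_0[OF 1(2) assms(3,4)] by (intro prod_zero) auto
    then show ?thesis by (simp add: polydisc_test_def)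
  next
    case 2
    then have "(\<Prod>i\<in>-B. complex_of_real (cutoff a h d ((norm (z $ i))\<^sup>2))) = 0"
      using cutoff_eq_0[OF 2(2) assms(3,4)] by (intro prod_zero) (auto intro!: bexI[of _ i])
    then show ?thesis by (simp add: polydisc_test_def)
  qed
qed

text \<open>Along a real line a squared norm is a quadratic polynomial in t, and only its linear
  coefficient enters the derivative at 0.\<close>

lemma vector_derivative_cutoff_line:
  assumes dh: "0 < d" "0 < h"
    and q: "\<And>t::real. q t = c0 + 2 * c1 * t + c2 * t\<^sup>2"
  shows "((\<lambda>t. complex_of_real (cutoff a h d (q t))) has_vector_derivative
          - of_real (2 * c1 * trapezoid a h d c0)) (at 0)"
proof -
  have "(q has_real_derivative 2 * c1) (at 0)"
    unfolding q[abs_def] by (auto intro!: derivative_eq_intros)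
  moreover have "q 0 = c0" by (simp add: q)
  ultimately have "((\<lambda>t. cutoff a h d (q t)) has_real_derivative - trapezoid a h d c0 * (2 * c1)) (at 0)"
    using DERIV_chain2[OF DERIV_cutoff[OF dh]] by metis
  from has_vector_derivative_of_real[OF this] show ?thesis by (simp add: mult_ac)
qed

text \<open>Because j is outside \<open>A\<close>, only the cutoff in z_j varies along the line and
  \<open>R\<close> collects all other factors unchanged. The trapezoid factors are thus never
  differentiated.\<close>

lemma polydisc_test_line_derivative:
  fixes z :: "complex^'n::finite" and a :: real
  assumes dh: "0 < d" "0 < h" and j: "j \<notin> A"
  defines "R \<equiv> (\<Prod>i\<in>A. - of_real (trapezoid a h d ((norm (z $ i))\<^sup>2)) * z $ i) *
                (\<Prod>i\<in>- A - {j}. of_real (cutoff a h d ((norm (z $ i))\<^sup>2)))"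
  shows "((\<lambda>t. polydisc_test a h d A (z + t *\<^sub>R axis j c)) has_vector_derivative
          - of_real (2 * Re (cnj (z $ j) * c) * trapezoid a h d ((norm (z $ j))\<^sup>2)) * R) (at 0)"
    and "polydisc_test a h d (insert j A) z = - of_real (trapezoid a h d ((norm (z $ j))\<^sup>2)) * z $ j * R"
proof -
  have comp: "(z + t *\<^sub>R axis j c) $ i = (if i = j then z $ j + t *\<^sub>R c else z $ i)" for i t
    by (simp add: axis_def)
  have *: "polydisc_test a h d A (z + t *\<^sub>R axis j c) =
      of_real (cutoff a h d ((norm (z $ j + t *\<^sub>R c))\<^sup>2)) * R" for t
  proof -
    have 1: "(\<Prod>i\<in>- A. of_real (cutoff a h d ((norm ((z + t *\<^sub>R axis j c) $ i))\<^sup>2))) =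
        complex_of_real (cutoff a h d ((norm (z $ j + t *\<^sub>R c))\<^sup>2)) *
        (\<Prod>i\<in>- A - {j}. of_real (cutoff a h d ((norm (z $ i))\<^sup>2)))"
      by (subst prod.remove[of _ j]) (use j in \<open>auto simp: comp intro!: prod.cong simp del: vector_add_component vector_scaleR_component\<close>)
    have 2: "(\<Prod>i\<in>A. - complex_of_real (trapezoid a h d ((norm ((z + t *\<^sub>R axis j c) $ i))\<^sup>2)) * (z + t *\<^sub>R axis j c) $ i)
        = (\<Prod>i\<in>A. - of_real (trapezoid a h d ((norm (z $ i))\<^sup>2)) * z $ i)"
      by (intro prod.cong) (use j in \<open>auto simp: comp simp del: vector_add_component vector_scaleR_component\<close>)
    show ?thesis unfolding polydisc_test_def 1 2 by (simp add: R_def mult_ac)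
  qed
  have q: "(norm (z $ j + t *\<^sub>R c))\<^sup>2 = (norm (z $ j))\<^sup>2 + 2 * Re (cnj (z $ j) * c) * t + (norm c)\<^sup>2 * t\<^sup>2" for t
    by (simp only: cmod_power2) (simp add: power2_eq_square algebra_simps)
  show "((\<lambda>t. polydisc_test a h d A (z + t *\<^sub>R axis j c)) has_vector_derivative
          - of_real (2 * Re (cnj (z $ j) * c) * trapezoid a h d ((norm (z $ j))\<^sup>2)) * R) (at 0)"
    unfolding * by (intro has_vector_derivative_mult_left vector_derivative_cutoff_line[OF dh q])
  have "- insert j A = - A - {j}" by auto
  then show "polydisc_test a h d (insert j A) z = - of_real (trapezoid a h d ((norm (z $ j))\<^sup>2)) * z $ j * R"
    using j by (simp add: polydisc_test_def R_def)
qed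

text \<open>Re (cnj w) + i Re (i cnj w) = w; in real coordinates this says that |w|^2 has derivative
  w with respect to cnj w.\<close>

lemma dzbar_combination:
  "(- of_real (2 * Re (cnj w * 1) * b) * R + \<i> * (- of_real (2 * Re (cnj w * \<i>) * b) * R)) / 2
     = - complex_of_real b * w * R"
  by (simp add: complex_eq_iff field_simps)

lemma nonzero_coords_open: "open {z :: complex^'n::finite. \<forall>i\<in>A. z $ i \<noteq> 0}"
proof -
  have "{z :: complex^'n. \<forall>i\<in>A. z $ i \<noteq> 0} = (\<Inter>i\<in>A. {z. z $ i \<noteq> 0})" by auto
  then show ?thesis by (auto intro!: open_INT open_Collect_neq continuous_intros)
qed

lemma polydisc_test_integrable:
  fixes \<phi> :: "complex^'n::finite \<Rightarrow> complex"
  assumes "0 < a" "0 < d" "0 < h" "continuous_on {z. \<forall>i\<in>A. z $ i \<noteq> 0} \<phi>"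
  shows "integrable lborel (\<lambda>z. \<phi> z * polydisc_test a h d A z)"
proof (rule integrable_compact_support)
  have sub: "polydisc_shell a (a + h + d) A \<subseteq> {z. \<forall>i\<in>A. z $ i \<noteq> 0}"
    using assms(1) by (auto simp: polydisc_shell_def)
  show "continuous_on UNIV (\<lambda>z. \<phi> z * polydisc_test a h d A z)"
    by (rule continuous_on_mult_cutoff[OF nonzero_coords_open assms(4) continuous_on_polydisc_test
          compact_imp_closed[OF compact_polydisc_shell] sub])
      (use assms polydisc_test_eq_0 in blast)
  show "compact (polydisc_shell a (a + h + d) A :: (complex^'n) set)"
    by (rule compact_polydisc_shell)
  show "\<phi> x * polydisc_test a h d A x = 0" if "x \<notin> polydisc_shell a (a + h + d) A" for x
    using polydisc_test_eq_0[OF that order_refl] assms by simp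
qed

text \<open>One step of the descent: a derivative in cnj z_j on the form is traded for enlarging
  \<open>A\<close> by j. The support stays away from the hyperplanes of \<open>A\<close>, the only
  places where \<phi> may be singular.\<close>

lemma polydisc_test_ibp:
  fixes \<phi> :: "complex^'n::finite \<Rightarrow> complex"
  assumes "0 < a" and dh: "0 < d" "0 < h" and j: "j \<notin> A"
    and \<phi>: "Ck_on 1 \<phi> {z. \<forall>i\<in>A. z $ i \<noteq> 0}"
  shows "(LINT z|lborel. d_zbar j \<phi> z * polydisc_test a h d A z) =
           - (LINT z|lborel. \<phi> z * polydisc_test a h d (insert j A) z)"
    and "integrable lborel (\<lambda>z. d_zbar j \<phi> z * polydisc_test a h d A z)"
    and "integrable lborel (\<lambda>z. \<phi> z * polydisc_test a h d (insert j A) z)"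
proof -
  let ?C = "polydisc_shell a (a + h + d) A :: (complex^'n) set"
  let ?R = "\<lambda>z::complex^'n. (\<Prod>i\<in>A. - of_real (trapezoid a h d ((norm (z $ i))\<^sup>2)) * z $ i) *
                (\<Prod>i\<in>- A - {j}. of_real (cutoff a h d ((norm (z $ i))\<^sup>2)))"
  let ?D = "\<lambda>c z. - of_real (2 * Re (cnj (z $ j) * c) * trapezoid a h d ((norm (z $ j))\<^sup>2)) * ?R z"
  have D0: "?D c z = 0" if z: "z \<notin> ?C" for c z
  proof -
    have z0: "polydisc_test a h d (insert j A) z = 0"
      by (rule polydisc_test_eq_0[OF z]) (use dh in auto)
    show ?thesis
    proof (cases "?R z = 0")
      case False
      \<comment> \<open>The vanishing product contains a factor z_j that the line derivatives lack.
        If z_j = 0, then |z_j|^2 lies below a > 0, where the trapezoid vanishes as well.\<close>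
      with z0 have "trapezoid a h d ((norm (z $ j))\<^sup>2) = 0"
        unfolding polydisc_test_line_derivative(2)[OF dh j]
        using trapezoid_eq_0[of "(norm (z $ j))\<^sup>2" a h d] dh \<open>0 < a\<close> by auto
      then show ?thesis by simp
    qed simp
  qed
  have cD: "continuous_on UNIV (?D c)" for c
    by (intro continuous_intros)
  note ibp = dzbar_integration_by_parts[OF nonzero_coords_open \<phi> continuous_on_polydisc_test
      cD[of 1] cD[of \<i>] compact_polydisc_shell, of a "a + h + d" A a h d A j "polydisc_test a h d (insert j A)"]
  have prem: "?C \<subseteq> {z. \<forall>i\<in>A. z $ i \<noteq> 0}"
    "\<And>x. x \<notin> ?C \<Longrightarrow> polydisc_test a h d A x = 0"
    using \<open>0 < a\<close> polydisc_test_eq_0[OF _ order_refl dh, of _ a A]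
    by (auto simp: polydisc_shell_def)
  have comb: "polydisc_test a h d (insert j A) x = (?D 1 x + \<i> * ?D \<i> x) / 2" for x
    by (simp only: polydisc_test_line_derivative(2)[OF dh j] dzbar_combination)
  note r = ibp[OF prem(1,2) D0 D0 polydisc_test_line_derivative(1)[OF dh j]
     polydisc_test_line_derivative(1)[OF dh j] comb]
  show "(LINT z|lborel. d_zbar j \<phi> z * polydisc_test a h d A z) =
           - (LINT z|lborel. \<phi> z * polydisc_test a h d (insert j A) z)"
    and "integrable lborel (\<lambda>z. d_zbar j \<phi> z * polydisc_test a h d A z)"
    and "integrable lborel (\<lambda>z. \<phi> z * polydisc_test a h d (insert j A) z)"
    using r by blast+
qed

lemma radial_cutoff_line_derivative:
  fixes z :: "complex^'n::finite"
  assumes dh: "0 < d" "0 < h"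
  shows "((\<lambda>t. complex_of_real (cutoff a h d ((norm (z + t *\<^sub>R axis j c))\<^sup>2))) has_vector_derivative
          - of_real (2 * Re (cnj (z $ j) * c) * trapezoid a h d ((norm z)\<^sup>2))) (at 0)"
proof (rule vector_derivative_cutoff_line[OF dh])
  fix t :: real
  have "z \<bullet> axis j c = Re (cnj (z $ j) * c)"
    by (simp add: inner_axis inner_complex_def)
  moreover have "(norm (z + t *\<^sub>R axis j c))\<^sup>2 = (norm z)\<^sup>2 + 2 * (z \<bullet> axis j c) * t + (norm (axis j c :: complex^'n))\<^sup>2 * t\<^sup>2"
    unfolding power2_norm_eq_inner by (simp add: inner_simps inner_commute power2_eq_square algebra_simps)
  ultimately show "(norm (z + t *\<^sub>R axis j c))\<^sup>2 = (norm z)\<^sup>2 + 2 * Re (cnj (z $ j) * c) * t + (norm (axis j c :: complex^'n))\<^sup>2 * t\<^sup>2"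
    by simp
qed

text \<open>The difference of the two cutoffs vanishes both near 0 and far away, so it is a test
  function on the punctured space and the closed form integrates to 0 against its derivatives. The
  inner radii \<open>a\<close> and \<open>a'\<close> are independent of each other.\<close>

lemma radial_eq_polydisc:
  fixes \<Theta> :: "'n::finite \<Rightarrow> complex^'n \<Rightarrow> complex"
  assumes a: "0 < a" "0 < a'" and dh: "0 < d" "0 < h"
    and \<Theta>: "\<And>j. Ck_on 1 (\<Theta> j) (- {0})"
    and closed: "\<And>z. z \<noteq> 0 \<Longrightarrow> (\<Sum>j\<in>UNIV. p j * d_zbar j (\<Theta> j) z) = 0"
  shows "(LINT z|lborel. of_real (trapezoid a h d ((norm z)\<^sup>2)) * (\<Sum>j\<in>UNIV. p j * \<Theta> j z * z $ j)) =
         - (\<Sum>j\<in>UNIV. p j * (LINT z|lborel. \<Theta> j z * polydisc_test a' h d {j} z))"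
proof -
  let ?\<psi> = "\<lambda>z::complex^'n. of_real (cutoff a h d ((norm z)\<^sup>2)) - polydisc_test a' h d {} z"
  let ?D = "\<lambda>j z. - of_real (trapezoid a h d ((norm z)\<^sup>2)) * z $ j - polydisc_test a' h d {j} z"
  let ?R = "\<lambda>j z::complex^'n. (\<Prod>i\<in>{}. - of_real (trapezoid a' h d ((norm (z $ i))\<^sup>2)) * z $ i) *
                (\<Prod>i\<in>- {} - {j}. of_real (cutoff a' h d ((norm (z $ i))\<^sup>2)))"
  let ?E = "\<lambda>j c z. - of_real (2 * Re (cnj (z $ j) * c) * trapezoid a h d ((norm z)\<^sup>2)) -
     (- of_real (2 * Re (cnj (z $ j) * c) * trapezoid a' h d ((norm (z $ j))\<^sup>2)) * ?R j z)"
  \<comment> \<open>Below \<open>?m\<close> both cutoffs are 1. Above \<open>?M\<close> the radial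
    one is 0, and some |z_i|^2 exceeds a' + h + d because the n of them add up to |z|^2, so the
    polydisc one is 0 too.\<close>
  let ?m = "min a a'" and ?M = "max (a + h + d) (CARD('n) * (a' + h + d))"
  define C where "C = {z :: complex^'n. ?m \<le> (norm z)\<^sup>2 \<and> (norm z)\<^sup>2 \<le> ?M}"
  have C: "compact C"
  proof -
    have "C \<subseteq> cball 0 (sqrt ?M)"
      unfolding C_def by (auto intro: real_le_rsqrt)
    moreover have "closed C" unfolding C_def
      by (intro closed_Collect_conj closed_Collect_le continuous_intros)
    ultimately show ?thesis
      using bounded_cball bounded_subset compact_eq_bounded_closed by metis
  qed
  have C0: "C \<subseteq> - {0}" using a by (auto simp: C_def)
  have comp_le: "(norm (z $ i))\<^sup>2 \<le> (norm z)\<^sup>2" for z :: "complex^'n" and i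
    by (intro power_mono Finite_Cartesian_Product.norm_nth_le) auto
  have big: "\<exists>i. (norm (z $ i))\<^sup>2 > a' + h + d" if "(norm z)\<^sup>2 > CARD('n) * (a' + h + d)" for z :: "complex^'n"
    using norm_le_of_components[of z "a' + h + d"] that by (meson not_le)
  have zero: "?\<psi> z = 0 \<and> ?E j c z = 0" if z: "z \<notin> C" for z j c
  proof (cases "(norm z)\<^sup>2 < ?m")
    case True
    then have "(norm (z $ i))\<^sup>2 \<le> a'" for i using comp_le[of z i] by linarith
    then show ?thesis using True dh
      by (simp add: polydisc_test_def cutoff_eq_1 trapezoid_eq_0)
  next
    case False
    then have gt: "(norm z)\<^sup>2 > a + h + d" "(norm z)\<^sup>2 > CARD('n) * (a' + h + d)"
      using z by (auto simp: C_def)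
    obtain i where i: "(norm (z $ i))\<^sup>2 > a' + h + d" using big[OF gt(2)] by blast
    then have "(\<Prod>i\<in>UNIV. complex_of_real (cutoff a' h d ((norm (z $ i))\<^sup>2))) = 0"
      using cutoff_eq_0[of a' h d "(norm (z $ i))\<^sup>2"] dh by (intro prod_zero) auto
    moreover have "complex_of_real (trapezoid a' h d ((norm (z $ j))\<^sup>2)) * ?R j z = 0"
    proof (cases "i = j")
      case True
      then show ?thesis using i dh by (simp add: trapezoid_eq_0)
    next
      case False
      then have "?R j z = 0"
        using cutoff_eq_0[of a' h d "(norm (z $ i))\<^sup>2"] dh i
        by (auto intro!: prod_zero bexI[of _ i])
      then show ?thesis by simp
    qed
    ultimately show ?thesis using gt dh
      by (simp add: polydisc_test_def cutoff_eq_0 trapezoid_eq_0)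
  qed
  have ibp: "(LINT z|lborel. d_zbar j (\<Theta> j) z * ?\<psi> z) = - (LINT z|lborel. \<Theta> j z * ?D j z)
      \<and> integrable lborel (\<lambda>z. d_zbar j (\<Theta> j) z * ?\<psi> z) \<and> integrable lborel (\<lambda>z. \<Theta> j z * ?D j z)" for j
  proof -
    have j: "j \<notin> {}" by simp
    have cE: "continuous_on UNIV (?E j c)" for c
      by (intro continuous_intros)
    have der: "((\<lambda>t. ?\<psi> (z + t *\<^sub>R axis j c)) has_vector_derivative ?E j c z) (at 0)" for c z
      by (intro has_vector_derivative_diff radial_cutoff_line_derivative[OF dh]
          polydisc_test_line_derivative(1)[OF dh j])
    have comb: "?D j z = (?E j 1 z + \<i> * ?E j \<i> z) / 2" for z
    proof -
      have split: "(A1 - B1 + \<i> * (A2 - B2)) / 2 = (A1 + \<i> * A2) / 2 - (B1 + \<i> * B2) / 2"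
        for A1 A2 B1 B2 :: complex by (simp add: field_simps)
      show ?thesis
        unfolding split dzbar_combination polydisc_test_line_derivative(2)[OF dh j, of a' z]
        using dzbar_combination[of "z $ j" "trapezoid a h d ((norm z)\<^sup>2)" 1, unfolded mult_1_right]
        by (simp only: mult_1_right)
    qed
    have c\<psi>: "continuous_on UNIV ?\<psi>"
      by (intro continuous_intros continuous_on_polydisc_test)
    note r = dzbar_integration_by_parts[OF _ \<Theta>[of j] c\<psi> cE[of 1] cE[of \<i>] C C0 _ _ _ der der comb]
    show ?thesis using r zero by blast
  qed
  have "(\<Sum>j\<in>UNIV. p j * (LINT z|lborel. d_zbar j (\<Theta> j) z * ?\<psi> z)) =
        (LINT z|lborel. (\<Sum>j\<in>UNIV. p j * (d_zbar j (\<Theta> j) z * ?\<psi> z)))"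
    using ibp by (subst Bochner_Integration.integral_sum) auto
  also have "\<dots> = (LINT z::complex^'n|lborel. 0)"
  proof (intro Bochner_Integration.integral_cong refl)
    fix z :: "complex^'n"
    have "(\<Sum>j\<in>UNIV. p j * (d_zbar j (\<Theta> j) z * ?\<psi> z)) = (\<Sum>j\<in>UNIV. p j * d_zbar j (\<Theta> j) z) * ?\<psi> z"
      by (simp only: sum_distrib_right mult.assoc)
    also have "\<dots> = 0"
      using closed[of z] zero[of z] C0 by (cases "z = 0") auto
    finally show "(\<Sum>j\<in>UNIV. p j * (d_zbar j (\<Theta> j) z * ?\<psi> z)) = 0" .
  qed
  finally have 1: "(\<Sum>j\<in>UNIV. p j * (LINT z|lborel. \<Theta> j z * ?D j z)) = 0"
    using ibp by (simp add: sum_negf)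
  have int1: "integrable lborel (\<lambda>z. \<Theta> j z * polydisc_test a' h d {j} z)" for j
  proof (rule polydisc_test_integrable[OF a(2) dh])
    have "continuous_on (- {0}) (\<Theta> j)"
      using \<Theta>[of j] by (auto intro!: continuous_at_imp_continuous_on differentiable_imp_continuous_within)
    then show "continuous_on {z. \<forall>i\<in>{j}. z $ i \<noteq> 0} (\<Theta> j)"
      by (rule continuous_on_subset) auto
  qed
  let ?T = "\<lambda>z :: complex^'n. complex_of_real (trapezoid a h d ((norm z)\<^sup>2))"
  have int2: "integrable lborel (\<lambda>z. ?T z * (\<Theta> j z * z $ j))" for j
  proof -
    have "integrable lborel (\<lambda>z. - (\<Theta> j z * ?D j z + \<Theta> j z * polydisc_test a' h d {j} z))"
      using ibp int1 by auto
    then show ?thesis by (simp add: algebra_simps)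
  qed
  have 2: "(LINT z|lborel. \<Theta> j z * ?D j z) = - (LINT z|lborel. ?T z * (\<Theta> j z * z $ j))
      - (LINT z|lborel. \<Theta> j z * polydisc_test a' h d {j} z)" for j
  proof -
    have "\<Theta> j z * ?D j z = - (?T z * (\<Theta> j z * z $ j)) - \<Theta> j z * polydisc_test a' h d {j} z" for z
      by (simp add: algebra_simps)
    then show ?thesis using int1 int2 by simp
  qed
  have "(LINT z|lborel. ?T z * (\<Sum>j\<in>UNIV. p j * \<Theta> j z * z $ j)) =
        (LINT z|lborel. (\<Sum>j\<in>UNIV. p j * (?T z * (\<Theta> j z * z $ j))))"
    by (simp add: sum_distrib_left mult_ac)
  also have "\<dots> = (\<Sum>j\<in>UNIV. p j * (LINT z|lborel. ?T z * (\<Theta> j z * z $ j)))"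
    using int2 by (subst Bochner_Integration.integral_sum) auto
  finally have 3: "(LINT z|lborel. ?T z * (\<Sum>j\<in>UNIV. p j * \<Theta> j z * z $ j)) =
    (\<Sum>j\<in>UNIV. p j * (LINT z|lborel. ?T z * (\<Theta> j z * z $ j)))" .
  have "(\<Sum>j\<in>UNIV. p j * (LINT z|lborel. ?T z * (\<Theta> j z * z $ j))) +
      (\<Sum>j\<in>UNIV. p j * (LINT z|lborel. \<Theta> j z * polydisc_test a' h d {j} z)) = 0"
  proof -
    have "(\<Sum>j\<in>UNIV. p j * (- A j - B j)) = - ((\<Sum>j\<in>UNIV. p j * A j) + (\<Sum>j\<in>UNIV. p j * B j))"
      for A B :: "'n \<Rightarrow> complex"
      by (simp add: right_diff_distrib sum_subtractf sum_negf)
    from 1[unfolded 2 this] show ?thesis by (simp only: neg_equal_0_iff_equal)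
  qed
  then show ?thesis unfolding 3 by (simp only: eq_neg_iff_add_eq_0)
qed

subsection \<open>Descent through the Cech--Dolbeault complex\<close>

lemma Ck_on_of_smooth_on: "smooth_on f U \<Longrightarrow> Ck_on k f U"
  by (simp add: smooth_on_def)

lemma Ck_on_1_continuous: "Ck_on 1 f U \<Longrightarrow> continuous_on U f"
  by (auto intro!: continuous_at_imp_continuous_on differentiable_imp_continuous_within)

text \<open>The one exponent behind all signs: for i in \<open>A\<close> it is the zero-based
  position of i, hence the Cech sign of omitting i and the sign of d(cnj z_i) in
  \<open>dbar\<close>. It is also applied to i outside \<open>A\<close>.\<close>

definition rank_in :: "'n::{finite,linorder} set \<Rightarrow> 'n \<Rightarrow> nat" where
  "rank_in A i = card {k\<in>A. k < i}"

lemma rank_in_nth: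
  assumes "\<nu> < card (A :: 'n::{finite,linorder} set)"
  shows "rank_in A (sorted_list_of_set A ! \<nu>) = \<nu>"
proof -
  let ?L = "sorted_list_of_set A"
  have len: "length ?L = card A" by simp
  have lt: "?L ! a < ?L ! b \<longleftrightarrow> a < b" if "a < card A" "b < card A" for a b
    using that by (metis len linorder_neqE_nat order_less_asym order_less_irrefl sorted_wrt_nth_less strict_sorted_list_of_set)
  have "{k\<in>A. k < ?L ! \<nu>} = (!) ?L ` {..<\<nu>}"
  proof (intro Set.set_eqI iffI)
    fix k assume "k \<in> {k\<in>A. k < ?L ! \<nu>}"
    then obtain m where "m < card A" "k = ?L ! m" "k < ?L ! \<nu>"
      by (metis (no_types, lifting) finite in_set_conv_nth len mem_Collect_eq set_sorted_list_of_set)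
    then show "k \<in> (!) ?L ` {..<\<nu>}" using lt assms by auto
  next
    fix k assume "k \<in> (!) ?L ` {..<\<nu>}"
    then obtain m where m: "m < \<nu>" "k = ?L ! m" by auto
    then have "k \<in> set ?L" using assms len by (metis nth_mem order_less_trans)
    then show "k \<in> {k\<in>A. k < ?L ! \<nu>}" using m lt assms by auto
  qed
  moreover have "inj_on ((!) ?L) {..<\<nu>}"
    using assms by (intro inj_on_nth) auto
  ultimately show ?thesis by (simp add: rank_in_def card_image)
qed

lemma bij_betw_sorted_list: "bij_betw ((!) (sorted_list_of_set A)) {..<card A} (A :: 'n::{finite,linorder} set)"
  by (rule bij_betw_nth) auto

lemma sorted_list_of_set_delete_nth:
  assumes "\<nu> < card (A :: 'n::{finite,linorder} set)"
  defines "L \<equiv> sorted_list_of_set A"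
  shows "take \<nu> L @ drop (Suc \<nu>) L = sorted_list_of_set (A - {L ! \<nu>})"
proof (rule sorted_distinct_set_unique)
  have len: "\<nu> < length L" using assms by (simp add: L_def)
  have dec: "L = take \<nu> L @ L ! \<nu> # drop (Suc \<nu>) L" by (rule id_take_nth_drop[OF len])
  have s: "sorted L" and d: "distinct L" and set: "set L = A" by (auto simp: L_def)
  show "sorted (take \<nu> L @ drop (Suc \<nu>) L)"
    using s by (subst (asm) dec) (auto simp: sorted_append)
  show "distinct (take \<nu> L @ drop (Suc \<nu>) L)"
    using d by (subst (asm) dec) auto
  have "set (take \<nu> L @ drop (Suc \<nu>) L) = set L - {L ! \<nu>}"
    using d by (subst (2) dec, subst (asm) dec) auto
  then show "set (take \<nu> L @ drop (Suc \<nu>) L) = set (sorted_list_of_set (A - {L ! \<nu>}))"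
    by (simp add: set)
qed auto

text \<open>Omitting one entry of an increasing tuple leaves an increasing tuple, so the tuples
  attached to sets are closed under faces. The bound on the cardinality excludes singletons, on
  which \<open>cech_delta\<close> is 0 by definition.\<close>

lemma cech_delta_sorted:
  fixes A :: "'n::{finite,linorder} set"
  assumes "card A \<ge> 2"
  shows "cech_delta \<xi> (sorted_list_of_set A) z I J =
    (\<Sum>i\<in>A. (-1) ^ rank_in A i * \<xi> (sorted_list_of_set (A - {i})) z I J)"
proof -
  let ?L = "sorted_list_of_set A"
  have "cech_delta \<xi> ?L z I J = (\<Sum>\<nu><card A. (-1) ^ \<nu> * \<xi> (take \<nu> ?L @ drop (Suc \<nu>) ?L) z I J)"
    using assms by (simp add: cech_delta_def)
  also have "\<dots> = (\<Sum>\<nu><card A. (-1) ^ rank_in A (?L ! \<nu>) * \<xi> (sorted_list_of_set (A - {?L ! \<nu>})) z I J)"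
    by (intro sum.cong) (auto simp: rank_in_nth sorted_list_of_set_delete_nth)
  also have "\<dots> = (\<Sum>i\<in>A. (-1) ^ rank_in A i * \<xi> (sorted_list_of_set (A - {i})) z I J)"
    by (rule sum.reindex_bij_betw[OF bij_betw_sorted_list])
  finally show ?thesis .
qed

lemma prod_rank_signs:
  "(\<Prod>j\<in>(UNIV :: 'n::{finite,linorder} set). (-1) ^ rank_in UNIV j) = (\<Prod>k<CARD('n). (-1) ^ k :: complex)"
proof -
  have "(\<Prod>j\<in>(UNIV :: 'n set). (-1) ^ rank_in UNIV j) =
      (\<Prod>k<CARD('n). (-1) ^ rank_in UNIV (sorted_list_of_set (UNIV :: 'n set) ! k) :: complex)"
    by (rule prod.reindex_bij_betw[OF bij_betw_sorted_list, symmetric])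
  then show ?thesis by (simp add: rank_in_nth)
qed

lemma rank_in_complement: "rank_in A i + rank_in (- A) i = rank_in UNIV i"
  unfolding rank_in_def by (subst card_Un_disjoint[symmetric]) (auto intro!: arg_cong[of _ _ card])

lemma cover_inter_sorted:
  "cover_inter coord_cover (sorted_list_of_set A) = {z. \<forall>i\<in>(A :: 'n::{finite,linorder} set). z $ i \<noteq> 0}"
  by (auto simp: cover_inter_def coord_cover_def)

text \<open>Signs chosen so that in the weighted sum over all \<open>A \<noteq> {}\<close> of the integrated cocycle equations
  the Cech terms cancel the \<open>\<partial>bar\<close> terms one level below.\<close>

definition descent_weight :: "nat \<Rightarrow> 'n::{finite,linorder} set \<Rightarrow> complex" where
  "descent_weight n A = (\<Prod>i\<in>A. (-1) ^ rank_in UNIV i) * (\<Prod>t\<in>{1..<card A}. (-1) ^ (n + t - 1))"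

text \<open>The recurrence that dictates the weights. On the left are the signs of the dbar term at
  \<open>B - {j}\<close>: the alternating sign of the total differential, (-1)^n for passing dz_1,
  ..., dz_n, and the place of d(cnj z_j) in the complement. On the right is the Cech sign of
  omitting j from \<open>B\<close>. Going from cardinality r + 1 to r + 2 costs (-1)^(n + r), the
  factor t = r + 1 of the weight.\<close>

lemma descent_weight_remove:
  fixes B :: "'n::{finite,linorder} set"
  assumes j: "j \<in> B" and B: "card B \<ge> 2"
  shows "descent_weight n (B - {j}) * (-1) ^ (card (B - {j}) - 1) * (-1) ^ n * (-1) ^ rank_in (- (B - {j})) j
     = descent_weight n B * (-1) ^ rank_in B j"
proof -
  define r where "r = card B - 2"
  have c: "card B = Suc (Suc r)" "card (B - {j}) = Suc r" using j B by (auto simp: r_def)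
  have w: "(\<Prod>t\<in>{1..<Suc (Suc r)}. (-1) ^ (n + t - 1)) =
      (\<Prod>t\<in>{1..<Suc r}. (-1) ^ (n + t - 1)) * ((-1) ^ (n + r) :: complex)"
    by (subst prod.atLeastLessThan_Suc) auto
  have s: "(\<Prod>i\<in>B. (-1) ^ rank_in UNIV i) = (-1) ^ rank_in UNIV j * (\<Prod>i\<in>B - {j}. (-1) ^ rank_in UNIV i :: complex)"
    using j by (subst prod.remove[of B j]) auto
  have "rank_in B j = rank_in (B - {j}) j"
    unfolding rank_in_def by (intro arg_cong[of _ _ card]) auto
  then have "rank_in UNIV j = rank_in B j + rank_in (- (B - {j})) j"
    using rank_in_complement[of "B - {j}" j] by simp
  then have rk: "(-1) ^ rank_in UNIV j * (-1) ^ rank_in B j = ((-1) ^ rank_in (- (B - {j})) j :: complex)"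
    by (simp add: power_add mult_ac power_mult_distrib[symmetric] flip: power2_eq_square power_mult)
  show ?thesis unfolding descent_weight_def c w s rk[symmetric]
    by (simp add: power_add mult_ac)
qed

text \<open>For t = 1, ..., n - 1 the signs (-1)^t and (-1)^(n + t - 1) combine to (-1)^(n - 1); the
  total exponent (n - 1)^2 has the parity of n + 1.\<close>

lemma descent_weight_UNIV:
  "descent_weight CARD('n) (UNIV :: 'n::{finite,linorder} set) = (-1) ^ (CARD('n) + 1)"
proof -
  obtain m where m: "CARD('n) = Suc m" by (metis Suc_pred zero_less_card_finite)
  have "descent_weight CARD('n) (UNIV :: 'n set) =
     (\<Prod>k<Suc m. (-1) ^ k) * (\<Prod>t\<in>{1..<Suc m}. (-1) ^ (Suc m + t - 1))"
    unfolding descent_weight_def prod_rank_signs m ..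
  also have "(\<Prod>k<Suc m. (-1) ^ k :: complex) = (\<Prod>k\<in>{1..<Suc m}. (-1) ^ k)"
    by (rule prod.mono_neutral_right) (auto simp: not_less_eq_eq)
  also have "\<dots> * (\<Prod>t\<in>{1..<Suc m}. (-1) ^ (Suc m + t - 1)) = (\<Prod>t\<in>{1..<Suc m}. (-1) ^ m :: complex)"
    unfolding prod.distrib[symmetric]
    by (intro prod.cong refl) (simp add: power_add power_mult_distrib[symmetric])
  also have "\<dots> = (-1) ^ (m * m)" by (simp add: power_mult)
  also have "\<dots> = (-1) ^ (CARD('n) + 1)" by (simp add: m minus_one_power_iff)
  finally show ?thesis .
qed

text \<open>Instead of an induction on the Cech degree, all the equations are integrated and added
  with weights. The integrals of \<xi> cancel in pairs, \<theta> survives only for singletons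
  \<open>A\<close>, and \<gamma> only for \<open>A = UNIV\<close>.\<close>

lemma cech_descent:
  fixes \<theta> :: "'n::{finite,linorder} form" and \<gamma> \<xi> :: "('n, 'n) cochain"
  assumes pos: "0 < a" "0 < d" "0 < h"
    and \<theta>: "\<And>j. continuous_on {z. z $ j \<noteq> 0} (\<lambda>z. \<theta> z UNIV (- {j}))"
    and \<gamma>: "continuous_on {z. \<forall>i. z $ i \<noteq> 0} (\<lambda>z. \<gamma> index_list z UNIV {})"
    and \<xi>: "cd_cochain coord_cover CARD('n) q \<xi>"
    and eq: "\<And>\<alpha> z I J. \<alpha> \<noteq> [] \<Longrightarrow> z \<in> cover_inter coord_cover \<alpha> \<Longrightarrow>
          of_form \<theta> \<alpha> z I J - of_cech (CARD('n) - 1) \<gamma> \<alpha> z I J = cd_diff \<xi> \<alpha> z I J"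
  shows "(\<Sum>j\<in>UNIV. (-1) ^ rank_in UNIV j * (LINT z|lborel. \<theta> z UNIV (- {j}) * polydisc_test a h d {j} z)) =
     (-1) ^ (CARD('n) + 1) * (LINT z|lborel. \<gamma> index_list z UNIV {} * polydisc_test a h d UNIV z)"
proof -
  let ?n = "CARD('n)" and ?L = "sorted_list_of_set :: 'n set \<Rightarrow> 'n list"
  let ?T = "\<lambda>A z. polydisc_test a h d A z"
  \<comment> \<open>Each \<open>Q B i\<close> with i in \<open>B\<close> and card \<open>B\<close>
    at least 2 occurs twice: as the face of \<open>B\<close> omitting i, and by parts from the
    derivative in cnj z_i at \<open>B - {i}\<close>.\<close>
  define Q where "Q B i = (LINT z|lborel. \<xi> (?L (B - {i})) z UNIV (- B) * ?T B z)" for B :: "'n set" and i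
  have Ck: "Ck_on 1 (\<lambda>z. \<xi> (?L A) z I J) {z. \<forall>i\<in>A. z $ i \<noteq> 0}" if "A \<noteq> {}" for A I J
    using \<xi> that unfolding cd_cochain_def smooth_form_def cover_inter_sorted[symmetric]
    by (metis Ck_on_of_smooth_on finite set_empty set_sorted_list_of_set)
  have cont: "continuous_on {z. \<forall>i\<in>A. z $ i \<noteq> 0} (\<lambda>z. \<xi> (?L A) z I J)" if "A \<noteq> {}" for A I J
    using Ck_on_1_continuous[OF Ck[OF that]] .
  have intQ: "integrable lborel (\<lambda>z. \<xi> (?L (B - {i})) z UNIV (- B) * ?T B z)" if "i \<in> B" "card B \<ge> 2" for B i
  proof (rule polydisc_test_integrable[OF pos])
    have "card (B - {i}) > 0" using that by simp
    then have "B - {i} \<noteq> {}" by (metis card.empty less_irrefl)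
    from cont[OF this] show "continuous_on {z. \<forall>i\<in>B. z $ i \<noteq> 0} (\<lambda>z. \<xi> (?L (B - {i})) z UNIV (- B))"
      by (rule continuous_on_subset) auto
  qed
  \<comment> \<open>The cocycle equation holds only where z_i \<noteq> 0 for all i in
    \<open>A\<close>; elsewhere the test function is 0, so the multiplied equation holds
    everywhere.\<close>
  have zero: "?T A z = 0" if "\<not> (\<forall>i\<in>A. z $ i \<noteq> 0)" for A z
    using that by (auto simp: polydisc_test_def intro!: prod_zero)

  have delta: "(LINT z|lborel. cech_delta \<xi> (?L A) z UNIV (- A) * ?T A z) =
        (if card A \<ge> 2 then \<Sum>i\<in>A. (-1) ^ rank_in A i * Q A i else 0)
      \<and> integrable lborel (\<lambda>z. cech_delta \<xi> (?L A) z UNIV (- A) * ?T A z)" for A :: "'n set"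
  proof (cases "card A \<ge> 2")
    case True
    have *: "cech_delta \<xi> (?L A) z UNIV (- A) * ?T A z =
        (\<Sum>i\<in>A. (-1) ^ rank_in A i * (\<xi> (?L (A - {i})) z UNIV (- A) * ?T A z))" for z
      by (simp add: cech_delta_sorted[OF True] sum_distrib_right mult.assoc)
    show ?thesis unfolding * using True intQ[OF _ True]
      by (subst Bochner_Integration.integral_sum) (auto simp: Q_def)
  next
    case False
    then show ?thesis by (simp add: cech_delta_def)
  qed
  have dbar: "(LINT z|lborel. dbar (\<xi> (?L A)) z UNIV (- A) * ?T A z) =
        - ((-1) ^ ?n * (\<Sum>j\<in>- A. (-1) ^ rank_in (- A) j * Q (insert j A) j))
      \<and> integrable lborel (\<lambda>z. dbar (\<xi> (?L A)) z UNIV (- A) * ?T A z)" if A: "A \<noteq> {}" for A :: "'n set"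
  proof -
    have *: "dbar (\<xi> (?L A)) z UNIV (- A) * ?T A z = (-1) ^ ?n * (\<Sum>j\<in>- A. (-1) ^ rank_in (- A) j *
       (d_zbar j (\<lambda>w. \<xi> (?L A) w UNIV (- insert j A)) z * ?T A z))" for z
    proof -
      have "- A - {j} = - insert j A" for j by auto
      then show ?thesis by (simp add: dbar_def rank_in_def sum_distrib_right sum_distrib_left mult.assoc)
    qed
    have ibp: "(LINT z|lborel. d_zbar j (\<lambda>w. \<xi> (?L A) w UNIV (- insert j A)) z * ?T A z) = - Q (insert j A) j
        \<and> integrable lborel (\<lambda>z. d_zbar j (\<lambda>w. \<xi> (?L A) w UNIV (- insert j A)) z * ?T A z)" if "j \<in> - A" for j
    proof -
      have j: "j \<notin> A" "insert j A - {j} = A" using that by auto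
      show ?thesis unfolding Q_def j(2)
        using polydisc_test_ibp[OF pos(1-3) j(1) Ck[OF A, of UNIV "- insert j A"]] by simp
    qed
    let ?g = "\<lambda>j z. (-1) ^ rank_in (- A) j * (d_zbar j (\<lambda>w. \<xi> (?L A) w UNIV (- insert j A)) z * ?T A z)"
    have g: "integrable lborel (?g j)" "(LINT z|lborel. ?g j z) = - ((-1) ^ rank_in (- A) j * Q (insert j A) j)"
      if "j \<in> - A" for j using ibp[OF that] by simp_all
    have "(LINT z|lborel. (\<Sum>j\<in>- A. ?g j z)) = - (\<Sum>j\<in>- A. (-1) ^ rank_in (- A) j * Q (insert j A) j)"
      by (subst Bochner_Integration.integral_sum) (simp_all add: g(1) g(2)[simplified] sum_negf)
    moreover have "integrable lborel (\<lambda>z. \<Sum>j\<in>- A. ?g j z)"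
      using g(1) by (intro Bochner_Integration.integrable_sum) auto
    ultimately show ?thesis unfolding * by simp
  qed
  have integrated: "(LINT z|lborel. (of_form \<theta> (?L A) z UNIV (- A) - of_cech (?n - 1) \<gamma> (?L A) z UNIV (- A)) * ?T A z) =
      (if card A \<ge> 2 then \<Sum>i\<in>A. (-1) ^ rank_in A i * Q A i else 0)
       - (-1) ^ (card A - 1) * (-1) ^ ?n * (\<Sum>j\<in>- A. (-1) ^ rank_in (- A) j * Q (insert j A) j)"
    if A: "A \<noteq> {}" for A :: "'n set"
  proof -
    have "?L A \<noteq> []" using A by simp
    then have "(of_form \<theta> (?L A) z UNIV (- A) - of_cech (?n - 1) \<gamma> (?L A) z UNIV (- A)) * ?T A z =
        cech_delta \<xi> (?L A) z UNIV (- A) * ?T A z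
          + (-1) ^ (card A - 1) * (dbar (\<xi> (?L A)) z UNIV (- A) * ?T A z)" for z
      using eq[of "?L A" z UNIV "- A"] zero[of A z] unfolding cover_inter_sorted
      by (cases "\<forall>i\<in>A. z $ i \<noteq> 0") (auto simp: cd_diff_def algebra_simps)
    then show ?thesis using delta[of A] dbar[OF A] by simp
  qed
  let ?W = "descent_weight ?n :: 'n set \<Rightarrow> complex"
  let ?S = "{A :: 'n set. A \<noteq> {}}"
  have sum0: "(\<Sum>A\<in>?S. ?W A * (LINT z|lborel. (of_form \<theta> (?L A) z UNIV (- A) -
      of_cech (?n - 1) \<gamma> (?L A) z UNIV (- A)) * ?T A z)) = 0"
  proof -
    let ?f = "\<lambda>(B, i). ?W B * ((-1) ^ rank_in B i * Q B i)"
    have 1: "(\<Sum>A\<in>?S. ?W A * (if card A \<ge> 2 then \<Sum>i\<in>A. (-1) ^ rank_in A i * Q A i else 0)) =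
       sum ?f (SIGMA B:{B. card B \<ge> 2}. B)"
    proof -
      have "(\<Sum>A\<in>?S. ?W A * (if card A \<ge> 2 then \<Sum>i\<in>A. (-1) ^ rank_in A i * Q A i else 0)) =
        (\<Sum>A\<in>{B. card B \<ge> 2}. ?W A * (\<Sum>i\<in>A. (-1) ^ rank_in A i * Q A i))"
        by (rule sum.mono_neutral_cong_right) auto
      then show ?thesis by (simp add: sum.Sigma sum_distrib_left)
    qed
    have 2: "(\<Sum>A\<in>?S. ?W A * ((-1) ^ (card A - 1) * (-1) ^ ?n * (\<Sum>j\<in>- A. (-1) ^ rank_in (- A) j * Q (insert j A) j))) =
       sum ?f (SIGMA B:{B. card B \<ge> 2}. B)"
    proof -
      have "(\<Sum>A\<in>?S. ?W A * ((-1) ^ (card A - 1) * (-1) ^ ?n * (\<Sum>j\<in>- A. (-1) ^ rank_in (- A) j * Q (insert j A) j))) =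
        (\<Sum>(A, j)\<in>(SIGMA A:?S. - A). ?W A * (-1) ^ (card A - 1) * (-1) ^ ?n * (-1) ^ rank_in (- A) j * Q (insert j A) j)"
        by (simp add: sum.Sigma sum_distrib_left mult.assoc)
      also have "\<dots> = sum ?f (SIGMA B:{B. card B \<ge> 2}. B)"
      \<comment> \<open>Pairs of a nonempty set and a point outside it match pairs of a set with at
        least two elements and a point in it.\<close>
      proof (rule sum.reindex_bij_witness[where i="\<lambda>(B, j). (B - {j}, j)" and j="\<lambda>(A, j). (insert j A, j)"])
        fix x assume "x \<in> (SIGMA A:?S. - A)"
        then obtain A j where x: "x = (A, j)" "A \<noteq> {}" "j \<notin> A" by auto
        then have c: "card (insert j A) \<ge> 2"
          by (simp add: Suc_le_eq card_gt_0_iff)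
        have j: "insert j A - {j} = A" using x by auto
        from descent_weight_remove[OF insertI1 c, of ?n, unfolded j]
        show "?f (case x of (A, j) \<Rightarrow> (insert j A, j)) = (case x of (A, j) \<Rightarrow>
          ?W A * (-1) ^ (card A - 1) * (-1) ^ ?n * (-1) ^ rank_in (- A) j * Q (insert j A) j)"
          by (simp add: x mult.assoc)
        show "(case x of (A, j) \<Rightarrow> (insert j A, j)) \<in> (SIGMA B:{B. card B \<ge> 2}. B)"
          using c by (simp add: x)
        show "(case case x of (A, j) \<Rightarrow> (insert j A, j) of (B, j) \<Rightarrow> (B - {j}, j)) = x"
          using j by (simp add: x)
      next
        fix y :: "'n set \<times> 'n" assume "y \<in> (SIGMA B:{B. card B \<ge> 2}. B)"
        then obtain B j where y: "y = (B, j)" "card B \<ge> 2" "j \<in> B" by auto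
        then show "(case case y of (B, j) \<Rightarrow> (B - {j}, j) of (A, j) \<Rightarrow> (insert j A, j)) = y"
          by auto
        have "card (B - {j}) > 0" using y by simp
        then have "B - {j} \<noteq> {}" by (metis card.empty less_irrefl)
        then show "(case y of (B, j) \<Rightarrow> (B - {j}, j)) \<in> (SIGMA A:?S. - A)"
          by (simp add: y)
      qed
      finally show ?thesis .
    qed
    have "(\<Sum>A\<in>?S. ?W A * (LINT z|lborel. (of_form \<theta> (?L A) z UNIV (- A) -
      of_cech (?n - 1) \<gamma> (?L A) z UNIV (- A)) * ?T A z)) =
      (\<Sum>A\<in>?S. ?W A * (if card A \<ge> 2 then \<Sum>i\<in>A. (-1) ^ rank_in A i * Q A i else 0) -
          ?W A * ((-1) ^ (card A - 1) * (-1) ^ ?n * (\<Sum>j\<in>- A. (-1) ^ rank_in (- A) j * Q (insert j A) j)))"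
      by (intro sum.cong refl, subst integrated) (simp, simp only: right_diff_distrib)
    then show ?thesis by (simp only: sum_subtractf 1 2 diff_self)
  qed
  have int1: "integrable lborel (\<lambda>z. of_form \<theta> (?L A) z UNIV (- A) * ?T A z)" for A
  proof (cases "card A = 1")
    case True
    then obtain j where "A = {j}" by (auto simp: card_1_singleton_iff)
    then show ?thesis using polydisc_test_integrable[OF pos, of "{j}" "\<lambda>z. \<theta> z UNIV (- {j})"] \<theta>[of j]
      by (simp add: of_form_def)
  qed (simp add: of_form_def)
  have int2: "integrable lborel (\<lambda>z. of_cech (?n - 1) \<gamma> (?L A) z UNIV (- A) * ?T A z)" for A :: "'n set"
  proof (cases "card A = ?n")
    case True
    then have "A = UNIV" by (simp add: card_eq_UNIV_imp_eq_UNIV)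
    then show ?thesis using polydisc_test_integrable[OF pos, of "UNIV" "\<lambda>z. \<gamma> index_list z UNIV {}"] \<gamma>
      by (simp add: of_cech_def index_list_def)
  qed (simp add: of_cech_def)
  have split: "(LINT z|lborel. (of_form \<theta> (?L A) z UNIV (- A) - of_cech (?n - 1) \<gamma> (?L A) z UNIV (- A)) * ?T A z) =
     (LINT z|lborel. of_form \<theta> (?L A) z UNIV (- A) * ?T A z) -
     (LINT z|lborel. of_cech (?n - 1) \<gamma> (?L A) z UNIV (- A) * ?T A z)" for A
    using int1[of A] int2[of A] by (simp add: left_diff_distrib)
  have t1: "(\<Sum>A\<in>?S. ?W A * (LINT z|lborel. of_form \<theta> (?L A) z UNIV (- A) * ?T A z)) =
     (\<Sum>j\<in>UNIV. (-1) ^ rank_in UNIV j * (LINT z|lborel. \<theta> z UNIV (- {j}) * ?T {j} z))"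
  proof -
    have "(\<Sum>A\<in>?S. ?W A * (LINT z|lborel. of_form \<theta> (?L A) z UNIV (- A) * ?T A z)) =
      (\<Sum>A\<in>(\<lambda>j. {j}) ` UNIV. ?W A * (LINT z|lborel. of_form \<theta> (?L A) z UNIV (- A) * ?T A z))"
    proof (rule sum.mono_neutral_right)
      show "\<forall>A\<in>?S - range (\<lambda>j. {j}). ?W A * (LINT z|lborel. of_form \<theta> (?L A) z UNIV (- A) * ?T A z) = 0"
      proof
        fix A assume "A \<in> ?S - range (\<lambda>j. {j})"
        then have "card A \<noteq> 1" by (auto simp: card_1_singleton_iff)
        then show "?W A * (LINT z|lborel. of_form \<theta> (?L A) z UNIV (- A) * ?T A z) = 0"
          by (simp add: of_form_def)
      qed
    qed auto
    also have "\<dots> = (\<Sum>j\<in>UNIV. (-1) ^ rank_in UNIV j * (LINT z|lborel. \<theta> z UNIV (- {j}) * ?T {j} z))"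
      by (subst sum.reindex) (auto simp: of_form_def descent_weight_def intro!: injI)
    finally show ?thesis .
  qed
  have t2: "(\<Sum>A\<in>?S. ?W A * (LINT z|lborel. of_cech (?n - 1) \<gamma> (?L A) z UNIV (- A) * ?T A z)) =
     ?W UNIV * (LINT z|lborel. \<gamma> index_list z UNIV {} * ?T UNIV z)"
  proof -
    have "(\<Sum>A\<in>?S. ?W A * (LINT z|lborel. of_cech (?n - 1) \<gamma> (?L A) z UNIV (- A) * ?T A z)) =
      (\<Sum>A\<in>{UNIV}. ?W A * (LINT z|lborel. of_cech (?n - 1) \<gamma> (?L A) z UNIV (- A) * ?T A z))"
    proof (rule sum.mono_neutral_right)
      show "\<forall>A\<in>?S - {UNIV}. ?W A * (LINT z|lborel. of_cech (?n - 1) \<gamma> (?L A) z UNIV (- A) * ?T A z) = 0"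
      proof
        fix A assume "A \<in> ?S - {UNIV}"
        then have "card A \<noteq> ?n" using card_eq_UNIV_imp_eq_UNIV[of A] by auto
        then show "?W A * (LINT z|lborel. of_cech (?n - 1) \<gamma> (?L A) z UNIV (- A) * ?T A z) = 0"
          by (simp add: of_cech_def)
      qed
    qed auto
    then show ?thesis by (simp add: of_cech_def index_list_def)
  qed
  have "(\<Sum>A\<in>?S. ?W A * (LINT z|lborel. of_form \<theta> (?L A) z UNIV (- A) * ?T A z)) -
     (\<Sum>A\<in>?S. ?W A * (LINT z|lborel. of_cech (?n - 1) \<gamma> (?L A) z UNIV (- A) * ?T A z)) = 0"
    using sum0 unfolding split by (simp add: right_diff_distrib sum_subtractf)
  then show ?thesis unfolding t1 t2 descent_weight_UNIV by (simp only: right_minus_eq)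
qed

subsection \<open>Lebesgue measure under isometries and on products\<close>

text \<open>Uniqueness of the translation-invariant measure, by Fubini with the indicator of the unit ball,
  which the isometry preserves.\<close>

lemma distr_lborel_isometry:
  fixes T :: "'a::euclidean_space \<Rightarrow> 'a"
  assumes lin: "linear T" and iso: "\<And>x. norm (T x) = norm x"
  shows "distr lborel borel T = lborel"
proof (rule measure_eqI)
  have cT: "continuous_on UNIV T" using lin linear_continuous_on linear_conv_bounded_linear by blast
  have mT[measurable]: "T \<in> borel_measurable borel"
    using cT borel_measurable_continuous_onI by blast
  let ?N = "distr lborel borel T"
  interpret N: sigma_finite_measure ?N
  proof
    have "inj T"
      using linear_injective_0[OF lin] iso by (metis norm_eq_zero)
    let ?A = "range (\<lambda>k::nat. cball (0::'a) (real k))"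
    have "T -` cball 0 r = cball 0 r" for r using iso by auto
    then show "\<exists>A. countable A \<and> A \<subseteq> sets ?N \<and> \<Union> A = space ?N \<and> (\<forall>a\<in>A. emeasure ?N a \<noteq> \<infinity>)"
      using emeasure_compact_finite[OF compact_cball, of "0::'a"]
      by (intro exI[of _ ?A]) (auto simp: emeasure_distr less_top intro: real_arch_simple)
  qed
  interpret pair_sigma_finite ?N lborel ..
  have N_trans: "(\<integral>\<^sup>+x. f (x + c) \<partial>?N) = (\<integral>\<^sup>+x. f x \<partial>?N)"
    if [measurable]: "f \<in> borel_measurable borel" for f :: "'a \<Rightarrow> ennreal" and c
  proof -
    \<comment> \<open>Translating the image by c amounts to translating the source by a preimage of
      c.\<close>
    have "surj T"
      using lin iso linear_injective_0[OF lin] linear_inj_imp_surj by (metis norm_eq_zero)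
    then obtain e where c: "c = T e" by (metis surjD)
    have "(\<integral>\<^sup>+x. f (x + c) \<partial>?N) = (\<integral>\<^sup>+x. f (T (e + x)) \<partial>lborel)"
      by (simp add: nn_integral_distr c linear_add[OF lin] add.commute)
    also have "\<dots> = (\<integral>\<^sup>+x. f (T x) \<partial>distr lborel borel ((+) e))"
      by (simp add: nn_integral_distr)
    finally show ?thesis by (simp add: lborel_distr_plus nn_integral_distr)
  qed
  have L_trans: "(\<integral>\<^sup>+x. f (x + c) \<partial>lborel) = (\<integral>\<^sup>+x. f x \<partial>lborel)"
    if [measurable]: "f \<in> borel_measurable borel" for f :: "'a \<Rightarrow> ennreal" and c
  proof -
    have "(\<integral>\<^sup>+x. f (x + c) \<partial>lborel) = (\<integral>\<^sup>+x. f x \<partial>distr lborel borel ((+) c))"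
      by (simp add: nn_integral_distr add.commute)
    then show ?thesis by (simp add: lborel_distr_plus)
  qed
  fix X assume "X \<in> sets ?N"
  then have [measurable]: "X \<in> sets borel" by simp
  let ?f = "indicator X :: 'a \<Rightarrow> ennreal"
  let ?b = "indicator (cball 0 1) :: 'a \<Rightarrow> ennreal"
  have mb: "?b \<in> borel_measurable borel" and mf: "?f \<in> borel_measurable borel"
    by (auto intro!: borel_measurable_indicator)
  have m1: "(\<lambda>(x, y). ?f x * ?b (y - x)) \<in> borel_measurable (?N \<Otimes>\<^sub>M lborel)"
    unfolding split_beta'
  proof (rule borel_measurable_times_ennreal)
    show "(\<lambda>p. ?f (fst p)) \<in> borel_measurable (?N \<Otimes>\<^sub>M lborel)"
      by (rule measurable_compose[OF _ mf]) measurable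
    show "(\<lambda>p. ?b (snd p - fst p)) \<in> borel_measurable (?N \<Otimes>\<^sub>M lborel)"
      by (rule measurable_compose[OF _ mb]) measurable
  qed
  have m2: "(\<lambda>(x, y). ?f (x + y) * ?b (- x)) \<in> borel_measurable (?N \<Otimes>\<^sub>M lborel)"
    unfolding split_beta'
  proof (rule borel_measurable_times_ennreal)
    show "(\<lambda>p. ?f (fst p + snd p)) \<in> borel_measurable (?N \<Otimes>\<^sub>M lborel)"
      by (rule measurable_compose[OF _ mf]) measurable
    show "(\<lambda>p. ?b (- fst p)) \<in> borel_measurable (?N \<Otimes>\<^sub>M lborel)"
      by (rule measurable_compose[OF _ mb]) measurable
  qed
  have vT: "T -` cball 0 1 = cball 0 1" using iso by auto
  have b: "(\<integral>\<^sup>+x. ?b x \<partial>?N) = emeasure lborel (cball (0::'a) 1)"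
    by (simp add: emeasure_distr vT)
  have "(\<integral>\<^sup>+x. ?f x \<partial>?N) * (\<integral>\<^sup>+y. ?b y \<partial>lborel) = (\<integral>\<^sup>+x. \<integral>\<^sup>+y. ?f x * ?b (y - x) \<partial>lborel \<partial>?N)"
  proof -
    have "(\<integral>\<^sup>+y. ?f x * ?b (y - x) \<partial>lborel) = ?f x * (\<integral>\<^sup>+y. ?b y \<partial>lborel)" for x
    proof -
      have "(\<lambda>y. ?b (y - x)) \<in> borel_measurable lborel"
        using measurable_compose[OF _ mb, of "\<lambda>y. y - x" lborel] by simp
      from nn_integral_cmult[OF this, of "?f x"] show ?thesis
        using L_trans[OF mb, of "- x"] by simp
    qed
    then show ?thesis by (simp add: nn_integral_multc)
  qed
  also have "\<dots> = (\<integral>\<^sup>+y. \<integral>\<^sup>+x. ?f x * ?b (y - x) \<partial>?N \<partial>lborel)"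
    by (rule Fubini'[OF m1, symmetric])
  \<comment> \<open>Translating x by y frees the ball indicator of y; after a second exchange the
    inner integral over y no longer depends on x.\<close>
  also have "\<dots> = (\<integral>\<^sup>+y. \<integral>\<^sup>+x. ?f (x + y) * ?b (- x) \<partial>?N \<partial>lborel)"
  proof (rule nn_integral_cong)
    fix y
    show "(\<integral>\<^sup>+x. ?f x * ?b (y - x) \<partial>?N) = (\<integral>\<^sup>+x. ?f (x + y) * ?b (- x) \<partial>?N)"
    proof -
      have "(\<lambda>x. ?b (y - x)) \<in> borel_measurable borel"
        by (rule measurable_compose[OF _ mb]) measurable
      from N_trans[OF borel_measurable_times_ennreal[OF mf this], of y] show ?thesis by simp
    qed
  qed
  also have "\<dots> = (\<integral>\<^sup>+x. \<integral>\<^sup>+y. ?f (x + y) * ?b (- x) \<partial>lborel \<partial>?N)"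
    by (rule Fubini'[OF m2])
  also have "\<dots> = (\<integral>\<^sup>+x. (\<integral>\<^sup>+y. ?f y \<partial>lborel) * ?b (- x) \<partial>?N)"
  proof (rule nn_integral_cong)
    fix x
    show "(\<integral>\<^sup>+y. ?f (x + y) * ?b (- x) \<partial>lborel) = (\<integral>\<^sup>+y. ?f y \<partial>lborel) * ?b (- x)"
    proof -
      have "(\<lambda>y. ?f (x + y)) \<in> borel_measurable lborel"
        using measurable_compose[OF _ mf, of "\<lambda>y. x + y" lborel] by simp
      from nn_integral_multc[OF this, of "?b (- x)"] show ?thesis
        using L_trans[OF mf, of x] by (simp add: add.commute)
    qed
  qed
  also have "\<dots> = (\<integral>\<^sup>+y. ?f y \<partial>lborel) * (\<integral>\<^sup>+x. ?b x \<partial>?N)"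
  proof -
    have "?b (- x) = ?b x" for x by (simp add: indicator_def)
    then show ?thesis
      using nn_integral_cmult[of ?b ?N "\<integral>\<^sup>+y. ?f y \<partial>lborel"] mb by simp
  qed
  finally have "emeasure ?N X * emeasure lborel (cball (0::'a) 1) = emeasure lborel X * emeasure lborel (cball (0::'a) 1)"
    by (simp add: b)
  moreover have "emeasure lborel (cball (0::'a) 1) \<noteq> 0"
    using content_cball_gt_0_iff[of "0::'a" 1] by (auto simp: measure_def)
  moreover have "emeasure lborel (cball (0::'a) 1) \<noteq> \<infinity>"
    using emeasure_compact_finite[OF compact_cball, of "0::'a" 1] by simp
  ultimately show "emeasure ?N X = emeasure lborel X"
    by (metis infinity_ennreal_def mult_divide_eq_ennreal)
qed simp

text \<open>\<open>lborel\<close> on \<open>'a^'n\<close> is identified with the image of the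
  product measure by comparing both on open boxes, the basis of \<open>'a^'n\<close> consisting of
  the vectors \<open>axis i u\<close> with u in the basis of \<open>'a\<close>.\<close>

lemma measure_vec_product:
  fixes S :: "'n::finite \<Rightarrow> ('a::euclidean_space) set"
  assumes S: "\<And>i. S i \<in> sets borel"
  shows "emeasure lborel {z :: 'a^'n. \<forall>i. z $ i \<in> S i} = (\<Prod>i\<in>UNIV. emeasure lborel (S i))"
proof -
  interpret product_sigma_finite "\<lambda>_::'n. lborel :: 'a measure" ..
  let ?P = "PiM (UNIV :: 'n set) (\<lambda>_. lborel :: 'a measure)"
  have m[measurable]: "(\<lambda>f. \<chi> i. f i) \<in> ?P \<rightarrow>\<^sub>M (borel :: ('a^'n) measure)"
  proof (rule borel_measurable_euclidean_space[THEN iffD2], intro ballI)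
    fix b :: "'a^'n" assume "b \<in> Basis"
    then obtain i u where b: "b = axis i u" "u \<in> Basis" by (auto simp: Basis_vec_def)
    show "(\<lambda>f. (\<chi> i. f i) \<bullet> b) \<in> borel_measurable ?P"
      unfolding b inner_axis by (simp, measurable)
  qed
  have *: "emeasure (distr ?P borel (\<lambda>f. \<chi> i. f i)) {z. \<forall>i. z $ i \<in> S i} = (\<Prod>i\<in>UNIV. emeasure lborel (S i))"
    if S: "\<And>i. S i \<in> sets borel" for S :: "'n \<Rightarrow> 'a set"
  proof -
    have "{z :: 'a^'n. \<forall>i. z $ i \<in> S i} = (\<Inter>i. (\<lambda>z. z $ i) -` S i \<inter> space borel)" by auto
    also have "\<dots> \<in> sets borel"
      using S by (intro sets.finite_INT measurable_sets[OF borel_measurable_continuous_onI])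
        (auto intro!: continuous_intros)
    finally have "emeasure (distr ?P borel (\<lambda>f. \<chi> i. f i)) {z. \<forall>i. z $ i \<in> S i} =
       emeasure ?P ((\<lambda>f. \<chi> i. f i) -` {z :: 'a^'n. \<forall>i. z $ i \<in> S i} \<inter> space ?P)"
      by (intro emeasure_distr m) 
    also have "(\<lambda>f. \<chi> i. f i) -` {z :: 'a^'n. \<forall>i. z $ i \<in> S i} \<inter> space ?P = Pi\<^sub>E UNIV S"
      by (auto simp: space_PiM PiE_def Pi_def)
    also have "emeasure ?P (Pi\<^sub>E UNIV S) = (\<Prod>i\<in>UNIV. emeasure lborel (S i))"
      using S by (intro emeasure_PiM) auto
    finally show ?thesis .
  qed
  have "lborel = distr ?P borel (\<lambda>f. \<chi> i. f i)"
  proof (rule lborel_eqI)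
    fix l u :: "'a^'n" assume le: "\<And>b. b \<in> Basis \<Longrightarrow> l \<bullet> b \<le> u \<bullet> b"
    have le': "l $ i \<bullet> b \<le> u $ i \<bullet> b" if "b \<in> Basis" for i b
      using le[of "axis i b"] that by (simp add: inner_axis axis_in_Basis_iff)
    have "box l u = {z. \<forall>i. z $ i \<in> box (l $ i) (u $ i)}"
      by (auto simp: box_def Basis_vec_def inner_axis)
    then have "emeasure (distr ?P borel (\<lambda>f. \<chi> i. f i)) (box l u) = (\<Prod>i\<in>UNIV. emeasure lborel (box (l $ i) (u $ i)))"
      using *[of "\<lambda>i. box (l $ i) (u $ i)"] by simp
    also have "\<dots> = (\<Prod>i\<in>UNIV. ennreal (\<Prod>b\<in>Basis. (u $ i - l $ i) \<bullet> b))"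
      using le' by (simp add: emeasure_lborel_box_eq inner_diff_left)
    also have "\<dots> = ennreal (\<Prod>i\<in>UNIV. \<Prod>b\<in>Basis. (u $ i - l $ i) \<bullet> b)"
      using le' by (subst prod_ennreal) (auto intro!: prod_nonneg simp: inner_diff_left)
    also have "(\<Prod>i\<in>UNIV. \<Prod>b\<in>Basis. (u $ i - l $ i) \<bullet> b) = (\<Prod>b\<in>Basis. (u - l) \<bullet> b)"
    proof -
      have bij: "bij_betw (\<lambda>(i, b). axis i b) (UNIV \<times> Basis) (Basis :: ('a^'n) set)"
        by (auto simp: bij_betw_def inj_on_def axis_eq_axis Basis_vec_def)
      have "(\<Prod>b\<in>Basis. (u - l) \<bullet> b) = (\<Prod>(i, b)\<in>UNIV \<times> Basis. (u - l) \<bullet> axis i b)"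
        using prod.reindex_bij_betw[OF bij, of "\<lambda>b. (u - l) \<bullet> b"] by (simp add: split_beta)
      then show ?thesis by (simp add: prod.cartesian_product inner_axis)
    qed
    finally show "emeasure (distr ?P borel (\<lambda>f. \<chi> i. f i)) (box l u) = ennreal (\<Prod>b\<in>Basis. (u - l) \<bullet> b)" .
  qed simp
  then show ?thesis using *[OF S] by simp
qed

text \<open>The area is pi (a + h) - pi a; its independence of \<open>a\<close> is what measuring in
  squared radius buys.\<close>

lemma emeasure_annulus:
  assumes "0 < a" "0 < h"
  shows "emeasure lborel {w :: complex. (norm w)\<^sup>2 \<in> {a<..a + h}} = ennreal (pi * h)"
proof -
  have *: "norm w \<le> sqrt s \<longleftrightarrow> (norm w)\<^sup>2 \<le> s" for w :: complex and s
    by (metis abs_norm_cancel real_sqrt_abs real_sqrt_le_iff)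
  have "{w :: complex. (norm w)\<^sup>2 \<in> {a<..a + h}} = cball 0 (sqrt (a + h)) - cball 0 (sqrt a)"
    using assms by (auto simp: * intro: order_trans[OF _ less_imp_le])
  also have "emeasure lborel \<dots> = emeasure lborel (cball (0::complex) (sqrt (a + h))) - emeasure lborel (cball (0::complex) (sqrt a))"
    using assms emeasure_compact_finite[OF compact_cball, of "0::complex" "sqrt a"]
    by (intro emeasure_Diff) (auto intro!: order_trans[OF _ real_sqrt_le_mono[of a "a + h"]])
  also have "\<dots> = ennreal (pi * h)"
    using assms by (simp add: emeasure_cball unit_ball_vol_2 algebra_simps flip: ennreal_minus)
  finally show ?thesis .
qed

subsection \<open>Thin shells around the sphere and the torus\<close>

lemma integral_lborel_scale:
  fixes f :: "'a::euclidean_space \<Rightarrow> complex"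
  assumes c: "c > 0" and f[measurable]: "f \<in> borel_measurable borel"
  shows "(LINT x|lborel. f x) = of_real (c ^ DIM('a)) * (LINT x|lborel. f (c *\<^sub>R x))"
proof -
  have "(LINT x|lborel. f x) = (LINT x|density (distr lborel borel (\<lambda>x. c *\<^sub>R x)) (\<lambda>_. ennreal (\<bar>c\<bar> ^ DIM('a))). f x)"
    using lborel_affine[of c "0::'a"] c by simp
  also have "\<dots> = (LINT x|distr lborel borel (\<lambda>x. c *\<^sub>R x). (c ^ DIM('a)) *\<^sub>R f x)"
    using c by (subst integral_density) auto
  also have "\<dots> = (LINT x|lborel. (c ^ DIM('a)) *\<^sub>R f (c *\<^sub>R x))"
    by (subst integral_distr) auto
  finally show ?thesis by (simp add: scaleR_conv_of_real)
qed

lemma norm_le_sqrt_iff: "norm x \<le> sqrt s \<longleftrightarrow> (norm x)\<^sup>2 \<le> s"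
  by (metis abs_norm_cancel real_sqrt_abs real_sqrt_le_iff)

lemma compact_norm_shell: "compact {x :: 'a::euclidean_space. s \<le> (norm x)\<^sup>2 \<and> (norm x)\<^sup>2 \<le> t}"
proof -
  have "closed {x :: 'a. s \<le> (norm x)\<^sup>2 \<and> (norm x)\<^sup>2 \<le> t}"
    by (intro closed_Collect_conj closed_Collect_le continuous_intros)
  moreover have "{x :: 'a. s \<le> (norm x)\<^sup>2 \<and> (norm x)\<^sup>2 \<le> t} \<subseteq> cball 0 (sqrt t)"
    by (auto simp: norm_le_sqrt_iff)
  then have "bounded {x :: 'a. s \<le> (norm x)\<^sup>2 \<and> (norm x)\<^sup>2 \<le> t}"
    using bounded_cball bounded_subset by blast
  ultimately show ?thesis by (simp add: compact_eq_bounded_closed)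
qed

text \<open>Factor x^2 - R^2 and use x + R \<ge> R.\<close>

lemma radial_distance_le:
  fixes x :: real
  assumes "R > 0" "0 \<le> x" "R\<^sup>2 \<le> x\<^sup>2" "x\<^sup>2 \<le> R\<^sup>2 + h"
  shows "\<bar>x - R\<bar> \<le> h / R"
proof -
  have xR: "x \<ge> R" using assms by (metis abs_le_square_iff abs_of_nonneg abs_of_pos)
  have "(x - R) * R \<le> (x - R) * (x + R)"
    using assms xR by (intro mult_left_mono) auto
  also have "\<dots> \<le> h" using assms by (simp add: power2_eq_square algebra_simps)
  finally show ?thesis using assms xR by (simp add: field_simps)
qed

text \<open>Let \<open>G\<close> be the extension of \<open>g\<close> from the sphere that is
  constant along rays. By homogeneity its shell integral is exactly ((R^2 + h) / R^2)^n - 1 times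
  its ball integral, with derivative n / R^2 at h = 0. The error \<open>g - G\<close> is uniformly
  small on thin shells, whose volume is of order h.\<close>

lemma annulus_limit_sphere:
  fixes g :: "'a::euclidean_space \<Rightarrow> complex"
  assumes g: "continuous_on (- {0}) g" "g 0 = 0" and R: "R > 0" and N: "DIM('a) = 2 * n"
  defines "J \<equiv> LINT x:cball 0 R|lborel. g ((R / norm x) *\<^sub>R x)"
  shows "((\<lambda>h. (1 / of_real h) * (LINT x|lborel. indicator {R\<^sup>2<..R\<^sup>2 + h} ((norm x)\<^sup>2) * g x))
           \<longlongrightarrow> of_real (real n / R\<^sup>2) * J) (at_right 0)"
proof -
  define G where "G x = g ((R / norm x) *\<^sub>R x)" for x
  let ?a = "R\<^sup>2"
  let ?A = "\<lambda>h. {x :: 'a. (norm x)\<^sup>2 \<in> {?a<..?a + h}}"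
  have cG: "continuous_on (- {0}) G"
    unfolding G_def
    by (rule continuous_on_compose2[OF g(1)]) (use R in \<open>auto intro!: continuous_intros\<close>)
  \<comment> \<open>At the origin \<open>G\<close> takes the value \<open>g 0 = 0\<close>, so both
    functions are extensions by zero of continuous functions.\<close>
  have [measurable]: "g \<in> borel_measurable borel" "G \<in> borel_measurable borel"
    using borel_measurable_extend_zero[OF open_Compl[OF closed_singleton] g(1)]
      borel_measurable_extend_zero[OF open_Compl[OF closed_singleton] cG] g(2)
    by (simp_all add: G_def)
  have mA: "?A h \<in> sets lborel" for h
  proof -
    have "?A h = {x. ?a < (norm x)\<^sup>2} \<inter> {x. (norm x)\<^sup>2 \<le> ?a + h}" by auto
    moreover have "open {x :: 'a. ?a < (norm x)\<^sup>2}" "closed {x :: 'a. (norm x)\<^sup>2 \<le> ?a + h}"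
      by (intro open_Collect_less closed_Collect_le continuous_intros)+
    ultimately show ?thesis by (simp add: borel_open borel_closed sets.Int)
  qed
  have finA: "emeasure lborel (?A h) < \<infinity>" for h
  proof -
    have "?A h \<subseteq> cball 0 (sqrt (?a + h))" by (auto simp: norm_le_sqrt_iff)
    then show ?thesis using bounded_subset bounded_cball emeasure_bounded_finite by blast
  qed
  have intA: "integrable lborel (\<lambda>x. indicator (?A h) x *\<^sub>R f x)"
    if f: "continuous_on (- {0}) f" for f :: "'a \<Rightarrow> complex" and h
  proof -
    let ?K = "{x :: 'a. ?a \<le> (norm x)\<^sup>2 \<and> (norm x)\<^sup>2 \<le> ?a + h}"
    have "compact ?K" by (rule compact_norm_shell)
    moreover have "?K \<subseteq> - {0}" using R by auto
    then have "continuous_on ?K f"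
      by (rule continuous_on_subset[OF f])
    ultimately have "integrable lborel (\<lambda>x. indicator ?K x *\<^sub>R f x)"
      by (rule borel_integrable_compact)
    then have "integrable lborel (\<lambda>x. indicator (?A h) x *\<^sub>R (indicator ?K x *\<^sub>R f x))"
      by (rule integrable_mult_indicator[OF mA])
    also have "(\<lambda>x. indicator (?A h) x *\<^sub>R (indicator ?K x *\<^sub>R f x)) = (\<lambda>x. indicator (?A h) x *\<^sub>R f x)"
      by (auto simp: indicator_def)
    finally show ?thesis .
  qed
  have ball: "(LINT x:cball 0 r|lborel. f x) = of_real ((r\<^sup>2 / ?a) ^ n) * (LINT x:cball 0 R|lborel. f x)"
    if [measurable]: "f \<in> borel_measurable borel" and hom: "\<And>c x. c > 0 \<Longrightarrow> f (c *\<^sub>R x) = f x" and r: "r > 0"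
    for f :: "'a \<Rightarrow> complex" and r
  proof -
    have "(LINT x:cball 0 r|lborel. f x) = of_real ((r / R) ^ DIM('a)) *
       (LINT x|lborel. indicator (cball 0 r) ((r / R) *\<^sub>R x) *\<^sub>R f ((r / R) *\<^sub>R x))"
      unfolding set_lebesgue_integral_def
      by (rule integral_lborel_scale)
        (use r R in \<open>auto intro!: borel_measurable_scaleR borel_measurable_indicator\<close>)
    also have "(\<lambda>x. indicator (cball 0 r) ((r / R) *\<^sub>R x) *\<^sub>R f ((r / R) *\<^sub>R x)) = (\<lambda>x. indicator (cball 0 R) x *\<^sub>R f x)"
    proof
      fix x :: 'a
      have "norm ((r / R) *\<^sub>R x) \<le> r \<longleftrightarrow> norm x \<le> R" using r R by (simp add: field_simps)
      moreover have "f ((r / R) *\<^sub>R x) = f x" by (rule hom) (use r R in simp)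
      ultimately show "indicator (cball 0 r) ((r / R) *\<^sub>R x) *\<^sub>R f ((r / R) *\<^sub>R x) = indicator (cball 0 R) x *\<^sub>R f x"
        by (simp add: indicator_def)
    qed
    finally show ?thesis
      by (simp add: set_lebesgue_integral_def N power_mult power_divide)
  qed
  have annulus: "(LINT x|lborel. indicator (?A h) x *\<^sub>R f x) =
      of_real (((?a + h) / ?a) ^ n - 1) * (LINT x:cball 0 R|lborel. f x)"
    if f: "continuous_on (- {0}) f" "f \<in> borel_measurable borel" "\<And>c x. c > 0 \<Longrightarrow> f (c *\<^sub>R x) = f x"
      "set_integrable lborel (cball 0 R) f" and h: "h > 0"
    for f :: "'a \<Rightarrow> complex" and h
  proof -
    have dec: "indicator (cball 0 (sqrt (?a + h))) x *\<^sub>R f x = indicator (?A h) x *\<^sub>R f x + indicator (cball 0 R) x *\<^sub>R f x" for x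
    proof -
      have "norm x \<le> R \<longleftrightarrow> (norm x)\<^sup>2 \<le> ?a"
        using R norm_le_sqrt_iff[of x ?a] by simp
      then show ?thesis using h by (auto simp: indicator_def norm_le_sqrt_iff)
    qed
    have "(LINT x:cball 0 (sqrt (?a + h))|lborel. f x) =
      (LINT x|lborel. indicator (?A h) x *\<^sub>R f x) + (LINT x:cball 0 R|lborel. f x)"
      unfolding set_lebesgue_integral_def dec
      by (rule Bochner_Integration.integral_add) (use intA[OF f(1)] f(4) in \<open>auto simp: set_integrable_def\<close>)
    moreover have "(LINT x:cball 0 (sqrt (?a + h))|lborel. f x) =
      of_real (((?a + h) / ?a) ^ n) * (LINT x:cball 0 R|lborel. f x)"
    proof -
      have "?a + h > 0" using h by (simp add: add_nonneg_pos)
      then show ?thesis using ball[OF f(2,3), of "sqrt (?a + h)"] by simp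
    qed
    ultimately show ?thesis by (simp add: algebra_simps)
  qed
  have bdd: "set_integrable lborel (cball 0 R) G"
  proof -
    have "compact (sphere (0::'a) R)" by simp
    moreover have "continuous_on (sphere 0 R) g" by (rule continuous_on_subset[OF g(1)]) (use R in auto)
    ultimately have "bounded (g ` sphere 0 R)" using compact_continuous_image compact_imp_bounded by blast
    then obtain B where B: "\<And>x. x \<in> sphere 0 R \<Longrightarrow> norm (g x) \<le> B"
      unfolding bounded_iff by blast
    have GB: "norm (G x) \<le> max B 0" for x
      using B[of "(R / norm x) *\<^sub>R x"] R g(2) by (cases "x = 0") (auto simp: G_def le_max_iff_disj)
    show ?thesis unfolding set_integrable_def
    proof (rule integrableI_bounded_set[of "cball 0 R" _ _ "max B 0"])
      show "emeasure lborel (cball (0::'a) R) < \<infinity>" by (rule emeasure_compact_finite) simp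
      show "AE x in lborel. x \<in> cball 0 R \<longrightarrow> norm (indicator (cball 0 R) x *\<^sub>R G x) \<le> max B 0"
        using GB by (auto simp: indicator_def)
    qed (auto simp: indicator_def)
  qed
  define V where "V = measure lborel (cball (0::'a) R)"
  have AG: "(LINT x|lborel. indicator (?A h) x *\<^sub>R G x) = of_real (((?a + h) / ?a) ^ n - 1) * J" if "h > 0" for h
    unfolding J_def G_def[symmetric]
  proof (rule annulus[OF cG _ _ bdd that])
    show "G (c *\<^sub>R x) = G x" if "c > 0" for c x
      using that by (simp add: G_def)
  qed simp
  have volA: "measure lborel (?A h) = (((?a + h) / ?a) ^ n - 1) * V" if h: "h > 0" for h
  proof -
    have "(LINT x|lborel. indicator (?A h) x *\<^sub>R (1::complex)) = of_real (((?a + h) / ?a) ^ n - 1) * (LINT x:cball (0::'a) R|lborel. 1)"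
    proof (rule annulus[of "\<lambda>_. 1", OF _ _ _ _ h])
      have "integrable lborel (\<lambda>x::'a. indicator (cball 0 R) x *\<^sub>R (1::complex))"
        by (rule borel_integrable_compact) auto
      then show "set_integrable lborel (cball (0::'a) R) (\<lambda>_. 1 :: complex)"
        by (simp add: set_integrable_def)
    qed auto
    moreover have "(LINT x|lborel. indicator B x *\<^sub>R (1::complex)) = of_real (measure lborel B)"
      if "B \<in> sets lborel" "emeasure lborel B < \<infinity>" for B :: "'a set"
      by (subst integral_scaleR_left) (use that in \<open>auto simp: scaleR_conv_of_real\<close>)
    note this[OF mA finA] this[of "cball 0 R", OF _ emeasure_compact_finite]
    ultimately have "complex_of_real (measure lborel (?A h)) = of_real ((((?a + h) / ?a) ^ n - 1) * V)"
      by (simp add: set_lebesgue_integral_def V_def)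
    then show ?thesis using of_real_eq_iff by blast
  qed
  have lim0: "((\<lambda>h. (((?a + h) / ?a) ^ n - 1) / h) \<longlongrightarrow> real n / ?a) (at_right 0)"
  proof -
    have "((\<lambda>h. ((?a + h) / ?a) ^ n) has_real_derivative real n / ?a) (at 0)"
    proof -
      have "((\<lambda>h. (?a + h) / ?a) has_real_derivative 1 / ?a) (at 0)"
        by (intro DERIV_cdivide) (auto intro!: derivative_eq_intros)
      from DERIV_power[OF this, of n] show ?thesis using R by simp
    qed
    then have "((\<lambda>h. (((?a + h) / ?a) ^ n - 1) / h) \<longlongrightarrow> real n / ?a) (at 0)"
      using R by (simp add: has_field_derivative_iff)
    then show ?thesis by (rule filterlim_mono[OF _ order_refl at_le]) simp
  qed
  have lim1: "((\<lambda>h. (1 / of_real h) * (LINT x|lborel. indicator (?A h) x *\<^sub>R G x)) \<longlongrightarrow> of_real (real n / ?a) * J) (at_right 0)"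
  proof (rule Lim_transform_eventually)
    show "((\<lambda>h. of_real ((((?a + h) / ?a) ^ n - 1) / h) * J) \<longlongrightarrow> of_real (real n / ?a) * J) (at_right 0)"
      by (intro tendsto_mult_right tendsto_of_real lim0)
    show "\<forall>\<^sub>F h in at_right 0. of_real ((((?a + h) / ?a) ^ n - 1) / h) * J =
      (1 / of_real h) * (LINT x|lborel. indicator (?A h) x *\<^sub>R G x)"
      using eventually_at_right_less[of "0::real"]
    proof eventually_elim
      case (elim h)
      show ?case unfolding AG[OF elim] by simp
    qed
  qed
  have small: "\<forall>\<^sub>F h in at_right 0. \<forall>x\<in>?A h. norm (g x - G x) \<le> e" if e: "e > 0" for e
  proof -
    let ?K = "{x :: 'a. ?a \<le> (norm x)\<^sup>2 \<and> (norm x)\<^sup>2 \<le> ?a + 1}"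
    have "compact ?K" by (rule compact_norm_shell)
    moreover have "continuous_on ?K g"
      by (rule continuous_on_subset[OF g(1)]) (use R in auto)
    ultimately have "uniformly_continuous_on ?K g" by (rule compact_uniformly_continuous[rotated])
    then obtain d where d: "d > 0" "\<And>x y. x \<in> ?K \<Longrightarrow> y \<in> ?K \<Longrightarrow> dist y x < d \<Longrightarrow> dist (g y) (g x) < e"
      using e unfolding uniformly_continuous_on_def by meson
    have "\<forall>\<^sub>F h in at_right 0. h < min 1 (d * R)"
      using d R by (intro eventually_at_rightI[of 0 "min 1 (d * R)"]) auto
    then show ?thesis
    proof eventually_elim
      fix h assume h: "h < min 1 (d * R)"
      show "\<forall>x\<in>?A h. norm (g x - G x) \<le> e"
      proof
        fix x :: 'a assume x: "x \<in> ?A h"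
        then have nx: "norm x > 0" using R by (auto simp: zero_less_power2)
        have "norm (x - (R / norm x) *\<^sub>R x) = norm ((1 - R / norm x) *\<^sub>R x)" by (simp add: algebra_simps)
        also have "\<dots> = \<bar>(1 - R / norm x) * norm x\<bar>" by (simp add: abs_mult)
        also have "\<dots> = \<bar>norm x - R\<bar>" using nx by (simp add: left_diff_distrib)
        also have "\<dots> \<le> h / R"
        proof (rule radial_distance_le[OF R norm_ge_zero])
          show "?a \<le> (norm x)\<^sup>2" "(norm x)\<^sup>2 \<le> ?a + h" using x by (simp_all only: mem_Collect_eq greaterThanAtMost_iff less_imp_le)
        qed
        also have "\<dots> < d" using h R by (simp add: field_simps)
        finally have "dist x ((R / norm x) *\<^sub>R x) < d" by (simp add: dist_norm)
        moreover have "(R / norm x) *\<^sub>R x \<in> ?K" using nx R by simp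
        moreover have "x \<in> ?K" using x h by simp
        ultimately have "dist (g x) (g ((R / norm x) *\<^sub>R x)) < e"
          using d(2) by blast
        then show "norm (g x - G x) \<le> e" by (simp add: G_def dist_norm)
      qed
    qed
  qed
  have lim2: "((\<lambda>h. (1 / of_real h) * (LINT x|lborel. indicator (?A h) x *\<^sub>R (g x - G x))) \<longlongrightarrow> 0) (at_right 0)"
  proof (rule tendstoI)
    fix e :: real assume e: "e > 0"
    \<comment> \<open>For small h the shell has volume at most h \<open>L\<close>, so an integrand
      bounded by e / (2 L) contributes at most e / 2; the + 1 at \<open>V\<close> makes
      \<open>L\<close> positive.\<close>
    define L where "L = (real n / ?a + 1) * (V + 1)"
    have V: "V \<ge> 0" by (simp add: V_def)
    have L: "L > 0" unfolding L_def using R V by (intro mult_pos_pos) (auto intro: add_nonneg_pos)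
    have ev: "\<forall>\<^sub>F h in at_right 0. (((?a + h) / ?a) ^ n - 1) / h < real n / ?a + 1"
      using order_tendstoD(2)[OF lim0] by simp
    have eL: "e / (2 * L) > 0" using e L by simp
    show "\<forall>\<^sub>F h in at_right 0. dist ((1 / of_real h) * (LINT x|lborel. indicator (?A h) x *\<^sub>R (g x - G x))) 0 < e"
      using ev small[OF eL] eventually_at_right_less[of "0::real"]
    proof (eventually_elim)
      case (elim h)
      have "norm (LINT x|lborel. indicator (?A h) x *\<^sub>R (g x - G x)) \<le> (LINT x|lborel. indicator (?A h) x * (e / (2 * L)))"
      proof (rule Bochner_Integration.integral_norm_bound_integral)
        show "integrable lborel (\<lambda>x. indicator (?A h) x *\<^sub>R (g x - G x))"
          using intA[of "\<lambda>x. g x - G x"] g(1) cG by (auto intro!: continuous_intros)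
        show "integrable lborel (\<lambda>x. indicator (?A h) x * (e / (2 * L)))"
          using finA[of h] by (auto intro!: integrable_mult_left)
      qed (use elim e L in \<open>auto simp: indicator_def\<close>)
      also have "\<dots> = measure lborel (?A h) * (e / (2 * L))" by simp
      finally have "norm (LINT x|lborel. indicator (?A h) x *\<^sub>R (g x - G x)) / h \<le> measure lborel (?A h) * (e / (2 * L)) / h"
        using elim by (intro divide_right_mono) auto
      also have "\<dots> = ((((?a + h) / ?a) ^ n - 1) / h) * V * (e / (2 * L))"
        unfolding volA[OF elim(3)] by (simp add: field_simps)
      also have "\<dots> \<le> L * (e / (2 * L))"
      proof (rule mult_right_mono)
        show "((((?a + h) / ?a) ^ n - 1) / h) * V \<le> L"
          unfolding L_def by (rule mult_mono) (use elim V in \<open>auto intro!: add_nonneg_nonneg\<close>)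
      qed (use e L in auto)
      also have "\<dots> < e" using e L by simp
      finally show ?case using elim by (simp add: norm_mult norm_divide)
    qed
  qed
  have "(1 / of_real h) * (LINT x|lborel. indicator {?a<..?a + h} ((norm x)\<^sup>2) * g x) =
     (1 / of_real h) * (LINT x|lborel. indicator (?A h) x *\<^sub>R G x) +
     (1 / of_real h) * (LINT x|lborel. indicator (?A h) x *\<^sub>R (g x - G x))" for h
  proof -
    have D: "(LINT x|lborel. indicator (?A h) x *\<^sub>R (g x - G x)) =
      (LINT x|lborel. indicator (?A h) x *\<^sub>R g x) - (LINT x|lborel. indicator (?A h) x *\<^sub>R G x)"
      unfolding scaleR_diff_right by (rule Bochner_Integration.integral_diff[OF intA[OF g(1)] intA[OF cG]])
    have "indicator {?a<..?a + h} ((norm x)\<^sup>2) * g x = indicator (?A h) x *\<^sub>R g x" for x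
      by (auto simp: indicator_def)
    then show ?thesis unfolding D right_diff_distrib by simp
  qed
  then show ?thesis using tendsto_add[OF lim1 lim2] by simp
qed

section \<open>Integrals of periodic functions over period boxes\<close>

lemma integrable_indicator_bounded:
  fixes f :: "'a::euclidean_space \<Rightarrow> complex"
  assumes "continuous_on K f" "compact K" "A \<subseteq> K" "A \<in> sets borel"
  shows "integrable lborel (\<lambda>x. indicator A x *\<^sub>R f x)"
proof -
  have "integrable lborel (\<lambda>x. indicator A x *\<^sub>R (indicator K x *\<^sub>R f x))"
    by (rule integrable_mult_indicator[OF _ borel_integrable_compact]) (use assms in simp_all)
  also have "(\<lambda>x. indicator A x *\<^sub>R (indicator K x *\<^sub>R f x)) = (\<lambda>x. indicator A x *\<^sub>R f x)"
    using assms(3) by (intro ext) (auto simp: indicator_def)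
  finally show ?thesis .
qed

text \<open>Half-open, so that boxes can be cut and reassembled exactly, without overlaps to be
  discarded as null sets.\<close>

definition period_box :: "('n::finite \<Rightarrow> real) \<Rightarrow> (real^'n) set" where
  "period_box s = {t. \<forall>i. s i \<le> t $ i \<and> t $ i < s i + 2 * pi}"

lemma borel_component_le_less: "{t :: real^'n::finite. l \<le> t $ i \<and> t $ i < u} \<in> sets borel"
proof -
  have "{t :: real^'n. l \<le> t $ i \<and> t $ i < u} = {t. l \<le> t $ i} \<inter> {t. t $ i < u}" by auto
  moreover have "closed {t :: real^'n. l \<le> t $ i}" "open {t :: real^'n. t $ i < u}"
    by (intro closed_Collect_le open_Collect_less continuous_intros)+
  ultimately show ?thesis by (simp add: borel_open borel_closed sets.Int)
qed

lemma borel_half_open_box: "{t :: real^'n::finite. \<forall>i. l i \<le> t $ i \<and> t $ i < u i} \<in> sets borel"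
proof -
  have "{t :: real^'n. \<forall>i. l i \<le> t $ i \<and> t $ i < u i} = (\<Inter>i. {t. l i \<le> t $ i \<and> t $ i < u i})" by auto
  then show ?thesis using borel_component_le_less by (auto intro!: sets.finite_INT)
qed

lemma integrable_half_open_box:
  fixes \<Phi> :: "real^'n::finite \<Rightarrow> complex"
  assumes "continuous_on UNIV \<Phi>" "A \<in> sets borel" "A \<subseteq> {t. \<forall>i. l i \<le> t $ i \<and> t $ i < u i}"
  shows "integrable lborel (\<lambda>t. indicator A t *\<^sub>R \<Phi> t)"
proof (rule integrable_indicator_bounded[of "cbox (\<chi> i. l i) (\<chi> i. u i)"])
  show "A \<subseteq> cbox (\<chi> i. l i) (\<chi> i. u i)"
    using assms(3) by (auto simp: mem_box_cart less_imp_le)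
  show "continuous_on (cbox (\<chi> i. l i) (\<chi> i. u i)) \<Phi>"
    by (rule continuous_on_subset[OF assms(1)]) simp
qed (use assms in simp_all)

text \<open>Cut the j-th side [s, s + 2 pi) at 2 pi and move the upper piece back by one period onto
  [0, s).\<close>

lemma integral_period_box_shift1:
  fixes \<Phi> :: "real^'n::finite \<Rightarrow> complex"
  assumes cont: "continuous_on UNIV \<Phi>"
    and per: "\<And>t. \<Phi> (t + axis j (2 * pi)) = \<Phi> t"
    and s: "0 \<le> s j" "s j \<le> 2 * pi"
  shows "(LINT t|lborel. indicator (period_box s) t *\<^sub>R \<Phi> t) =
         (LINT t|lborel. indicator (period_box (s(j := 0))) t *\<^sub>R \<Phi> t)"
proof -
  let ?o = "\<lambda>t :: real^'n. \<forall>i. i \<noteq> j \<longrightarrow> s i \<le> t $ i \<and> t $ i < s i + 2 * pi"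
  let ?S = "\<lambda>l u. {t. ?o t \<and> l \<le> t $ j \<and> t $ j < u}"
  have eqS: "?S l u = {t. \<forall>i. (if i = j then l else s i) \<le> t $ i \<and> t $ i < (if i = j then u else s i + 2 * pi)}" for l u
  proof (intro Collect_cong iffI)
    fix t :: "real^'n" assume t: "?o t \<and> l \<le> t $ j \<and> t $ j < u"
    show "\<forall>i. (if i = j then l else s i) \<le> t $ i \<and> t $ i < (if i = j then u else s i + 2 * pi)"
    proof
      fix i show "(if i = j then l else s i) \<le> t $ i \<and> t $ i < (if i = j then u else s i + 2 * pi)"
        using t by (cases "i = j") simp_all
    qed
  next
    fix t :: "real^'n"
    assume t: "\<forall>i. (if i = j then l else s i) \<le> t $ i \<and> t $ i < (if i = j then u else s i + 2 * pi)"
    from t[rule_format, of j] have "l \<le> t $ j \<and> t $ j < u" by simp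
    moreover have "s i \<le> t $ i \<and> t $ i < s i + 2 * pi" if "i \<noteq> j" for i
      using t[rule_format, of i] that by simp
    ultimately show "?o t \<and> l \<le> t $ j \<and> t $ j < u" by blast
  qed
  have int: "integrable lborel (\<lambda>t. indicator (?S l u) t *\<^sub>R \<Phi> t)" for l u
    unfolding eqS by (rule integrable_half_open_box[OF cont borel_half_open_box order_refl])
  have split: "(LINT t|lborel. indicator (?S l u) t *\<^sub>R \<Phi> t) =
      (LINT t|lborel. indicator (?S l m) t *\<^sub>R \<Phi> t) + (LINT t|lborel. indicator (?S m u) t *\<^sub>R \<Phi> t)"
    if "l \<le> m" "m \<le> u" for l m u
  proof -
    have "indicator (?S l u) t *\<^sub>R \<Phi> t = indicator (?S l m) t *\<^sub>R \<Phi> t + indicator (?S m u) t *\<^sub>R \<Phi> t" for t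
      using that by (auto simp: indicator_def)
    then show ?thesis using int by simp
  qed
  have shift: "(LINT t|lborel. indicator (?S (2 * pi) (s j + 2 * pi)) t *\<^sub>R \<Phi> t) =
      (LINT t|lborel. indicator (?S 0 (s j)) t *\<^sub>R \<Phi> t)"
  proof -
    have "(LINT t|lborel. indicator (?S (2 * pi) (s j + 2 * pi)) t *\<^sub>R \<Phi> t) =
      (LINT t|lborel. indicator (?S (2 * pi) (s j + 2 * pi)) (t + axis j (2 * pi)) *\<^sub>R \<Phi> (t + axis j (2 * pi)))"
      by (rule integral_lborel_translation[symmetric]) (use int in \<open>auto simp: borel_measurable_integrable\<close>)
    also have "(\<lambda>t. indicator (?S (2 * pi) (s j + 2 * pi)) (t + axis j (2 * pi)) *\<^sub>R \<Phi> (t + axis j (2 * pi))) =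
      (\<lambda>t. indicator (?S 0 (s j)) t *\<^sub>R \<Phi> t)"
      unfolding per by (intro ext) (auto simp: indicator_def axis_def)
    finally show ?thesis .
  qed
  have e1: "period_box s = ?S (s j) (s j + 2 * pi)" and e2: "period_box (s(j := 0)) = ?S 0 (2 * pi)"
    by (auto simp: period_box_def split: if_splits)
  show ?thesis
    unfolding e1 e2 using split[of "s j" "2 * pi" "s j + 2 * pi"] split[of 0 "s j" "2 * pi"] shift s
    by simp
qed

lemma integral_period_box_shift:
  fixes \<Phi> :: "real^'n::finite \<Rightarrow> complex"
  assumes cont: "continuous_on UNIV \<Phi>"
    and per: "\<And>t j. \<Phi> (t + axis j (2 * pi)) = \<Phi> t"
    and s: "\<And>i. 0 \<le> s i" "\<And>i. s i \<le> 2 * pi"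
  shows "(LINT t|lborel. indicator (period_box s) t *\<^sub>R \<Phi> t) =
         (LINT t|lborel. indicator (period_box (\<lambda>_. 0)) t *\<^sub>R \<Phi> t)"
proof -
  have "(LINT t|lborel. indicator (period_box s) t *\<^sub>R \<Phi> t) =
         (LINT t|lborel. indicator (period_box (\<lambda>i. if i \<in> F then 0 else s i)) t *\<^sub>R \<Phi> t)"
    if "finite F" for F
    using that
  proof (induction F rule: finite_induct)
    case (insert j F)
    have "(\<lambda>i. if i \<in> insert j F then 0 else s i) = (\<lambda>i. if i \<in> F then 0 else s i)(j := 0)" by auto
    then show ?case using insert integral_period_box_shift1[OF cont per, of "\<lambda>i. if i \<in> F then 0 else s i" j] s
      by simp
  qed simp
  from this[of UNIV] show ?thesis by simp
qed

text \<open>The closed box agrees with the half-open one almost everywhere; translation turns the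
  latter into the period box at \<open>s\<close>, which is moved back one coordinate at a time. The
  range allowed for \<open>s\<close> contains all values of \<open>Arg2pi\<close>.\<close>

lemma integral_torus_shift:
  fixes \<Phi> :: "real^'n::finite \<Rightarrow> complex"
  assumes cont: "continuous_on UNIV \<Phi>"
    and per: "\<And>t j. \<Phi> (t + axis j (2 * pi)) = \<Phi> t"
    and s: "\<And>i. 0 \<le> s $ i" "\<And>i. s $ i \<le> 2 * pi"
  shows "(LINT t:cbox 0 (\<chi> i. 2 * pi)|lborel. \<Phi> (t + s)) = (LINT t:cbox 0 (\<chi> i. 2 * pi)|lborel. \<Phi> t)"
proof -
  let ?E = "period_box (\<lambda>_. 0) :: (real^'n) set"
  have AE: "AE t in lborel. t \<in> cbox 0 (\<chi> i. 2 * pi) \<longleftrightarrow> t \<in> ?E"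
  proof -
    have "AE t :: real^'n in lborel. \<forall>i\<in>UNIV. t $ i \<noteq> 2 * pi"
    proof (rule AE_finite_allI)
      fix i :: 'n
      show "AE t in lborel. t $ i \<noteq> 2 * pi"
        using AE_lborel_inner_neq[of "axis i 1 :: real^'n" "2 * pi"] by (simp add: inner_axis axis_in_Basis_iff)
    qed simp
    then show ?thesis
      by eventually_elim (auto simp: mem_box_cart period_box_def less_le)
  qed
  have box: "(LINT t:cbox 0 (\<chi> i. 2 * pi)|lborel. f t) = (LINT t|lborel. indicator ?E t *\<^sub>R f t)"
    if "continuous_on UNIV f" for f :: "real^'n \<Rightarrow> complex"
    unfolding set_lebesgue_integral_def
  proof (rule integral_cong_AE)
    have [measurable]: "f \<in> borel_measurable borel" using that by (rule borel_measurable_continuous_onI)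
    have [measurable]: "?E \<in> sets borel" unfolding period_box_def by (rule borel_half_open_box)
    show "(\<lambda>t. indicator (cbox 0 (\<chi> i. 2 * pi)) t *\<^sub>R f t) \<in> borel_measurable lborel"
      "(\<lambda>t. indicator ?E t *\<^sub>R f t) \<in> borel_measurable lborel"
      by (auto intro!: borel_measurable_scaleR borel_measurable_indicator)
    show "AE t in lborel. indicator (cbox 0 (\<chi> i. 2 * pi)) t *\<^sub>R f t = indicator ?E t *\<^sub>R f t"
      using AE by eventually_elim (simp add: indicator_def)
  qed
  have cs: "continuous_on UNIV (\<lambda>t. \<Phi> (t + s))"
    by (rule continuous_on_compose2[OF cont]) (auto intro!: continuous_intros)
  have mE: "period_box r \<in> sets borel" for r :: "'n \<Rightarrow> real"
    unfolding period_box_def by (rule borel_half_open_box)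
  have "(LINT t:cbox 0 (\<chi> i. 2 * pi)|lborel. \<Phi> (t + s)) = (LINT t|lborel. indicator ?E t *\<^sub>R \<Phi> (t + s))"
    by (rule box[OF cs])
  also have "\<dots> = (LINT t|lborel. indicator (period_box (($) s)) (t + s) *\<^sub>R \<Phi> (t + s))"
    by (intro Bochner_Integration.integral_cong refl) (auto simp: indicator_def period_box_def)
  also have "\<dots> = (LINT t|lborel. indicator (period_box (($) s)) t *\<^sub>R \<Phi> t)"
    by (rule integral_lborel_translation[of "\<lambda>t. indicator (period_box (($) s)) t *\<^sub>R \<Phi> t"])
      (use mE in \<open>auto intro!: borel_measurable_scaleR borel_measurable_indicator borel_measurable_continuous_onI[OF cont]\<close>)
  also have "\<dots> = (LINT t|lborel. indicator ?E t *\<^sub>R \<Phi> t)"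
    by (rule integral_period_box_shift[OF cont per s])
  also have "\<dots> = (LINT t:cbox 0 (\<chi> i. 2 * pi)|lborel. \<Phi> t)" by (rule box[OF cont, symmetric])
  finally show ?thesis .
qed

text \<open>Polar coordinates are replaced by averaging: the rotations z_i \<mapsto> exp(i t_i) z_i
  preserve Lebesgue measure and the product of annuli, so \<open>G\<close> may be replaced by its
  integral over all t, divided by (2 pi)^n. That integral depends only on the moduli |z_i| and is
  close to \<open>C\<close> when they are close to \<epsilon>. The volume (pi h)^n then yields
  (1/2)^n.\<close>

lemma annulus_limit_torus:
  fixes G :: "complex^'n::finite \<Rightarrow> complex"
  assumes G: "continuous_on {z. \<forall>i. z $ i \<noteq> 0} G" and \<epsilon>: "\<epsilon> > 0"
  defines "C \<equiv> LINT t:cbox 0 (\<chi> i. 2 * pi)|lborel. G (torus_map \<epsilon> t)"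
  shows "((\<lambda>h. (1 / of_real h ^ CARD('n)) *
            (LINT z|lborel. (\<Prod>i\<in>UNIV. indicator {\<epsilon>\<^sup>2<..\<epsilon>\<^sup>2 + h} ((norm (z $ i))\<^sup>2)) * G z))
          \<longlongrightarrow> (1 / 2) ^ CARD('n) * C) (at_right 0)"
proof -
  let ?n = "CARD('n)" and ?a = "\<epsilon>\<^sup>2"
  let ?B = "cbox 0 (\<chi> i. 2 * pi) :: (real^'n) set"
  define A where "A h = {z :: complex^'n. \<forall>i. z $ i \<in> {w. (norm w)\<^sup>2 \<in> {?a<..?a + h}}}" for h
  define K where "K h = {z :: complex^'n. \<forall>i. ?a \<le> (norm (z $ i))\<^sup>2 \<and> (norm (z $ i))\<^sup>2 \<le> ?a + h}" for h
  define rot where "rot t z = (\<chi> i. cis (t $ i) * z $ i)" for t :: "real^'n" and z :: "complex^'n"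
  let ?U = "{z :: complex^'n. \<forall>i. z $ i \<noteq> 0}"
  have AK: "A h \<subseteq> K h" for h by (simp add: A_def K_def subset_iff less_imp_le)
  have KU: "K h \<subseteq> ?U" for h
  proof
    fix z assume "z \<in> K h"
    have "0 < (norm (z $ i))\<^sup>2" for i
    proof -
      have "?a \<le> (norm (z $ i))\<^sup>2" using \<open>z \<in> K h\<close> by (simp only: K_def mem_Collect_eq)
      moreover have "0 < ?a" using \<epsilon> by simp
      ultimately show ?thesis by (rule order_less_le_trans[rotated])
    qed
    then show "z \<in> ?U" by simp
  qed
  have compK: "compact (K h)" for h
  proof -
    have "K h \<subseteq> cball 0 (\<Sum>i\<in>(UNIV::'n set). sqrt (?a + h))"
    proof
      fix z assume z: "z \<in> K h"
      have "norm z \<le> (\<Sum>i\<in>UNIV. norm (z $ i))" by (simp add: norm_vec_def L2_set_le_sum)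
      also have "\<dots> \<le> (\<Sum>i\<in>(UNIV::'n set). sqrt (?a + h))"
        by (intro sum_mono) (use z in \<open>simp only: K_def norm_le_sqrt_iff mem_Collect_eq\<close>)
      finally show "z \<in> cball 0 (\<Sum>i\<in>(UNIV::'n set). sqrt (?a + h))" by simp
    qed
    then have "bounded (K h)" using bounded_cball bounded_subset by blast
    moreover have "closed (K h)"
    proof -
      have eq: "K h = (\<Inter>i. {z. ?a \<le> (norm (z $ i))\<^sup>2} \<inter> {z. (norm (z $ i))\<^sup>2 \<le> ?a + h})"
        by (auto simp: K_def)
      moreover have "closed ({z :: complex^'n. ?a \<le> (norm (z $ i))\<^sup>2} \<inter> {z. (norm (z $ i))\<^sup>2 \<le> ?a + h})" for i
        by (intro closed_Int closed_Collect_le continuous_intros)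
      ultimately show ?thesis by (simp only: eq) (intro closed_INT ballI)
    qed
    ultimately show ?thesis by (simp add: compact_eq_bounded_closed)
  qed
  have annulus_borel: "{w :: complex. (norm w)\<^sup>2 \<in> {?a<..?a + h}} \<in> sets borel" for h
  proof -
    have "{w :: complex. (norm w)\<^sup>2 \<in> {?a<..?a + h}} = {w. ?a < (norm w)\<^sup>2} \<inter> {w. (norm w)\<^sup>2 \<le> ?a + h}" by auto
    moreover have "open {w :: complex. ?a < (norm w)\<^sup>2}" "closed {w :: complex. (norm w)\<^sup>2 \<le> ?a + h}"
      by (intro open_Collect_less closed_Collect_le continuous_intros)+
    ultimately show ?thesis by (simp add: borel_open borel_closed sets.Int)
  qed
  have mA: "A h \<in> sets borel" for h
  proof -
    have "A h = (\<Inter>i. (\<lambda>z. z $ i) -` {w. (norm w)\<^sup>2 \<in> {?a<..?a + h}} \<inter> space borel)"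
      by (auto simp: A_def)
    also have "\<dots> \<in> sets borel"
      using annulus_borel by (intro sets.finite_INT measurable_sets[OF borel_measurable_continuous_onI])
        (auto intro!: continuous_intros)
    finally show ?thesis .
  qed
  have volA: "measure lborel (A h) = (pi * h) ^ ?n" "emeasure lborel (A h) < \<infinity>" if "h > 0" for h
  proof -
    have "emeasure lborel (A h) = (\<Prod>i\<in>(UNIV :: 'n set). emeasure lborel {w :: complex. (norm w)\<^sup>2 \<in> {?a<..?a + h}})"
      unfolding A_def by (rule measure_vec_product[OF annulus_borel])
    also have "\<dots> = ennreal ((pi * h) ^ ?n)"
      using emeasure_annulus[of ?a h] \<epsilon> that by (simp add: ennreal_power)
    finally have *: "emeasure lborel (A h) = ennreal ((pi * h) ^ ?n)" .
    show "measure lborel (A h) = (pi * h) ^ ?n" using that by (simp add: measure_def *)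
    show "emeasure lborel (A h) < \<infinity>" by (simp add: *)
  qed
  have cGK: "continuous_on (K h) G" for h by (rule continuous_on_subset[OF G KU])
  have intG: "integrable lborel (\<lambda>z. indicator (A h) z *\<^sub>R G z)" for h
    by (rule integrable_indicator_bounded[OF cGK compK AK mA])
  have norm_rot: "norm (rot t z $ i) = norm (z $ i)" for t z i by (simp add: rot_def norm_mult)
  have rotA: "rot t z \<in> A h \<longleftrightarrow> z \<in> A h" and rotK: "rot t z \<in> K h \<longleftrightarrow> z \<in> K h" for t z h
    by (simp_all add: A_def K_def norm_rot)
  have rot_inv: "(LINT z|lborel. f (rot t z)) = (LINT z|lborel. f z)"
    if f: "f \<in> borel_measurable borel" for f :: "complex^'n \<Rightarrow> complex" and t
  proof -
    have "linear (rot t)"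
      by (rule linearI) (auto simp: rot_def Finite_Cartesian_Product.vec_eq_iff algebra_simps)
    moreover have "norm (rot t z) = norm z" for z
      by (simp add: norm_vec_def norm_rot)
    ultimately have "distr lborel borel (rot t) = lborel" by (rule distr_lborel_isometry)
    moreover have "rot t \<in> borel_measurable borel"
      using \<open>linear (rot t)\<close> by (simp add: borel_measurable_continuous_onI linear_continuous_on linear_linear)
    ultimately show ?thesis
      using integral_distr[of "rot t" lborel borel f] f by simp
  qed
  define M where "M z = (LINT t:?B|lborel. G (rot t z))" for z
  have volB: "(LINT t:?B|lborel. c) = of_real ((2 * pi) ^ ?n) * c" for c :: complex
  proof -
    have "measure lborel ?B = (2 * pi) ^ ?n"
      by (subst content_cbox_cart) (auto simp: interval_eq_empty_cart)
    then show ?thesis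
      unfolding set_lebesgue_integral_def
      by (subst integral_scaleR_left)
        (auto simp: scaleR_conv_of_real intro!: integrable_real_indicator emeasure_compact_finite)
  qed
  have rot_continuous: "continuous_on S (\<lambda>x. rot (f x) (g x))"
    if "continuous_on S f" "continuous_on S g" for S :: "'x::topological_space set" and f g
    unfolding rot_def using that by (intro continuous_on_vec_lambda continuous_intros)
  have average: "of_real ((2 * pi) ^ ?n) * (LINT z|lborel. indicator (A h) z *\<^sub>R G z) =
      (LINT z|lborel. indicator (A h) z *\<^sub>R M z)
      \<and> integrable lborel (\<lambda>z. indicator (A h) z *\<^sub>R M z)" for h
  proof -
    let ?F = "\<lambda>t z. indicator ?B t *\<^sub>R (indicator (A h) z *\<^sub>R G (rot t z))"
    have int: "integrable (lborel \<Otimes>\<^sub>M lborel) (\<lambda>(t, z). ?F t z)"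
    proof -
      have "integrable lborel (\<lambda>p. indicator (?B \<times> A h) p *\<^sub>R G (rot (fst p) (snd p)))"
      proof (rule integrable_indicator_bounded[of "?B \<times> K h"])
        show "continuous_on (?B \<times> K h) (\<lambda>p. G (rot (fst p) (snd p)))"
          by (rule continuous_on_compose2[OF cGK[of h]])
            (auto intro!: rot_continuous continuous_on_fst continuous_on_snd continuous_on_id simp: rotK)
        show "compact (?B \<times> K h)" by (intro compact_Times compK compact_cbox)
        show "?B \<times> A h \<subseteq> ?B \<times> K h" using AK by auto
        have "?B \<times> A h \<in> sets (borel \<Otimes>\<^sub>M borel)" by (rule pair_measureI) (use mA in auto)
        then show "?B \<times> A h \<in> sets borel" by (simp only: borel_prod)
      qed
      also have "(\<lambda>p. indicator (?B \<times> A h) p *\<^sub>R G (rot (fst p) (snd p))) = (\<lambda>(t, z). ?F t z)"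
        by (intro ext) (auto simp: indicator_def)
      finally show ?thesis by (simp add: lborel_prod)
    qed
    have F: "(LINT t|lborel. ?F t z) = indicator (A h) z *\<^sub>R M z" for z
      by (auto simp: M_def set_lebesgue_integral_def indicator_def)
    have "of_real ((2 * pi) ^ ?n) * (LINT z|lborel. indicator (A h) z *\<^sub>R G z) =
        (LINT t:?B|lborel. LINT z|lborel. indicator (A h) z *\<^sub>R G z)"
      by (rule volB[symmetric])
    also have "\<dots> = (LINT t|lborel. LINT z|lborel. ?F t z)"
      unfolding set_lebesgue_integral_def
    proof (rule Bochner_Integration.integral_cong[OF refl])
      fix t
      have "(LINT z|lborel. indicator (A h) z *\<^sub>R G z) = (LINT z|lborel. indicator (A h) (rot t z) *\<^sub>R G (rot t z))"
        by (rule rot_inv[symmetric]) (use borel_measurable_integrable[OF intG] in simp)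
      then show "indicator ?B t *\<^sub>R (LINT z|lborel. indicator (A h) z *\<^sub>R G z) = (LINT z|lborel. ?F t z)"
        by (simp add: rotA indicator_def)
    qed
    also have "\<dots> = (LINT z|lborel. LINT t|lborel. ?F t z)"
      by (rule lborel_pair.Fubini_integral[OF int, symmetric])
    finally have 1: "of_real ((2 * pi) ^ ?n) * (LINT z|lborel. indicator (A h) z *\<^sub>R G z) =
      (LINT z|lborel. indicator (A h) z *\<^sub>R M z)" unfolding F .
    have "integrable lborel (\<lambda>z. LINT t|lborel. ?F t z)"
      by (rule lborel_pair.integrable_snd[OF int])
    then show ?thesis using 1 unfolding F by blast
  qed
  have M_close: "\<forall>\<^sub>F h in at_right 0. \<forall>z\<in>A h. norm (M z - C) \<le> (2 * pi) ^ ?n * e" if e: "e > 0" for e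
  proof -
    have "uniformly_continuous_on (K 1) G"
      using cGK compK by (rule compact_uniformly_continuous)
    then obtain d where d: "d > 0" "\<And>x y. x \<in> K 1 \<Longrightarrow> y \<in> K 1 \<Longrightarrow> dist y x < d \<Longrightarrow> dist (G y) (G x) < e"
      using e unfolding uniformly_continuous_on_def by meson
    \<comment> \<open>Each of the n coordinates moves by at most h / \<epsilon>, which must add up
      to less than d; the bound 1 keeps the points inside \<open>K 1\<close>.\<close>
    let ?m = "min 1 (d * \<epsilon> / ?n)"
    have m: "?m > 0" using d \<epsilon> by simp
    have "\<forall>\<^sub>F h in at_right 0. h < ?m \<and> h > 0"
      using m by (intro eventually_at_rightI[of 0 ?m]) auto
    then show ?thesis
    proof eventually_elim
      case (elim h)
      show ?case
      proof
        fix z assume z: "z \<in> A h"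
        define r where "r = (\<chi> i. complex_of_real (norm (z $ i)))"
        \<comment> \<open>The phases of z are absorbed by a translation of the torus, so
          \<open>M z\<close> is determined by the moduli \<open>r\<close>.\<close>
        define s where "s = (\<chi> i. Arg2pi (z $ i))"
        have zi: "z $ i = cis (s $ i) * r $ i" for i
          using Arg2pi_eq[of "z $ i"] by (simp add: r_def s_def cis_conv_exp mult.commute)
        have rK: "rot t r \<in> K 1" for t
        proof -
          have "?a \<le> (norm (r $ i))\<^sup>2 \<and> (norm (r $ i))\<^sup>2 \<le> ?a + 1" for i
          proof -
            have "?a < (norm (z $ i))\<^sup>2 \<and> (norm (z $ i))\<^sup>2 \<le> ?a + h" using z by (simp add: A_def)
            then show ?thesis using elim by (simp add: r_def)
          qed
          then have "r \<in> K 1" by (simp only: K_def mem_Collect_eq) blast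
          then show ?thesis by (simp only: rotK)
        qed
        have cr: "continuous_on UNIV (\<lambda>t. G (rot t r))"
          by (rule continuous_on_compose2[OF cGK[of 1]]) (auto intro!: rot_continuous continuous_intros rK)
        have "M z = (LINT t:?B|lborel. G (rot (t + s) r))"
        proof -
          have "rot t z = rot (t + s) r" for t
            unfolding rot_def Finite_Cartesian_Product.vec_eq_iff by (simp add: zi cis_mult[symmetric] mult.assoc)
          then show ?thesis by (simp add: M_def)
        qed
        also have "\<dots> = (LINT t:?B|lborel. G (rot t r))"
        proof (rule integral_torus_shift[OF cr])
          show "G (rot (t + axis j (2 * pi)) r) = G (rot t r)" for t j
          proof -
            have "cis ((t + axis j (2 * pi)) $ i) = cis (t $ i)" for i
              by (auto simp: axis_def cis_mult[symmetric])
            then show ?thesis by (simp only: rot_def)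
          qed
          show "0 \<le> s $ i" "s $ i \<le> 2 * pi" for i
            using Arg2pi[of "z $ i"] by (auto simp: s_def)
        qed
        finally have Mr: "M z = (LINT t:?B|lborel. G (rot t r))" .
        have torus_K: "torus_map \<epsilon> t \<in> K 1" for t
          using \<epsilon> by (auto simp: K_def torus_map_def norm_mult)
        have ct: "continuous_on UNIV (\<lambda>t. G (torus_map \<epsilon> t))"
          by (rule continuous_on_compose2[OF cGK[of 1]])
            (auto simp: torus_map_def[abs_def] torus_K[unfolded torus_map_def] intro!: continuous_on_vec_lambda continuous_intros)
        have close: "norm (G (rot t r) - G (torus_map \<epsilon> t)) \<le> e" for t
        proof -
          have "norm (rot t r - torus_map \<epsilon> t) \<le> (\<Sum>i\<in>UNIV. norm ((rot t r - torus_map \<epsilon> t) $ i))"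
            by (simp add: norm_vec_def L2_set_le_sum)
          also have "\<dots> \<le> (\<Sum>i\<in>(UNIV::'n set). h / \<epsilon>)"
          proof (rule sum_mono)
            fix i
            have "(rot t r - torus_map \<epsilon> t) $ i = cis (t $ i) * of_real (norm (z $ i) - \<epsilon>)"
              by (simp add: rot_def torus_map_def r_def algebra_simps)
            then have "norm ((rot t r - torus_map \<epsilon> t) $ i) = \<bar>norm (z $ i) - \<epsilon>\<bar>"
              by (simp only: norm_mult norm_cis norm_of_real mult_1)
            also have "\<dots> \<le> h / \<epsilon>"
            proof (rule radial_distance_le[OF \<epsilon> norm_ge_zero])
              show "?a \<le> (norm (z $ i))\<^sup>2" "(norm (z $ i))\<^sup>2 \<le> ?a + h"
                using z by (simp_all only: A_def mem_Collect_eq greaterThanAtMost_iff less_imp_le)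
            qed
            finally show "norm ((rot t r - torus_map \<epsilon> t) $ i) \<le> h / \<epsilon>" .
          qed
          also have "\<dots> < d" using elim \<epsilon> by (simp add: field_simps)
          finally have "dist (rot t r) (torus_map \<epsilon> t) < d" by (simp add: dist_norm)
          from d(2)[OF torus_K rK this] show ?thesis by (simp add: dist_norm)
        qed
        have intB: "integrable lborel (\<lambda>t. indicator ?B t *\<^sub>R f t)" if "continuous_on UNIV f" for f :: "real^'n \<Rightarrow> complex"
          by (rule borel_integrable_compact) (use that in \<open>auto intro: continuous_on_subset\<close>)
        have "M z - C = (LINT t|lborel. indicator ?B t *\<^sub>R (G (rot t r) - G (torus_map \<epsilon> t)))"
          unfolding Mr C_def set_lebesgue_integral_def scaleR_diff_right
          by (rule Bochner_Integration.integral_diff[symmetric, OF intB[OF cr] intB[OF ct]])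
        also have "norm \<dots> \<le> (LINT t|lborel. indicator ?B t * e)"
        proof (rule Bochner_Integration.integral_norm_bound_integral)
          show "integrable lborel (\<lambda>t. indicator ?B t *\<^sub>R (G (rot t r) - G (torus_map \<epsilon> t)))"
            by (rule intB) (intro continuous_intros cr ct)
          show "integrable lborel (\<lambda>t. indicator ?B t * e)"
            by (auto intro!: integrable_mult_left emeasure_compact_finite)
        qed (use close e in \<open>auto simp: indicator_def\<close>)
        also have "\<dots> = (2 * pi) ^ ?n * e"
        proof -
          have "measure lborel ?B = (2 * pi) ^ ?n"
            by (subst content_cbox_cart) (auto simp: interval_eq_empty_cart)
          then show ?thesis by simp
        qed
        finally show "norm (M z - C) \<le> (2 * pi) ^ ?n * e" .
      qed
    qed
  qed
  have integrand: "(\<Prod>i\<in>UNIV. indicator {?a<..?a + h} ((norm (z $ i))\<^sup>2)) * G z = indicator (A h) z *\<^sub>R G z" for h z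
  proof (cases "z \<in> A h")
    case False
    then obtain i where "(norm (z $ i))\<^sup>2 \<notin> {?a<..?a + h}" by (auto simp: A_def)
    then have "(\<Prod>i\<in>UNIV. indicator {?a<..?a + h} ((norm (z $ i))\<^sup>2)) = (0 :: complex)"
      by (intro prod_zero finite bexI[OF _ UNIV_I]) (simp add: indicator_def)
    then show ?thesis using False by simp
  qed (simp add: A_def)
  show ?thesis unfolding integrand
  proof (rule tendstoI)
    fix e :: real assume e: "e > 0"
    \<comment> \<open>After division by (2 pi h)^n the error becomes pi^n c = e / 2.\<close>
    define c where "c = e / (2 * pi ^ ?n)"
    have c: "c > 0" using e by (simp add: c_def)
    show "\<forall>\<^sub>F h in at_right 0. dist ((1 / of_real h ^ ?n) * (LINT z|lborel. indicator (A h) z *\<^sub>R G z)) ((1 / 2) ^ ?n * C) < e"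
      using M_close[OF c] eventually_at_right_less[of "0::real"]
    proof eventually_elim
      case (elim h)
      define I where "I = (LINT z|lborel. indicator (A h) z *\<^sub>R G z)"
      have intC: "integrable lborel (\<lambda>z. indicator (A h) z *\<^sub>R C)"
        using volA(2)[OF elim(2)] mA by (intro integrable_scaleR_left integrable_real_indicator) auto
      have LC: "(LINT z|lborel. indicator (A h) z *\<^sub>R C) = of_real ((pi * h) ^ ?n) * C"
        using volA[OF elim(2)] mA
        by (subst integral_scaleR_left) (auto simp: scaleR_conv_of_real)
      have "of_real ((2 * pi) ^ ?n) * I - of_real ((pi * h) ^ ?n) * C =
          (LINT z|lborel. indicator (A h) z *\<^sub>R (M z - C))"
        unfolding I_def LC[symmetric] scaleR_diff_right conjunct1[OF average]
        by (rule Bochner_Integration.integral_diff[symmetric, OF conjunct2[OF average] intC])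
      also have "norm \<dots> \<le> (LINT z|lborel. indicator (A h) z * ((2 * pi) ^ ?n * c))"
      proof (rule Bochner_Integration.integral_norm_bound_integral)
        show "integrable lborel (\<lambda>z. indicator (A h) z *\<^sub>R (M z - C))"
          unfolding scaleR_diff_right
          by (rule Bochner_Integration.integrable_diff[OF conjunct2[OF average] intC])
        show "integrable lborel (\<lambda>z. indicator (A h) z * ((2 * pi) ^ ?n * c))"
          using volA(2)[OF elim(2)] mA by (intro integrable_mult_left integrable_real_indicator) auto
      qed (use elim(1) c in \<open>auto simp: indicator_def\<close>)
      also have "\<dots> = (pi * h) ^ ?n * ((2 * pi) ^ ?n * c)"
        using volA(1)[OF elim(2)] by simp
      finally have *: "norm (of_real ((2 * pi) ^ ?n) * I - of_real ((pi * h) ^ ?n) * C) \<le> (pi * h) ^ ?n * ((2 * pi) ^ ?n * c)" .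
      have "(1 / of_real h ^ ?n) * I - (1 / 2) ^ ?n * C =
         (of_real ((2 * pi) ^ ?n) * I - of_real ((pi * h) ^ ?n) * C) / of_real ((2 * pi * h) ^ ?n)"
        using elim(2) by (simp add: field_simps power_mult_distrib)
      also have "norm \<dots> \<le> (pi * h) ^ ?n * ((2 * pi) ^ ?n * c) / (2 * pi * h) ^ ?n"
        unfolding norm_divide norm_of_real
        using * elim(2) by (subst abs_of_pos) (auto intro!: divide_right_mono)
      also have "\<dots> = pi ^ ?n * c"
        using elim(2) by (simp add: power_mult_distrib)
      also have "\<dots> < e" using e by (simp add: c_def)
      finally show ?case by (simp add: I_def dist_norm)
    qed
  qed
qed

subsection \<open>The integrands on the sphere and the torus\<close>

text \<open>The covectors \<open>dz\<^sub>1, \<dots>, dz\<^sub>n, d(cnj z)\<^sub>1, \<dots>, d(cnj z)\<^sub>n\<close> (rows) evaluated on \<open>real_basis\<close>.\<close>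

definition wirtinger_mat :: "nat \<Rightarrow> complex mat" where
  "wirtinger_mat n = mat (2 * n) (2 * n) (\<lambda>(a, b).
     if a < n then (if b div 2 = a then if even b then 1 else \<i> else 0)
     else (if b div 2 = a - n then if even b then 1 else - \<i> else 0))"

lemma laplace_row_support:
  fixes A :: "complex mat"
  assumes A: "A \<in> carrier_mat n n" and i: "i < n" and S: "S \<subseteq> {..<n}"
    and z: "\<And>j. j < n \<Longrightarrow> j \<notin> S \<Longrightarrow> A $$ (i, j) = 0"
  shows "det A = (\<Sum>j\<in>S. A $$ (i, j) * ((-1) ^ (i + j) * det (mat_delete A i j)))"
proof -
  have "det A = (\<Sum>j<n. A $$ (i, j) * cofactor A i j)"
    by (rule laplace_expansion_row[OF A i])
  also have "\<dots> = (\<Sum>j\<in>S. A $$ (i, j) * cofactor A i j)"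
    by (rule sum.mono_neutral_right) (use S z in auto)
  finally show ?thesis by (simp add: cofactor_def)
qed

lemma mat_delete_entry:
  "a < dim_row A - 1 \<Longrightarrow> b < dim_col A - 1 \<Longrightarrow>
    mat_delete A i k $$ (a, b) = A $$ (if a < i then a else Suc a, if b < k then b else Suc b)"
  by (simp add: mat_delete_def)

text \<open>Expand along the last row, the newest d(cnj z), with entries 1 and - i; in either minor
  the row of the newest dz has one nonzero entry left. Together they give - 2 i, as in dz \<and>
  d(cnj z) = - 2 i dx \<and> dy, and (-1)^m records that this dz stands in row m, apart from its
  conjugate.\<close>

lemma det_wirtinger_mat: "det (wirtinger_mat n) = (\<Prod>m<n. - 2 * \<i> * (-1) ^ m)"
proof (induction n)
  case 0
  show ?case by (simp add: wirtinger_mat_def)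
next
  case (Suc n)
  let ?E = "wirtinger_mat (Suc n)"
  have E: "?E \<in> carrier_mat (2 * n + 2) (2 * n + 2)" by (simp add: wirtinger_mat_def)
  have Ev: "?E $$ (a, b) = (if a < Suc n then (if b div 2 = a then if even b then 1 else \<i> else 0)
     else (if b div 2 = a - Suc n then if even b then 1 else - \<i> else 0))" if "a < 2 * n + 2" "b < 2 * n + 2" for a b
    using that by (simp add: wirtinger_mat_def)
  have minor: "det (mat_delete ?E (2 * n + 1) c) = x * (-1) ^ n * det (wirtinger_mat n)"
    if c: "c = 2 * n \<and> x = \<i> \<or> c = 2 * n + 1 \<and> x = 1" for c x
  proof -
    let ?F = "mat_delete ?E (2 * n + 1) c"
    have F: "?F \<in> carrier_mat (2 * n + 1) (2 * n + 1)"
      by (rule carrier_matI) (simp_all add: mat_delete_def wirtinger_mat_def)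
    have Fx: "?F $$ (a, b) = ?E $$ (a, if b < c then b else Suc b)" if "a < 2 * n + 1" "b < 2 * n + 1" for a b
      using that by (simp add: mat_delete_def wirtinger_mat_def)
    have "det ?F = (\<Sum>j\<in>{2 * n}. ?F $$ (n, j) * ((-1) ^ (n + j) * det (mat_delete ?F n j)))"
    proof (rule laplace_row_support[OF F])
      show "?F $$ (n, j) = 0" if "j < 2 * n + 1" "j \<notin> {2 * n}" for j
        using that c by (subst Fx) (auto simp: Ev)
    qed auto
    moreover have "?F $$ (n, 2 * n) = x"
      using c by (subst Fx) (auto simp: Ev)
    moreover have "mat_delete ?F n (2 * n) = wirtinger_mat n"
    proof (rule eq_matI)
      show "dim_row (mat_delete ?F n (2 * n)) = dim_row (wirtinger_mat n)"
        "dim_col (mat_delete ?F n (2 * n)) = dim_col (wirtinger_mat n)"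
        by (simp_all add: wirtinger_mat_def mat_delete_def)
      fix a b assume "a < dim_row (wirtinger_mat n)" "b < dim_col (wirtinger_mat n)"
      then have ab: "a < 2 * n" "b < 2 * n" by (simp_all add: wirtinger_mat_def)
      then have "mat_delete ?F n (2 * n) $$ (a, b) = ?F $$ (if a < n then a else Suc a, b)"
        using carrier_matD[OF F] by (subst mat_delete_entry) simp_all
      also have "\<dots> = ?E $$ (if a < n then a else Suc a, b)"
        using ab c by (subst Fx) auto
      also have "\<dots> = wirtinger_mat n $$ (a, b)"
        using ab by (subst Ev) (auto simp: wirtinger_mat_def)
      finally show "mat_delete ?F n (2 * n) $$ (a, b) = wirtinger_mat n $$ (a, b)" .
    qed
    moreover have "(-1 :: complex) ^ (n + 2 * n) = (-1) ^ n" by (simp add: power_add power_mult del: mult_2)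
    ultimately show ?thesis by (simp only: sum.insert sum.empty finite.emptyI empty_iff not_False_eq_True if_True add_0_right mult.assoc)
  qed
  have "det ?E = (\<Sum>j\<in>{2 * n, 2 * n + 1}. ?E $$ (2 * n + 1, j) * ((-1) ^ (2 * n + 1 + j) * det (mat_delete ?E (2 * n + 1) j)))"
  proof (rule laplace_row_support[OF E])
    show "?E $$ (2 * n + 1, j) = 0" if "j < 2 * n + 2" "j \<notin> {2 * n, 2 * n + 1}" for j
      using that by (auto simp: wirtinger_mat_def)
  qed auto
  also have "\<dots> = - (\<i> * (-1) ^ n * det (wirtinger_mat n)) - \<i> * (1 * (-1) ^ n * det (wirtinger_mat n))"
  proof -
    have "?E $$ (2 * n + 1, 2 * n) = 1" "?E $$ (2 * n + 1, 2 * n + 1) = - \<i>"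
      by (simp_all add: wirtinger_mat_def)
    then show ?thesis
      using minor[of "2 * n" \<i>] minor[of "2 * n + 1" 1] by simp
  qed
  finally show ?case by (simp add: Suc.IH)
qed

text \<open>The rows below the first are the unit covectors other than the \<open>q\<close>-th.\<close>

lemma det_bordered_shift:
  fixes w :: "nat \<Rightarrow> complex"
  assumes q: "q \<le> n"
  shows "det (mat (Suc n) (Suc n) (\<lambda>(a, b). if a = 0 then w b else if b = insert_index q (a - 1) then 1 else 0))
    = w q * (-1) ^ q" (is "det ?N = _")
proof -
  have N: "?N \<in> carrier_mat (Suc n) (Suc n)" by simp
  have del: "mat_delete ?N 0 c = mat n n (\<lambda>(a, b). if insert_index c b = insert_index q a then 1 else 0)"
    if "c < Suc n" for c
    by (rule eq_matI) (use that in \<open>auto simp: mat_delete_def insert_index_def\<close>)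
  have "det ?N = (\<Sum>c<Suc n. ?N $$ (0, c) * cofactor ?N 0 c)"
    by (rule laplace_expansion_row[OF N]) simp
  also have "\<dots> = (\<Sum>c\<in>{q}. ?N $$ (0, c) * cofactor ?N 0 c)"
  proof (rule sum.mono_neutral_right)
    show "\<forall>c\<in>{..<Suc n} - {q}. ?N $$ (0, c) * cofactor ?N 0 c = 0"
    proof
      fix c assume c: "c \<in> {..<Suc n} - {q}"
      let ?D = "mat n n (\<lambda>(a, b). if insert_index c b = insert_index q a then 1 else 0 :: complex)"
      \<comment> \<open>For c \<noteq> q the column q survives in the minor, at this position, but
        no row has its 1 there: a zero column.\<close>
      let ?b = "if q < c then q else q - 1"
      have b: "?b < n" "insert_index c ?b = q" using c q by (auto simp: insert_index_def)
      have ne: "q \<noteq> insert_index q a" for a by (simp add: insert_index_def)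
      have "det ?D = (\<Sum>i<n. ?D $$ (i, ?b) * cofactor ?D i ?b)"
        by (rule laplace_expansion_column[OF _ b(1)]) simp
      also have "\<dots> = 0"
        by (rule sum.neutral) (use b ne in \<open>auto simp del: if_split\<close>)
      finally show "?N $$ (0, c) * cofactor ?N 0 c = 0"
        using c del[of c] by (simp add: cofactor_def)
    qed
  qed (use q in auto)
  also have "\<dots> = w q * (-1) ^ q"
  proof -
    have "mat_delete ?N 0 q = 1\<^sub>m n"
      unfolding del[OF le_imp_less_Suc[OF q]]
      by (rule eq_matI) (auto simp: insert_index_def split: if_splits)
    then show ?thesis using q by (simp add: cofactor_def)
  qed
  finally show ?thesis .
qed

section \<open>Evaluation of forms on real frames\<close>

lemma wedge_eq_det:
  "wedge ls vs = det (mat (length ls) (length ls) (\<lambda>(a, b). (ls ! a) (vs ! b)))"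
proof -
  have "mat (length ls) (length ls) (\<lambda>(a, b). (ls ! a) (vs ! b)) \<in> carrier_mat (length ls) (length ls)" by simp
  then show ?thesis
    unfolding wedge_def det_def'[OF \<open>_ \<in> carrier_mat _ _\<close>] lessThan_atLeast0
  proof (intro sum.cong refl arg_cong2[of _ _ _ _ "(*)"] prod.cong)
    fix \<pi> a assume "\<pi> \<in> {p. p permutes {0..<length ls}}" "a \<in> {0..<length ls}"
    then have "\<pi> a < length ls" "a < length ls" using permutes_in_image[of \<pi> "{0..<length ls}" a] by auto
    then show "(ls ! a) (vs ! \<pi> a) =
        mat (length ls) (length ls) (\<lambda>(a, b). (ls ! a) (vs ! b)) $$ (a, \<pi> a)" by simp
  qed
qed

lemma length_index_list: "length (index_list :: 'n::{finite,linorder} list) = CARD('n)"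
  by (simp add: index_list_def)

lemma real_basis_nth:
  assumes "b < 2 * CARD('n::{finite,linorder})"
  shows "(real_basis :: (complex^'n::{finite,linorder}) list) ! b = axis (index_list ! (b div 2)) (if even b then 1 else \<i>)"
proof -
  have *: "concat (map (\<lambda>i. [f i, g i]) l) ! b = (if even b then f (l ! (b div 2)) else g (l ! (b div 2)))"
    if "b < 2 * length l" for f g :: "'x \<Rightarrow> 'y" and l b
    using that
  proof (induction l arbitrary: b)
    case (Cons x l)
    consider "b = 0" | "b = 1" | c where "b = Suc (Suc c)" by (metis One_nat_def not0_implies_Suc)
    then show ?case using Cons by cases auto
  qed simp
  show ?thesis unfolding real_basis_def using assms by (subst *) (auto simp: length_index_list)
qed

lemma length_real_basis: "length (real_basis :: (complex^'n::{finite,linorder}) list) = 2 * CARD('n)"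
proof -
  have *: "length (concat (map (\<lambda>i. [f i, g i]) l)) = 2 * length l" for f g :: "'x \<Rightarrow> 'y" and l
    by (induction l) auto
  show ?thesis by (simp add: real_basis_def length_index_list *)
qed

lemma index_list_nth_eq_iff:
  assumes "a < CARD('n::{finite,linorder})" "b < CARD('n)"
  shows "(index_list :: 'n::{finite,linorder} list) ! a = index_list ! b \<longleftrightarrow> a = b"
  using assms by (simp add: index_list_def nth_eq_iff_index_eq)

lemma index_list_nth_rank: "(index_list :: 'n::{finite,linorder} list) ! rank_in UNIV j = j"
  "rank_in UNIV (j :: 'n) < CARD('n)"
proof -
  obtain k where k: "k < CARD('n)" "j = index_list ! k"
    using bij_betw_sorted_list[of "UNIV :: 'n set"] unfolding bij_betw_def index_list_def
    by (metis (no_types, lifting) UNIV_I imageE lessThan_iff)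
  then have "rank_in UNIV j = k" by (simp add: index_list_def rank_in_nth)
  with k show "index_list ! rank_in UNIV j = j" "rank_in UNIV j < CARD('n)" by simp_all
qed

definition wirtinger_covector :: "nat \<Rightarrow> complex^'n::{finite,linorder} \<Rightarrow> complex" where
  "wirtinger_covector a v =
     (if a < CARD('n) then v $ (index_list ! a) else cnj (v $ (index_list ! (a - CARD('n)))))"

text \<open>In the numbering of the rows of \<open>wirtinger_mat\<close>, leaving out d(cnj z_j)
  means skipping the number \<open>CARD('n) + rank_in UNIV j\<close>, which is what
  \<open>insert_index\<close> does.\<close>

lemma dz_dzbar_nth:
  fixes j :: "'n::{finite,linorder}"
  assumes "m < 2 * CARD('n) - 1"
  shows "dz_dzbar UNIV (- {j}) ! m = wirtinger_covector (insert_index (CARD('n) + rank_in UNIV j) m)"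
    and "length (dz_dzbar UNIV (- {j})) = 2 * CARD('n) - 1"
proof -
  let ?n = "CARD('n)" and ?p = "rank_in UNIV j"
  have L: "sorted_list_of_set (- {j}) = take ?p index_list @ drop (Suc ?p) index_list"
    using sorted_list_of_set_delete_nth[of ?p "UNIV :: 'n set"] index_list_nth_rank[of j]
    by (simp add: index_list_def Compl_eq_Diff_UNIV)
  have len: "length (sorted_list_of_set (- {j})) = ?n - 1"
    by (simp add: Compl_eq_Diff_UNIV card_Diff_singleton)
  show "length (dz_dzbar UNIV (- {j})) = 2 * ?n - 1"
    using len by (simp add: dz_dzbar_def)
  show "dz_dzbar UNIV (- {j}) ! m = wirtinger_covector (insert_index (?n + ?p) m)"
  proof (cases "m < ?n")
    case True
    then show ?thesis
      by (auto simp: dz_dzbar_def nth_append wirtinger_covector_def insert_index_def index_list_def fun_eq_iff)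
  next
    case False
    define k where "k = m - ?n"
    have k: "m = ?n + k" "k < ?n - 1" using False assms by (auto simp: k_def)
    have "sorted_list_of_set (- {j}) ! k = index_list ! (insert_index ?p k)"
      unfolding L using k index_list_nth_rank(2)[of j]
      by (auto simp: nth_append insert_index_def length_index_list)
    moreover have "insert_index (?n + ?p) m = ?n + insert_index ?p k"
      using k by (simp add: insert_index_def)
    moreover have "dz_dzbar UNIV (- {j}) ! m = (\<lambda>v. cnj (v $ (sorted_list_of_set (- {j}) ! k)))"
      using k len by (simp add: dz_dzbar_def nth_append)
    ultimately show ?thesis by (simp add: wirtinger_covector_def fun_eq_iff)
  qed
qed

lemma wirtinger_covector_real_basis:
  assumes "a < 2 * CARD('n::{finite,linorder})" "b < 2 * CARD('n)"
  shows "wirtinger_covector a ((real_basis :: (complex^'n::{finite,linorder}) list) ! b) = wirtinger_mat CARD('n) $$ (a, b)"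
  using assms
  by (auto simp: wirtinger_covector_def wirtinger_mat_def real_basis_nth axis_def index_list_nth_eq_iff)

text \<open>The sum is the Laplace expansion of a determinant whose first row is the covector dual
  to \<nu>. Since the inner product of \<nu> and v is the sum over i of (cnj \<nu>_i v_i + \<nu>_i
  cnj v_i) / 2, the matrix factors as \<open>N * wirtinger_mat\<close>; in \<open>det N\<close> only
  the coefficient \<nu>_j / 2 of the omitted d(cnj z_j) survives.\<close>

lemma normal_wedge_expansion:
  fixes \<nu> :: "complex^'n::{finite,linorder}"
  shows "(\<Sum>k<2 * CARD('n). (-1) ^ k * of_real (inner \<nu> (real_basis ! k)) *
      wedge (dz_dzbar UNIV (- {j})) (take k real_basis @ drop (Suc k) real_basis)) =
    \<nu> $ j / 2 * (-1) ^ (CARD('n) + rank_in UNIV j) * (\<Prod>m<CARD('n). - 2 * \<i> * (-1) ^ m)"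
proof -
  let ?n = "CARD('n)" and ?B = "real_basis :: (complex^'n::{finite,linorder}) list"
  define q where "q = ?n + rank_in UNIV j"
  have n: "?n > 0" by simp
  have q: "q \<le> 2 * ?n - 1" using index_list_nth_rank(2)[of j] by (simp add: q_def)
  define w where "w b = (if b < ?n then cnj (\<nu> $ (index_list ! b)) else \<nu> $ (index_list ! (b - ?n))) / 2" for b
  define N where "N = mat (Suc (2 * ?n - 1)) (Suc (2 * ?n - 1))
     (\<lambda>(a, b). if a = 0 then w b else if b = insert_index q (a - 1) then 1 else 0)"
  define M where "M = mat (2 * ?n) (2 * ?n) (\<lambda>(a, b). if a = 0 then complex_of_real (inner \<nu> (?B ! b))
     else wirtinger_covector (insert_index q (a - 1)) (?B ! b))"
  have S: "Suc (2 * ?n - 1) = 2 * ?n" using n by simp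
  have N: "N \<in> carrier_mat (2 * ?n) (2 * ?n)" by (simp add: N_def S)
  have E: "wirtinger_mat ?n \<in> carrier_mat (2 * ?n) (2 * ?n)" by (simp add: wirtinger_mat_def)
  have M: "M \<in> carrier_mat (2 * ?n) (2 * ?n)" by (simp add: M_def)
  have "M = N * wirtinger_mat ?n"
  proof (rule eq_matI)
    show "dim_row M = dim_row (N * wirtinger_mat ?n)" "dim_col M = dim_col (N * wirtinger_mat ?n)"
      using M N E by auto
    fix a b assume "a < dim_row (N * wirtinger_mat ?n)" "b < dim_col (N * wirtinger_mat ?n)"
    then have ab: "a < 2 * ?n" "b < 2 * ?n" using N E by auto
    have "(N * wirtinger_mat ?n) $$ (a, b) = (\<Sum>c\<in>{0..<2 * ?n}. N $$ (a, c) * wirtinger_mat ?n $$ (c, b))"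
      using ab N E by (simp add: scalar_prod_def)
    also have "\<dots> = (\<Sum>c<2 * ?n. N $$ (a, c) * wirtinger_covector c (?B ! b))"
      using ab by (intro sum.cong) (auto simp: wirtinger_covector_real_basis)
    also have "\<dots> = M $$ (a, b)"
    proof (cases "a = 0")
      case True
      have "(\<Sum>c<2 * ?n. N $$ (a, c) * wirtinger_covector c (?B ! b)) =
        (\<Sum>c<2 * ?n. w c * wirtinger_covector c (?B ! b))"
        using True by (intro sum.cong) (auto simp: N_def S)
      also have "\<dots> = (\<Sum>c<?n. w c * wirtinger_covector c (?B ! b)) +
           (\<Sum>c<?n. w (?n + c) * wirtinger_covector (?n + c) (?B ! b))"
        by (simp add: mult_2 sum.nat_group[symmetric] sum_up_index_split lessThan_atLeast0
            sum.atLeastLessThan_concat[of 0 ?n "?n + ?n", symmetric] sum.shift_bounds_nat_ivl[of _ 0 ?n ?n, simplified] add.commute)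
      also have "\<dots> = (\<Sum>c<?n. complex_of_real (inner (\<nu> $ (index_list ! c)) ((?B ! b) $ (index_list ! c))))"
        unfolding sum.distrib[symmetric]
        by (intro sum.cong) (auto simp: w_def wirtinger_covector_def inner_complex_def complex_eq_iff field_simps)
      also have "\<dots> = (\<Sum>i\<in>UNIV. complex_of_real (inner (\<nu> $ i) ((?B ! b) $ i)))"
        unfolding index_list_def
        using sum.reindex_bij_betw[OF bij_betw_sorted_list[of "UNIV :: 'n set"],
          of "\<lambda>i. complex_of_real (inner (\<nu> $ i) ((?B ! b) $ i))"] by simp
      also have "\<dots> = M $$ (a, b)"
        using True ab by (simp add: M_def inner_vec_def)
      finally show ?thesis .
    next
      case False
      have lt: "insert_index q (a - 1) < 2 * ?n" using ab False by (auto simp: insert_index_def)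
      have "(\<Sum>c<2 * ?n. N $$ (a, c) * wirtinger_covector c (?B ! b)) =
        (\<Sum>c<2 * ?n. if c = insert_index q (a - 1) then wirtinger_covector c (?B ! b) else 0)"
        using False ab by (intro sum.cong) (auto simp: N_def S)
      then show ?thesis using lt False ab by (simp add: M_def)
    qed
    finally show "M $$ (a, b) = (N * wirtinger_mat ?n) $$ (a, b)" ..
  qed
  then have "det M = det N * det (wirtinger_mat ?n)" using det_mult[OF N E] by simp
  also have "det N = w q * (-1) ^ q" unfolding N_def by (rule det_bordered_shift[OF q])
  also have "w q = \<nu> $ j / 2" by (simp add: w_def q_def index_list_nth_rank)
  finally have detM: "det M = \<nu> $ j / 2 * (-1) ^ q * (\<Prod>m<?n. - 2 * \<i> * (-1) ^ m)"
    by (simp add: det_wirtinger_mat)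
  have "det M = (\<Sum>k<2 * ?n. M $$ (0, k) * cofactor M 0 k)"
    by (rule laplace_expansion_row[OF M]) simp
  also have "\<dots> = (\<Sum>k<2 * ?n. (-1) ^ k * of_real (inner \<nu> (?B ! k)) *
      wedge (dz_dzbar UNIV (- {j})) (take k ?B @ drop (Suc k) ?B))"
  proof (rule sum.cong[OF refl])
    fix k assume "k \<in> {..<2 * ?n}"
    then have k: "k < 2 * ?n" by simp
    have len: "length (dz_dzbar UNIV (- {j})) = 2 * ?n - 1"
      by (rule dz_dzbar_nth(2)[of 0]) (use n in linarith)
    have "mat_delete M 0 k = mat (2 * ?n - 1) (2 * ?n - 1)
       (\<lambda>(a, b). (dz_dzbar UNIV (- {j}) ! a) ((take k ?B @ drop (Suc k) ?B) ! b))"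
    proof (rule eq_matI)
      fix a b
      assume "a < dim_row (mat (2 * ?n - 1) (2 * ?n - 1) (\<lambda>(a, b). (dz_dzbar UNIV (- {j}) ! a) ((take k ?B @ drop (Suc k) ?B) ! b)))"
        "b < dim_col (mat (2 * ?n - 1) (2 * ?n - 1) (\<lambda>(a, b). (dz_dzbar UNIV (- {j}) ! a) ((take k ?B @ drop (Suc k) ?B) ! b)))"
      then have ab: "a < 2 * ?n - 1" "b < 2 * ?n - 1" by auto
      have "(take k ?B @ drop (Suc k) ?B) ! b = ?B ! (if b < k then b else Suc b)"
        using k ab by (auto simp: nth_append length_real_basis)
      then show "mat_delete M 0 k $$ (a, b) = mat (2 * ?n - 1) (2 * ?n - 1)
         (\<lambda>(a, b). (dz_dzbar UNIV (- {j}) ! a) ((take k ?B @ drop (Suc k) ?B) ! b)) $$ (a, b)"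
        using ab by (simp add: mat_delete_def M_def dz_dzbar_nth(1)[OF ab(1)] q_def)
    qed (auto simp: mat_delete_def M_def)
    then show "M $$ (0, k) * cofactor M 0 k = (-1) ^ k * of_real (inner \<nu> (?B ! k)) *
      wedge (dz_dzbar UNIV (- {j})) (take k ?B @ drop (Suc k) ?B)"
      using k by (simp add: wedge_eq_det len cofactor_def) (simp add: M_def)
  qed
  finally show ?thesis using detM by (simp add: q_def)
qed

lemma prod_alternating_signs: "(\<Prod>m<n. (-1) ^ m) = ((-1) ^ (n * (n - 1) div 2) :: complex)"
proof -
  have "(\<Prod>m<n. (-1) ^ m) = ((-1) ^ (\<Sum>m<n. m) :: complex)"
    by (simp add: power_sum)
  also have "(\<Sum>m<n. m) = n * (n - 1) div 2"
    by (induction n) (auto simp: algebra_simps div_add_self1 split: nat_diff_split)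
  finally show ?thesis .
qed

lemma form_eval_n_minus_1:
  fixes \<theta> :: "'n::{finite,linorder} form"
  assumes \<theta>: "smooth_form CARD('n) (int (CARD('n) - 1)) U \<theta>" and z: "z \<in> U"
    and vs: "length vs = 2 * CARD('n) - 1"
  shows "form_eval \<theta> z vs = (\<Sum>j\<in>UNIV. \<theta> z UNIV (- {j}) * wedge (dz_dzbar UNIV (- {j})) vs)"
proof -
  let ?S = "{(I, J). card (I :: 'n set) + card (J :: 'n set) = length vs}"
  have n: "CARD('n) > 0" by simp
  have "form_eval \<theta> z vs = (\<Sum>(I, J)\<in>(\<lambda>j. (UNIV, - {j})) ` UNIV. \<theta> z I J * wedge (dz_dzbar I J) vs)"
    unfolding form_eval_def
  proof (rule sum.mono_neutral_right)
    show "(\<lambda>j. (UNIV, - {j})) ` UNIV \<subseteq> ?S"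
      using vs n by (auto simp: Compl_eq_Diff_UNIV card_Diff_singleton)
    show "\<forall>x\<in>?S - (\<lambda>j. (UNIV, - {j})) ` UNIV. (case x of (I, J) \<Rightarrow> \<theta> z I J * wedge (dz_dzbar I J) vs) = 0"
    proof (clarify)
      fix I J :: "'n set" assume nin: "(I, J) \<notin> (\<lambda>j. (UNIV, - {j})) ` UNIV"
      have "\<theta> z I J = 0"
      proof (rule ccontr)
        assume "\<theta> z I J \<noteq> 0"
        then have c: "card I = CARD('n)" "card J = CARD('n) - 1"
          using \<theta> z unfolding smooth_form_def by (metis, metis int_int_eq)
        have "I = UNIV" using c(1) by (rule card_eq_UNIV_imp_eq_UNIV[OF finite])
        moreover have "card (- J) = 1"
          using c(2) n by (simp add: Compl_eq_Diff_UNIV card_Diff_subset)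
        then obtain j where "- J = {j}" by (auto simp: card_1_singleton_iff)
        then have "J = - {j}" by blast
        ultimately show False using nin by blast
      qed
      then show "\<theta> z I J * wedge (dz_dzbar I J) vs = 0" by simp
    qed
  qed simp
  also have "\<dots> = (\<Sum>j\<in>UNIV. \<theta> z UNIV (- {j}) * wedge (dz_dzbar UNIV (- {j})) vs)"
    by (subst sum.reindex) (auto simp: inj_on_def)
  finally show ?thesis .
qed

text \<open>The alternating product in \<open>det_wirtinger_mat\<close> becomes the sign of the
  theorem. The (-1)^n inside (- 2 i)^n cancels the one from the position n +
  \<open>rank_in UNIV j\<close> of the omitted covector.\<close>

lemma tangential_value_eq:
  fixes \<theta> :: "'n::{finite,linorder} form"
  assumes \<theta>: "smooth_form CARD('n) (int (CARD('n) - 1)) U \<theta>" and z: "z \<in> U"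
  shows "tangential_value \<theta> z \<nu> = (2 * \<i>) ^ CARD('n) / 2 * (-1) ^ (CARD('n) * (CARD('n) - 1) div 2) *
     (\<Sum>j\<in>UNIV. (-1) ^ rank_in UNIV j * \<theta> z UNIV (- {j}) * \<nu> $ j)"
proof -
  let ?n = "CARD('n)" and ?B = "real_basis :: (complex^'n::{finite,linorder}) list"
  let ?vs = "\<lambda>k. take k ?B @ drop (Suc k) ?B"
  have "tangential_value \<theta> z \<nu> = (\<Sum>k<2 * ?n. (-1) ^ k * of_real (inner \<nu> (?B ! k)) *
      (\<Sum>j\<in>UNIV. \<theta> z UNIV (- {j}) * wedge (dz_dzbar UNIV (- {j})) (?vs k)))"
    unfolding tangential_value_def length_real_basis
    by (intro sum.cong refl) (subst form_eval_n_minus_1[OF \<theta> z], auto simp: length_real_basis)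
  also have "\<dots> = (\<Sum>j\<in>UNIV. \<theta> z UNIV (- {j}) * (\<Sum>k<2 * ?n. (-1) ^ k * of_real (inner \<nu> (?B ! k)) *
      wedge (dz_dzbar UNIV (- {j})) (?vs k)))"
    unfolding sum_distrib_left by (subst sum.swap) (simp only: mult_ac)
  also have "\<dots> = (2 * \<i>) ^ ?n / 2 * (-1) ^ (?n * (?n - 1) div 2) *
     (\<Sum>j\<in>UNIV. (-1) ^ rank_in UNIV j * \<theta> z UNIV (- {j}) * \<nu> $ j)"
  proof -
    have 1: "(\<Prod>m<?n. - 2 * \<i> * (-1) ^ m) = (- 2 * \<i>) ^ ?n * (-1) ^ (?n * (?n - 1) div 2)"
      by (subst prod.distrib) (simp only: prod_alternating_signs prod_constant card_lessThan)
    have 2: "(- 2 * \<i>) ^ ?n = (-1) ^ ?n * (2 * \<i>) ^ ?n"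
      by (simp only: power_mult_distrib[symmetric]) simp
    have 3: "(-1) ^ ?n * (-1) ^ ?n = (1 :: complex)"
      by (simp add: power_mult_distrib[symmetric])
    have "\<theta> z UNIV (- {j}) * (\<nu> $ j / 2 * (-1) ^ (?n + rank_in UNIV j) * ((-1) ^ ?n * (2 * \<i>) ^ ?n * (-1) ^ (?n * (?n - 1) div 2))) =
       (2 * \<i>) ^ ?n / 2 * (-1) ^ (?n * (?n - 1) div 2) * ((-1) ^ rank_in UNIV j * \<theta> z UNIV (- {j}) * \<nu> $ j)" for j
    proof -
      have "\<theta> z UNIV (- {j}) * (\<nu> $ j / 2 * (-1) ^ (?n + rank_in UNIV j) * ((-1) ^ ?n * (2 * \<i>) ^ ?n * (-1) ^ (?n * (?n - 1) div 2))) =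
        ((-1) ^ ?n * (-1) ^ ?n) * ((2 * \<i>) ^ ?n / 2 * (-1) ^ (?n * (?n - 1) div 2) * ((-1) ^ rank_in UNIV j * \<theta> z UNIV (- {j}) * \<nu> $ j))"
        by (simp only: power_add) (simp add: mult_ac)
      then show ?thesis unfolding 3 by simp
    qed
    then show ?thesis unfolding normal_wedge_expansion 1 2 sum_distrib_left by (intro sum.cong refl)
  qed
  finally show ?thesis .
qed

text \<open>The constant n / R^2 collects the cone factor 2 n / R of the area integral, the 1 / R of
  the unit normal z / R and the 1 / 2 of \<open>tangential_value_eq\<close>. It is the constant that
  appears in \<open>annulus_limit_sphere\<close>.\<close>

lemma sphere_integral_eq:
  fixes \<theta> :: "'n::{finite,linorder} form"
  assumes \<theta>: "smooth_form CARD('n) (int (CARD('n) - 1)) (- {0}) \<theta>" and R: "R > 0"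
  defines "g \<equiv> \<lambda>z. \<Sum>j\<in>UNIV. (-1) ^ rank_in UNIV j * \<theta> z UNIV (- {j}) * z $ j"
  shows "sphere_integral R \<theta> = (2 * \<i>) ^ CARD('n) * (-1) ^ (CARD('n) * (CARD('n) - 1) div 2) *
     (of_real (real CARD('n) / R\<^sup>2) * (LINT x:cball 0 R|lborel. g ((R / norm x) *\<^sub>R x)))"
proof -
  define c where "c = (2 * \<i>) ^ CARD('n) / 2 * (-1) ^ (CARD('n) * (CARD('n) - 1) div 2)"
  have tv: "tangential_value \<theta> ((R / norm x) *\<^sub>R x) ((1 / R) *\<^sub>R ((R / norm x) *\<^sub>R x)) =
      c / of_real R * g ((R / norm x) *\<^sub>R x)" for x :: "complex^'n::{finite,linorder}"
  proof (cases "x = 0")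
    case True
    then show ?thesis by (simp add: tangential_value_def g_def)
  next
    case False
    then have "(R / norm x) *\<^sub>R x \<in> - {0}" using R by simp
    from tangential_value_eq[OF \<theta> this] show ?thesis
      by (simp add: c_def g_def sum_distrib_left scaleR_conv_of_real[where 'a=complex] mult_ac sum_divide_distrib)
  qed
  have "sphere_integral R \<theta> = of_real (real (2 * CARD('n)) / R) * (c / of_real R * (LINT x:cball 0 R|lborel. g ((R / norm x) *\<^sub>R x)))"
    unfolding sphere_integral_def sphere_area_integral_def tv set_lebesgue_integral_def
    by (simp add: mult_ac flip: integral_mult_right_zero)
  then show ?thesis using R by (simp add: c_def field_simps power2_eq_square)
qed

lemma has_derivative_vec_components:
  fixes f :: "'a::euclidean_space \<Rightarrow> 'b::euclidean_space^'n::finite"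
  assumes "\<And>i. ((\<lambda>x. f x $ i) has_derivative (\<lambda>h. f' h $ i)) (at a)"
  shows "(f has_derivative f') (at a)"
proof (subst has_derivative_componentwise_within, intro ballI)
  fix b :: "'b^'n" assume "b \<in> Basis"
  then obtain i u where b: "b = axis i u" by (auto simp: Basis_vec_def)
  show "((\<lambda>x. inner (f x) b) has_derivative (\<lambda>h. inner (f' h) b)) (at a)"
    unfolding b inner_axis by (rule has_derivative_inner_left[OF assms])
qed

lemma torus_map_derivative:
  "frechet_derivative (torus_map \<epsilon>) (at t) (axis j 1) = axis j (\<i> * (torus_map \<epsilon> t $ j))"
proof -
  have "(torus_map \<epsilon> has_derivative (\<lambda>h. \<chi> i. (h $ i) *\<^sub>R (\<i> * (of_real \<epsilon> * cis (t $ i))))) (at t)"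
  proof (rule has_derivative_vec_components)
    fix i
    have "((\<lambda>s. of_real \<epsilon> * cis s) has_vector_derivative (\<i> * (of_real \<epsilon> * cis (t $ i)))) (at (t $ i))"
      unfolding cis_conv_exp
      by (auto intro!: derivative_eq_intros has_vector_derivative_real_field simp: mult_ac)
    moreover have "((\<lambda>t. t $ i) has_derivative (\<lambda>h. h $ i)) (at t)"
      by (intro bounded_linear_imp_has_derivative bounded_linear_vec_nth)
    ultimately have "((\<lambda>t. of_real \<epsilon> * cis (t $ i)) has_derivative (\<lambda>h. (h $ i) *\<^sub>R (\<i> * (of_real \<epsilon> * cis (t $ i))))) (at t)"
      unfolding has_vector_derivative_def using has_derivative_compose by fast
    then show "((\<lambda>t. torus_map \<epsilon> t $ i) has_derivative
        (\<lambda>h. (\<chi> i. (h $ i) *\<^sub>R (\<i> * (of_real \<epsilon> * cis (t $ i)))) $ i)) (at t)"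
      by (simp add: torus_map_def)
  qed
  from fun_cong[OF frechet_derivative_at[OF this], of "axis j 1", symmetric]
  have "frechet_derivative (torus_map \<epsilon>) (at t) (axis j 1) =
      (\<chi> i. (axis j 1 $ i) *\<^sub>R (\<i> * (of_real \<epsilon> * cis (t $ i))))" .
  then show ?thesis unfolding torus_map_def by (auto simp: Finite_Cartesian_Product.vec_eq_iff axis_def)
qed

text \<open>The j-th velocity of the parametrisation is i z_j in the j-th coordinate only, so the
  determinant of dz_1, ..., dz_n on the velocities is that of a diagonal matrix.\<close>

lemma torus_integral_eq:
  fixes \<gamma> :: "'n::{finite,linorder} form"
  assumes \<epsilon>: "\<epsilon> > 0" and \<gamma>: "holo_form CARD('n) {z. \<forall>i. z $ i \<noteq> 0} \<gamma>"
  shows "torus_integral \<epsilon> \<gamma> = \<i> ^ CARD('n) *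
     (LINT t:cbox 0 (\<chi> i. 2 * pi)|lborel. \<gamma> (torus_map \<epsilon> t) UNIV {} * (\<Prod>i\<in>UNIV. torus_map \<epsilon> t $ i))"
proof -
  let ?n = "CARD('n)"
  have "form_eval \<gamma> (torus_map \<epsilon> t) (map (\<lambda>j. frechet_derivative (torus_map \<epsilon>) (at t) (axis j 1)) index_list) =
     \<i> ^ ?n * (\<gamma> (torus_map \<epsilon> t) UNIV {} * (\<Prod>i\<in>UNIV. torus_map \<epsilon> t $ i))" for t
  proof -
    define z where "z = torus_map \<epsilon> t"
    define vs where "vs = map (\<lambda>j. axis j (\<i> * z $ j)) index_list"
    have z: "z \<in> {z. \<forall>i. z $ i \<noteq> 0}" using \<epsilon> by (simp add: z_def torus_map_def)
    have len: "length vs = ?n" by (simp add: vs_def length_index_list)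
    have "form_eval \<gamma> z vs = (\<Sum>(I, J)\<in>{(UNIV, {})}. \<gamma> z I J * wedge (dz_dzbar I J) vs)"
      unfolding form_eval_def
    proof (rule sum.mono_neutral_right)
      show "\<forall>x\<in>{(I, J). card I + card J = length vs} - {(UNIV, {})}.
         (case x of (I, J) \<Rightarrow> \<gamma> z I J * wedge (dz_dzbar I J) vs) = 0"
      proof
        fix x assume "x \<in> {(I, J). card I + card J = length vs} - {(UNIV :: 'n set, {} :: 'n set)}"
        moreover obtain I J where x: "x = (I, J)" by (cases x)
        ultimately have "\<not> (I = UNIV \<and> J = {})" by simp
        then have "\<gamma> z I J = 0"
          using \<gamma> z card_eq_UNIV_imp_eq_UNIV[of I] unfolding holo_form_def by fastforce
        then show "(case x of (I, J) \<Rightarrow> \<gamma> z I J * wedge (dz_dzbar I J) vs) = 0" by (simp add: x)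
      qed
    qed (auto simp: len)
    also have "\<dots> = \<gamma> z UNIV {} * wedge (dz_dzbar UNIV {}) vs" by simp
    also have "wedge (dz_dzbar UNIV {}) vs = \<i> ^ ?n * (\<Prod>i\<in>UNIV. z $ i)"
    proof -
      let ?M = "mat ?n ?n (\<lambda>(a, b). (dz_dzbar UNIV {} ! a) (vs ! b))"
      have Mab: "?M $$ (a, b) = (if a = b then \<i> * z $ (index_list ! a) else 0)" if "a < ?n" "b < ?n" for a b
        using that
        by (auto simp: dz_dzbar_def vs_def length_index_list index_list_def[symmetric] axis_def index_list_nth_eq_iff)
      have "wedge (dz_dzbar UNIV {}) vs = det ?M"
        by (simp add: wedge_eq_det dz_dzbar_def)
      also have "\<dots> = prod_list (diag_mat ?M)"
      proof (rule det_upper_triangular)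
        show "upper_triangular ?M" by (intro upper_triangularI) (use Mab in auto)
        show "?M \<in> carrier_mat ?n ?n" by simp
      qed
      also have "\<dots> = (\<Prod>a = 0..<?n. ?M $$ (a, a))" by (simp add: prod_list_diag_prod)
      also have "\<dots> = (\<Prod>a<?n. \<i> * z $ (index_list ! a))"
        by (intro prod.cong) (simp_all only: atLeast0LessThan lessThan_iff Mab if_True refl)
      also have "\<dots> = (\<Prod>i\<in>UNIV. \<i> * z $ i)"
        unfolding index_list_def by (rule prod.reindex_bij_betw[OF bij_betw_sorted_list])
      finally show ?thesis by (simp add: prod.distrib)
    qed
    finally show ?thesis by (simp add: torus_map_derivative z_def vs_def mult_ac)
  qed
  then show ?thesis unfolding torus_integral_def set_lebesgue_integral_def
    by (simp flip: integral_mult_right_zero)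
qed

subsection \<open>The residue theorem\<close>

theorem theorem8p5:
  fixes \<epsilon> :: real
    and \<theta> :: "'n::{finite,linorder} form"
    and \<gamma> :: "('n, 'n) cochain"
  assumes "\<epsilon> > 0"
    and "smooth_form CARD('n) (int (CARD('n) - 1)) (- {0}) \<theta>"
    and "\<forall>z\<in>- {0}. \<forall>I J. dbar \<theta> z I J = 0"
    and "holo_cocycle coord_cover CARD('n) (CARD('n) - 1) \<gamma>"
    and "classes_correspond coord_cover CARD('n) (CARD('n) - 1) \<theta> \<gamma>"
  shows "sphere_integral (sqrt (real CARD('n)) * \<epsilon>) \<theta> =
         (-1) ^ (CARD('n) * (CARD('n) - 1) div 2) * torus_integral \<epsilon> (\<gamma> index_list)"
proof -
  let ?n = "CARD('n)"
  define R where "R = sqrt (real ?n) * \<epsilon>"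
  have n: "?n > 0" by simp
  have R: "R > 0" using assms(1) n by (simp add: R_def)
  let ?U = "{z :: complex^'n::{finite,linorder}. \<forall>i. z $ i \<noteq> 0}"
  let ?\<Theta> = "\<lambda>j z. \<theta> z UNIV (- {j})" and ?p = "\<lambda>j. (-1) ^ rank_in UNIV j :: complex"
  \<comment> \<open>Up to constants, \<open>g\<close> is the density of \<theta> on spheres about 0,
    and \<open>G\<close> below is that of \<gamma> on the tori |z_i| = const. The same functions
    arise from differentiating the cutoffs, the derivative of |z|^2 in cnj z_j being z_j.\<close>
  define g where "g z = (\<Sum>j\<in>UNIV. ?p j * ?\<Theta> j z * z $ j)" for z
  define G where "G z = \<gamma> index_list z UNIV {} * (\<Prod>i\<in>UNIV. z $ i)" for z
  have Ck: "Ck_on 1 (?\<Theta> j) (- {0})" for j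
    using assms(2) by (auto simp only: smooth_form_def intro: Ck_on_of_smooth_on)
  have c\<Theta>: "continuous_on (- {0}) (?\<Theta> j)" for j by (rule Ck_on_1_continuous[OF Ck])
  have Uc: "cover_inter coord_cover (index_list :: 'n list) = ?U"
    unfolding index_list_def cover_inter_sorted by simp
  have holo: "holo_form ?n ?U (\<gamma> index_list)"
  proof -
    have "length (index_list :: 'n list) = ?n - 1 + 1" using n by (simp add: length_index_list)
    then show ?thesis
      using assms(4) unfolding holo_cocycle_def holo_cochain_def Uc[symmetric] by blast
  qed
  have c\<gamma>: "continuous_on ?U (\<lambda>z. \<gamma> index_list z UNIV {})"
  proof -
    have "isCont (\<lambda>z. \<gamma> index_list z UNIV {}) z" if "z \<in> ?U" for z
      using holo that unfolding holo_form_def holo_on_def by (meson has_derivative_continuous)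
    then show ?thesis by (auto intro!: continuous_at_imp_continuous_on)
  qed
  have cg: "continuous_on (- {0}) g" unfolding g_def
    by (intro continuous_intros c\<Theta>)
  have g0: "g 0 = 0" by (simp add: g_def)
  have cG: "continuous_on ?U G" unfolding G_def
    by (intro continuous_intros c\<gamma>)
  have oU: "open ?U" using nonzero_coords_open[of "UNIV :: 'n set"] by simp
  have closed: "(\<Sum>j\<in>UNIV. ?p j * d_zbar j (?\<Theta> j) z) = 0" if "z \<noteq> 0" for z
  proof -
    have "dbar \<theta> z UNIV UNIV = 0" using assms(3) that by simp
    then show ?thesis by (simp add: dbar_def rank_in_def Compl_eq_Diff_UNIV)
  qed
  obtain \<xi> where \<xi>: "cd_cochain coord_cover ?n (int (?n - 1) - 1) \<xi>"
    "\<And>\<alpha> z I J. \<alpha> \<noteq> [] \<Longrightarrow> z \<in> cover_inter coord_cover \<alpha> \<Longrightarrow>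
          of_form \<theta> \<alpha> z I J - of_cech (?n - 1) \<gamma> \<alpha> z I J = cd_diff \<xi> \<alpha> z I J"
    using assms(5) unfolding classes_correspond_def by blast
  \<comment> \<open>the residue theorem in smeared form, for a \<open>C\<^sup>1\<close> radial and a \<open>C\<^sup>1\<close> polydisc cutoff\<close>
  have smoothed: "(LINT z|lborel. of_real (trapezoid (R\<^sup>2) h d ((norm z)\<^sup>2)) * g z) =
      (LINT z|lborel. (\<Prod>i\<in>UNIV. of_real (trapezoid (\<epsilon>\<^sup>2) h d ((norm (z $ i))\<^sup>2))) * G z)"
    if dh: "0 < d" "0 < h" for d h
  proof -
    have e: "0 < R\<^sup>2" "0 < \<epsilon>\<^sup>2" using R assms(1) by auto
    have "(LINT z|lborel. of_real (trapezoid (R\<^sup>2) h d ((norm z)\<^sup>2)) * g z) =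
       - (\<Sum>j\<in>UNIV. ?p j * (LINT z|lborel. ?\<Theta> j z * polydisc_test (\<epsilon>\<^sup>2) h d {j} z))"
      unfolding g_def by (rule radial_eq_polydisc[OF e dh Ck closed])
    also have "(\<Sum>j\<in>UNIV. ?p j * (LINT z|lborel. ?\<Theta> j z * polydisc_test (\<epsilon>\<^sup>2) h d {j} z)) =
       (-1) ^ (?n + 1) * (LINT z|lborel. \<gamma> index_list z UNIV {} * polydisc_test (\<epsilon>\<^sup>2) h d UNIV z)"
    proof (rule cech_descent[OF e(2) dh _ c\<gamma> \<xi>])
      show "continuous_on {z. z $ j \<noteq> 0} (?\<Theta> j)" for j
        by (rule continuous_on_subset[OF c\<Theta>]) auto
    qed
    also have "(\<lambda>z. \<gamma> index_list z UNIV {} * polydisc_test (\<epsilon>\<^sup>2) h d UNIV z) =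
      (\<lambda>z. (-1) ^ ?n * ((\<Prod>i\<in>UNIV. of_real (trapezoid (\<epsilon>\<^sup>2) h d ((norm (z $ i))\<^sup>2))) * G z))"
    proof
      fix z :: "complex^'n::{finite,linorder}"
      have "polydisc_test (\<epsilon>\<^sup>2) h d UNIV z =
         (\<Prod>i\<in>UNIV. (- 1) * (of_real (trapezoid (\<epsilon>\<^sup>2) h d ((norm (z $ i))\<^sup>2)) * z $ i))"
        by (simp add: polydisc_test_def)
      also have "\<dots> = (-1) ^ ?n * ((\<Prod>i\<in>UNIV. of_real (trapezoid (\<epsilon>\<^sup>2) h d ((norm (z $ i))\<^sup>2))) * (\<Prod>i\<in>UNIV. z $ i))"
        by (simp only: prod.distrib prod_constant)
      finally show "\<gamma> index_list z UNIV {} * polydisc_test (\<epsilon>\<^sup>2) h d UNIV z =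
        (-1) ^ ?n * ((\<Prod>i\<in>UNIV. of_real (trapezoid (\<epsilon>\<^sup>2) h d ((norm (z $ i))\<^sup>2))) * G z)"
        by (simp add: G_def mult_ac)
    qed
    \<comment> \<open>The minus of \<open>radial_eq_polydisc\<close>, the weight of
      \<open>UNIV\<close> and the n minus signs of the test function cancel.\<close>
    also have "- ((-1) ^ (?n + 1) * (LINT z|lborel. (-1) ^ ?n * ((\<Prod>i\<in>UNIV. of_real (trapezoid (\<epsilon>\<^sup>2) h d ((norm (z $ i))\<^sup>2))) * G z)))
      = (LINT z|lborel. (\<Prod>i\<in>UNIV. of_real (trapezoid (\<epsilon>\<^sup>2) h d ((norm (z $ i))\<^sup>2))) * G z)"
      unfolding integral_mult_right_zero by (cases "even ?n") simp_all
    finally show ?thesis .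
  qed
  \<comment> \<open>letting the ramp width \<open>d\<close> tend to 0\<close>
  have shells: "(1 / of_real h) * (LINT z|lborel. indicator {R\<^sup>2<..R\<^sup>2 + h} ((norm z)\<^sup>2) * g z) =
      (1 / of_real h ^ ?n) * (LINT z|lborel. (\<Prod>i\<in>UNIV. indicator {\<epsilon>\<^sup>2<..\<epsilon>\<^sup>2 + h} ((norm (z $ i))\<^sup>2)) * G z)"
    if h: "h > 0" for h
  proof (rule LIMSEQ_unique)
    \<comment> \<open>A one-element index set specialises \<open>trapezoid_limit\<close> to the
      single radial function.\<close>
    have sphere_side: "(\<lambda>k. LINT z|lborel. (\<Prod>i\<in>{()}. of_real (trapezoid (R\<^sup>2) h (1 / real (Suc k)) ((norm z)\<^sup>2))) * g z) \<longlonglongrightarrow>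
      (1 / of_real h ^ card {()}) * (LINT z|lborel. (\<Prod>i\<in>{()}. indicator {R\<^sup>2<..R\<^sup>2 + h} ((norm z)\<^sup>2)) * g z)"
    proof (rule trapezoid_limit[OF h, where K = "{z. R\<^sup>2 \<le> (norm z)\<^sup>2 \<and> (norm z)\<^sup>2 \<le> R\<^sup>2 + h + 1}"])
      show "g \<in> borel_measurable borel"
        by (rule borel_measurable_extend_zero[OF _ cg]) (use g0 in auto)
      show "compact {z :: complex^'n::{finite,linorder}. R\<^sup>2 \<le> (norm z)\<^sup>2 \<and> (norm z)\<^sup>2 \<le> R\<^sup>2 + h + 1}"
        by (rule compact_norm_shell)
      show "continuous_on {z. R\<^sup>2 \<le> (norm z)\<^sup>2 \<and> (norm z)\<^sup>2 \<le> R\<^sup>2 + h + 1} g"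
        by (rule continuous_on_subset[OF cg]) (use R in auto)
      show "continuous_on UNIV (\<lambda>z :: complex^'n::{finite,linorder}. (norm z)\<^sup>2)"
        by (intro continuous_intros)
    qed simp_all
    then show "(\<lambda>k. LINT z|lborel. of_real (trapezoid (R\<^sup>2) h (1 / real (Suc k)) ((norm z)\<^sup>2)) * g z) \<longlonglongrightarrow>
      (1 / of_real h) * (LINT z|lborel. indicator {R\<^sup>2<..R\<^sup>2 + h} ((norm z)\<^sup>2) * g z)"
      by simp
    have "(\<lambda>k. LINT z|lborel. (\<Prod>i\<in>UNIV. of_real (trapezoid (\<epsilon>\<^sup>2) h (1 / real (Suc k)) ((norm (z $ i))\<^sup>2))) * G z) \<longlonglongrightarrow>
      (1 / of_real h ^ ?n) * (LINT z|lborel. (\<Prod>i\<in>UNIV. indicator {\<epsilon>\<^sup>2<..\<epsilon>\<^sup>2 + h} ((norm (z $ i))\<^sup>2)) * G z)"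
    proof (rule trapezoid_limit[OF h, where K = "polydisc_shell (\<epsilon>\<^sup>2) (\<epsilon>\<^sup>2 + h + 1) UNIV"])
      show "G \<in> borel_measurable borel"
        by (rule borel_measurable_extend_zero[OF oU cG]) (auto simp: G_def)
      show "compact (polydisc_shell (\<epsilon>\<^sup>2) (\<epsilon>\<^sup>2 + h + 1) UNIV :: (complex^'n::{finite,linorder}) set)"
        by (rule compact_polydisc_shell)
      show "continuous_on (polydisc_shell (\<epsilon>\<^sup>2) (\<epsilon>\<^sup>2 + h + 1) UNIV) G"
      proof (rule continuous_on_subset[OF cG])
        show "polydisc_shell (\<epsilon>\<^sup>2) (\<epsilon>\<^sup>2 + h + 1) UNIV \<subseteq> ?U"
        proof
          fix z :: "complex^'n::{finite,linorder}" assume "z \<in> polydisc_shell (\<epsilon>\<^sup>2) (\<epsilon>\<^sup>2 + h + 1) UNIV"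
          then have "\<epsilon>\<^sup>2 \<le> (norm (z $ i))\<^sup>2" for i by (simp only: polydisc_shell_def mem_Collect_eq) blast
          moreover have "0 < \<epsilon>\<^sup>2" using assms(1) by simp
          ultimately have "0 < (norm (z $ i))\<^sup>2" for i by (rule order_less_le_trans[rotated])
          then show "z \<in> ?U" by simp
        qed
      qed
      show "x \<in> polydisc_shell (\<epsilon>\<^sup>2) (\<epsilon>\<^sup>2 + h + 1) UNIV"
        if "\<And>i. i \<in> UNIV \<Longrightarrow> \<epsilon>\<^sup>2 \<le> (norm (x $ i))\<^sup>2 \<and> (norm (x $ i))\<^sup>2 \<le> \<epsilon>\<^sup>2 + h + 1"
        for x :: "complex^'n::{finite,linorder}"
        using that by (simp only: polydisc_shell_def mem_Collect_eq) blast
      show "continuous_on UNIV (\<lambda>z :: complex^'n::{finite,linorder}. (norm (z $ i))\<^sup>2)" for i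
        by (intro continuous_intros)
    qed simp_all
    moreover have "(LINT z|lborel. of_real (trapezoid (R\<^sup>2) h (1 / real (Suc k)) ((norm z)\<^sup>2)) * g z) =
        (LINT z|lborel. (\<Prod>i\<in>UNIV. of_real (trapezoid (\<epsilon>\<^sup>2) h (1 / real (Suc k)) ((norm (z $ i))\<^sup>2))) * G z)" for k
      by (rule smoothed) (use h in simp_all)
    ultimately show "(\<lambda>k. LINT z|lborel. of_real (trapezoid (R\<^sup>2) h (1 / real (Suc k)) ((norm z)\<^sup>2)) * g z) \<longlonglongrightarrow>
      (1 / of_real h ^ ?n) * (LINT z|lborel. (\<Prod>i\<in>UNIV. indicator {\<epsilon>\<^sup>2<..\<epsilon>\<^sup>2 + h} ((norm (z $ i))\<^sup>2)) * G z)"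
      by (simp only:)
  qed
  have dim: "DIM(complex^'n::{finite,linorder}) = 2 * ?n" by simp
  let ?C = "LINT t:cbox 0 (\<chi> i. 2 * pi)|lborel. G (torus_map \<epsilon> t)"
  \<comment> \<open>By \<open>shells\<close> the normalised integrals over the two shells agree for
    every h > 0, so their limits as h tends to 0 from the right agree.\<close>
  have residue: "of_real (real ?n / R\<^sup>2) * (LINT x:cball 0 R|lborel. g ((R / norm x) *\<^sub>R x)) =
      (1 / 2) ^ ?n * (LINT t:cbox 0 (\<chi> i. 2 * pi)|lborel. G (torus_map \<epsilon> t))"
  proof (rule tendsto_unique)
    show "((\<lambda>h. (1 / of_real h) * (LINT z|lborel. indicator {R\<^sup>2<..R\<^sup>2 + h} ((norm z)\<^sup>2) * g z)) \<longlongrightarrow>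
       of_real (real ?n / R\<^sup>2) * (LINT x:cball 0 R|lborel. g ((R / norm x) *\<^sub>R x))) (at_right 0)"
      by (rule annulus_limit_sphere[OF cg g0 R dim])
    show "((\<lambda>h. (1 / of_real h) * (LINT z|lborel. indicator {R\<^sup>2<..R\<^sup>2 + h} ((norm z)\<^sup>2) * g z)) \<longlongrightarrow>
       (1 / 2) ^ ?n * (LINT t:cbox 0 (\<chi> i. 2 * pi)|lborel. G (torus_map \<epsilon> t))) (at_right 0)"
    proof (rule Lim_transform_eventually[OF annulus_limit_torus[OF cG assms(1)]])
      show "\<forall>\<^sub>F h in at_right 0. (1 / of_real h ^ ?n) * (LINT z|lborel. (\<Prod>i\<in>UNIV. indicator {\<epsilon>\<^sup>2<..\<epsilon>\<^sup>2 + h} ((norm (z $ i))\<^sup>2)) * G z) =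
         (1 / of_real h) * (LINT z|lborel. indicator {R\<^sup>2<..R\<^sup>2 + h} ((norm z)\<^sup>2) * g z)"
        using eventually_at_right_less[of "0::real"] by eventually_elim (rule shells[symmetric])
    qed
  qed simp
  have "sphere_integral R \<theta> = (2 * \<i>) ^ ?n * (-1) ^ (?n * (?n - 1) div 2) *
     (of_real (real ?n / R\<^sup>2) * (LINT x:cball 0 R|lborel. g ((R / norm x) *\<^sub>R x)))"
    unfolding g_def by (rule sphere_integral_eq[OF assms(2) R])
  also have "\<dots> = (-1) ^ (?n * (?n - 1) div 2) * (((2 * \<i>) ^ ?n * (1 / 2) ^ ?n) * ?C)"
    unfolding residue by (simp only: mult_ac)
  also have "(2 * \<i>) ^ ?n * (1 / 2) ^ ?n = \<i> ^ ?n"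
    by (simp only: power_mult_distrib[symmetric]) simp
  also have "\<i> ^ ?n * ?C = torus_integral \<epsilon> (\<gamma> index_list)"
    unfolding G_def by (rule torus_integral_eq[OF assms(1) holo, symmetric])
  finally show ?thesis unfolding R_def .
qed

end
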